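(* Let $\mathcal{A}:=\{A_{(\alpha)}\}_{\alpha\in\mathbb{F}_n^+}$ and $\mathcal{B}:=\{B_{(\alpha)}\}_{\alpha\in\mathbb{F}_n^+}$ be sequences of operators in $B(\mathcal{H})$ such that $H_{\mathcal{A}}$ and $H_{\mathcal{B}}$ are noncommutative harmonic functions on $[B(\mathcal{X})^n]_{<1}$ and $$H_{\mathcal{A}}(X_1,\ldots,X_n)\leq H_{\mathcal{B}}(X_1,\ldots,X_n)\quad\text{for any }(X_1,\ldots,X_n)\in[B(\mathcal{X})^n]_{<1}\text{ and any Hilbert space }\mathcal{X}.$$ Then $$\sum_{|\alpha|=k}(B_{(\alpha)}-A_{(\alpha)})^*(B_{(\alpha)}-A_{(\alpha)})\leq\|B_{(0)}-A_{(0)}\|\,(B_{(0)}-A_{(0)})$$ for $k=1,2,\ldots$, and $$\sum_{k=1}^\infty r^k\left\|\sum_{|\alpha|=k}A_{(\alpha)}^*A_{(\alpha)}\right\|^{1/2}\leq\frac12\|B_{(0)}-A_{(0)}\|+\sum_{k=1}^\infty r^k\left\|\sum_{|\alpha|=k}B_{(\alpha)}^*B_{(\alpha)}\right\|^{1/2}$$ for any $r\in\left[0,\frac13\right]$.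
   Context: $\mathbb{F}_n^+$ is the unital free semigroup on $g_1,\dots,g_n$ with identity $g_0$; $|g_{i_1}\cdots g_{i_k}|=k$, $|g_0|=0$; $X_\alpha:=X_{i_1}\cdots X_{i_k}$ for $\alpha=g_{i_1}\cdots g_{i_k}$, $X_{g_0}:=I$. $[B(\mathcal{X})^n]_{<1}:=\{(X_1,\ldots,X_n)\in B(\mathcal{X})^n:\|X_1X_1^*+\cdots+X_nX_n^*\|<1\}$. A series $\sum_{k\ge0}\left(\sum_{|\alpha|=k}X_\alpha\otimes C_{(\alpha)}\right)$, $C_{(\alpha)}\in B(\mathcal{H})$, is a (universal) holomorphic function on $[B(\mathcal{X})^n]_{<1}$ if it converges in operator norm for every Hilbert space $\mathcal{X}$ and every $(X_1,\ldots,X_n)\in[B(\mathcal{X})^n]_{<1}$. Let $\mathcal{A}=\{A_{(\alpha)}\}_{\alpha\in\mathbb{F}_n^+}\subset B(\mathcal{H})$ with $A_{(0)}:=A_{(g_0)}=A_{(0)}^*$ be such that $F(X_1,\ldots,X_n)=\frac12I\otimes A_{(0)}+\sum_{k=1}^\infty\sum_{|\alpha|=k}X_\alpha\otimes A_{(\alpha)}$ is holomorphic on $[B(\mathcal{X})^n]_{<1}$; then the noncommutative harmonic function $H_{\mathcal{A}}$ is $H_{\mathcal{A}}(X_1,\ldots,X_n):=\mathrm{Re}\,F(X_1,\ldots,X_n)=\frac12(F(X_1,\dots,X_n)+F(X_1,\dots,X_n)^* )$. The same applies to $\mathcal{B}$ and $H_{\mathcal{B}}$; in particular $A_{(0)}$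 and $B_{(0)}$ are selfadjoint. *)

theory Defs
  imports "HOL-Analysis.Analysis" "HOL-Library.Function_Algebras" "HOL-Library.Infinite_Typeclass"
begin

section \<open>Complex Hilbert spaces\<close>

text \<open>
  A Hilbert space lives on a subset of an additive group type, so that a formula can quantify over
  all Hilbert spaces inside a type.  Functions are added pointwise (Function_Algebras).  The inner
  product is linear in the first argument and conjugate linear in the second one.
\<close>

record 'a hspace =
  hcarrier :: "'a set"
  hscale :: "complex \<Rightarrow> 'a \<Rightarrow> 'a"
  hip :: "'a \<Rightarrow> 'a \<Rightarrow> complex"

definition hnorm :: "'a hspace \<Rightarrow> 'a \<Rightarrow> real" where
  "hnorm K x = sqrt (Re (hip K x x))"

locale hilbert_space = vector_space "hscale K" for K :: "'a::ab_group_add hspace" +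
  assumes subspace_carrier: "subspace (hcarrier K)"
    and ip_add_left: "\<lbrakk>x \<in> hcarrier K; y \<in> hcarrier K; z \<in> hcarrier K\<rbrakk>
      \<Longrightarrow> hip K (x + y) z = hip K x z + hip K y z"
    and ip_scale_left: "\<lbrakk>x \<in> hcarrier K; y \<in> hcarrier K\<rbrakk>
      \<Longrightarrow> hip K (hscale K c x) y = c * hip K x y"
    and ip_cnj: "\<lbrakk>x \<in> hcarrier K; y \<in> hcarrier K\<rbrakk> \<Longrightarrow> hip K y x = cnj (hip K x y)"
    and ip_pos: "\<lbrakk>x \<in> hcarrier K; x \<noteq> 0\<rbrakk> \<Longrightarrow> Re (hip K x x) > 0"
    and complete: "\<lbrakk>\<And>m. s m \<in> hcarrier K;
        \<And>e. e > 0 \<Longrightarrow> \<exists>N. \<forall>m\<ge>N. \<forall>k\<ge>N. hnorm K (s m - s k) < e\<rbrakk>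
      \<Longrightarrow> \<exists>x\<in>hcarrier K. (\<lambda>m. hnorm K (s m - x)) \<longlonglongrightarrow> 0"


section \<open>Bounded operators\<close>

text \<open>
  The elements of B(K) vanish outside the carrier, so that equality of functions is equality of
  operators; sums and differences of operators are the pointwise ones.
\<close>

definition bops :: "'a::ab_group_add hspace \<Rightarrow> ('a \<Rightarrow> 'a) set" where
  "bops K = {T.
     (\<forall>x\<in>hcarrier K. T x \<in> hcarrier K) \<and> (\<forall>x. x \<notin> hcarrier K \<longrightarrow> T x = 0) \<and>
     (\<forall>x\<in>hcarrier K. \<forall>y\<in>hcarrier K. T (x + y) = T x + T y) \<and>
     (\<forall>c. \<forall>x\<in>hcarrier K. T (hscale K c x) = hscale K c (T x)) \<and>
     (\<exists>M. \<forall>x\<in>hcarrier K. hnorm K (T x) \<le> M * hnorm K x)}"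

definition id_op :: "'a::ab_group_add hspace \<Rightarrow> 'a \<Rightarrow> 'a" where
  "id_op K x = (if x \<in> hcarrier K then x else 0)"

definition scale_op :: "'a hspace \<Rightarrow> complex \<Rightarrow> ('a \<Rightarrow> 'a) \<Rightarrow> 'a \<Rightarrow> 'a" where
  "scale_op K c T = (\<lambda>x. hscale K c (T x))"

definition opnorm :: "'a hspace \<Rightarrow> ('a \<Rightarrow> 'a) \<Rightarrow> real" where
  "opnorm K T = Sup {hnorm K (T x) | x. x \<in> hcarrier K \<and> hnorm K x \<le> 1}"

definition adj :: "'a::ab_group_add hspace \<Rightarrow> ('a \<Rightarrow> 'a) \<Rightarrow> 'a \<Rightarrow> 'a" where
  "adj K T y = (if y \<in> hcarrier K
     then (THE z. z \<in> hcarrier K \<and> (\<forall>x\<in>hcarrier K. hip K (T x) y = hip K x z)) else 0)"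

definition op_le :: "'a::ab_group_add hspace \<Rightarrow> ('a \<Rightarrow> 'a) \<Rightarrow> ('a \<Rightarrow> 'a) \<Rightarrow> bool" where
  "op_le K S T \<longleftrightarrow> (\<forall>x\<in>hcarrier K. hip K (T x - S x) x \<in> \<real>\<^sub>\<ge>\<^sub>0)"

definition op_sums :: "'a::ab_group_add hspace \<Rightarrow> (nat \<Rightarrow> 'a \<Rightarrow> 'a) \<Rightarrow> ('a \<Rightarrow> 'a) \<Rightarrow> bool" where
  "op_sums K f T \<longleftrightarrow> T \<in> bops K \<and> (\<lambda>N. opnorm K (T - (\<Sum>k<N. f k))) \<longlonglongrightarrow> 0"


section \<open>The Hilbert space tensor product\<close>

definition onb :: "'a::ab_group_add hspace \<Rightarrow> 'a set \<Rightarrow> bool" where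
  "onb K E \<longleftrightarrow> E \<subseteq> hcarrier K \<and>
     (\<forall>e\<in>E. \<forall>f\<in>E. hip K e f = (if e = f then 1 else 0)) \<and>
     (\<forall>x\<in>hcarrier K. (\<forall>e\<in>E. hip K x e = 0) \<longrightarrow> x = 0)"

definition some_onb :: "'a::ab_group_add hspace \<Rightarrow> 'a set" where
  "some_onb K = (SOME E. onb K E)"

context hilbert_space
begin

lemmas carrier_simps [simp] =
  subspace_0[OF subspace_carrier] subspace_add[OF subspace_carrier]
  subspace_diff[OF subspace_carrier] subspace_neg[OF subspace_carrier]
  subspace_scale[OF subspace_carrier]

lemma ip_zero_left [simp]: "x \<in> hcarrier K \<Longrightarrow> hip K 0 x = 0"
  using ip_add_left[of 0 0 x] by simp

lemma ip_zero_right [simp]: "x \<in> hcarrier K \<Longrightarrow> hip K x 0 = 0"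
  using ip_cnj[of 0 x] by simp

lemma ip_add_right:
  "\<lbrakk>x \<in> hcarrier K; y \<in> hcarrier K; z \<in> hcarrier K\<rbrakk> \<Longrightarrow> hip K x (y + z) = hip K x y + hip K x z"
  using ip_cnj[of "y + z" x] ip_cnj[of y x] ip_cnj[of z x] ip_add_left[of y z x] by simp

lemma ip_scale_right:
  "\<lbrakk>x \<in> hcarrier K; y \<in> hcarrier K\<rbrakk> \<Longrightarrow> hip K x (hscale K c y) = cnj c * hip K x y"
  using ip_cnj[of "hscale K c y" x] ip_cnj[of y x] ip_scale_left[of y x c] by simp

lemma ip_diff_left:
  "\<lbrakk>x \<in> hcarrier K; y \<in> hcarrier K; z \<in> hcarrier K\<rbrakk> \<Longrightarrow> hip K (x - y) z = hip K x z - hip K y z"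
  using ip_add_left[of "x - y" y z] by simp

lemma ip_diff_right:
  "\<lbrakk>x \<in> hcarrier K; y \<in> hcarrier K; z \<in> hcarrier K\<rbrakk> \<Longrightarrow> hip K x (y - z) = hip K x y - hip K x z"
  using ip_add_right[of x "y - z" z] by simp

lemmas ip_simps = ip_add_left ip_add_right ip_scale_left ip_scale_right ip_diff_left ip_diff_right

lemma ip_self: "x \<in> hcarrier K \<Longrightarrow> hip K x x = of_real ((hnorm K x)\<^sup>2)"
proof -
  assume x: "x \<in> hcarrier K"
  have "Im (hip K x x) = 0"
    using ip_cnj[OF x x] by (metis cnj.simps(2) neg_equal_zero)
  moreover have "Re (hip K x x) \<ge> 0"
    using ip_pos[OF x] x by (cases "x = 0") auto
  ultimately show ?thesis by (simp add: hnorm_def complex_eq_iff)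
qed

lemma hnorm_nonneg [simp]: "x \<in> hcarrier K \<Longrightarrow> hnorm K x \<ge> 0"
  using ip_pos[of x] by (cases "x = 0") (auto simp: hnorm_def)

lemma hnorm_eq_0: "x \<in> hcarrier K \<Longrightarrow> hnorm K x = 0 \<longleftrightarrow> x = 0"
  using ip_pos[of x] by (cases "x = 0") (auto simp: hnorm_def)

lemma hnorm_sq: "x \<in> hcarrier K \<Longrightarrow> (hnorm K x)\<^sup>2 = Re (hip K x x)"
  by (simp add: ip_self)

lemma hnorm_scale: "x \<in> hcarrier K \<Longrightarrow> hnorm K (hscale K c x) = cmod c * hnorm K x"
proof -
  assume x: "x \<in> hcarrier K"
  have "hip K (hscale K c x) (hscale K c x) = (c * cnj c) * hip K x x"
    by (simp only: ip_scale_left[OF x carrier_simps(5)[OF x]] ip_scale_right[OF x x] mult.assoc)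
  also have "\<dots> = of_real ((cmod c * hnorm K x)\<^sup>2)"
    unfolding ip_self[OF x] complex_norm_square[symmetric] by (simp add: power_mult_distrib)
  finally have "Re (hip K (hscale K c x) (hscale K c x)) = (cmod c * hnorm K x)\<^sup>2"
    by (simp only: Re_complex_of_real)
  then show ?thesis
    using x by (simp add: hnorm_def[of K "hscale K c x"])
qed

lemma Cauchy_Schwarz:
  assumes x: "x \<in> hcarrier K" and y: "y \<in> hcarrier K"
  shows "cmod (hip K x y) \<le> hnorm K x * hnorm K y"
proof (cases "y = 0")
  case True then show ?thesis using x y by (simp add: hnorm_def)
next
  case False
  let ?N = "(hnorm K y)\<^sup>2" and ?a = "hip K x y"
  have N: "?N > 0" using hnorm_eq_0[OF y] False by simp
  define w where "w = hscale K (of_real ?N) x - hscale K ?a y"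
  have "0 \<le> Re (hip K w w)" using x y by (simp add: w_def flip: hnorm_sq)
  also have "hip K w w = of_real (?N\<^sup>2 * (hnorm K x)\<^sup>2 - ?N * (cmod ?a)\<^sup>2)"
    using x y ip_cnj[OF x y] complex_norm_square[of ?a]
    by (simp add: w_def ip_simps ip_self[OF x] ip_self[OF y] algebra_simps power2_eq_square)
  finally have "0 \<le> ?N * (?N * (hnorm K x)\<^sup>2 - (cmod ?a)\<^sup>2)"
    by (simp add: algebra_simps power2_eq_square)
  then have "(cmod ?a)\<^sup>2 \<le> (hnorm K x * hnorm K y)\<^sup>2"
    using N by (simp add: zero_le_mult_iff power_mult_distrib mult.commute)
  then show ?thesis using x y by (meson hnorm_nonneg mult_nonneg_nonneg power2_le_imp_le)
qed

lemma Riesz: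
  assumes mem: "\<And>c x. x \<in> hcarrier K \<Longrightarrow> f (hscale K c x) = c * f x"
    and add: "\<And>x y. x \<in> hcarrier K \<Longrightarrow> y \<in> hcarrier K \<Longrightarrow> f (x + y) = f x + f y"
    and bd: "\<And>x. x \<in> hcarrier K \<Longrightarrow> cmod (f x) \<le> M * hnorm K x"
  shows "\<exists>z\<in>hcarrier K. \<forall>x\<in>hcarrier K. f x = hip K x z"
proof -
  let ?V = "hcarrier K"
  define J where "J x = (hnorm K x)\<^sup>2 - 2 * Re (f x)" for x
  define m where "m = Inf (J ` ?V)"
  have f_diff: "f (x - y) = f x - f y" if "x \<in> ?V" "y \<in> ?V" for x y
    using add[of "x - y" y] that by simp
  have low: "- M\<^sup>2 \<le> J x" if x: "x \<in> ?V" for x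
  proof -
    have "Re (f x) \<le> M * hnorm K x"
      using bd[OF x] complex_Re_le_cmod[of "f x"] by linarith
    moreover have "0 \<le> (hnorm K x - M)\<^sup>2" by simp
    ultimately show ?thesis by (simp add: J_def power2_eq_square algebra_simps)
  qed
  have bdd: "bdd_below (J ` ?V)" using low by (auto intro!: bdd_belowI)
  have m_le: "m \<le> J x" if "x \<in> ?V" for x
    unfolding m_def using bdd that by (auto intro: cInf_lower)
  have "\<exists>x\<in>?V. J x < m + 1 / Suc k" for k
    using cInf_lessD[of "J ` ?V" "m + 1 / Suc k"] carrier_simps(1) unfolding m_def by fastforce
  then obtain s where s: "\<And>k. s k \<in> ?V" "\<And>k. J (s k) < m + 1 / Suc k" by metis
  have par: "(hnorm K (x - y))\<^sup>2 \<le> 2 * (J x - m) + 2 * (J y - m)" if x: "x \<in> ?V" and y: "y \<in> ?V" for x y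
  proof -
    define h where "h = hscale K (1/2) (x + y)"
    have h: "h \<in> ?V" using x y by (simp add: h_def)
    have "hnorm K h = hnorm K (x + y) / 2" "f h = (f x + f y) / 2"
      unfolding h_def using x y by (subst hnorm_scale mem; simp add: add)+
    then have "(hnorm K h)\<^sup>2 = (hnorm K (x + y))\<^sup>2 / 4" "Re (f h) = (Re (f x) + Re (f y)) / 2"
      by (simp_all only: power_divide Re_divide_numeral plus_complex.sel) simp
    then have "4 * J h = (hnorm K (x + y))\<^sup>2 - 4 * Re (f x + f y)"
      unfolding J_def by (simp add: field_simps)
    moreover have "(hnorm K (x + y))\<^sup>2 + (hnorm K (x - y))\<^sup>2 = 2 * (hnorm K x)\<^sup>2 + 2 * (hnorm K y)\<^sup>2"
      using x y by (simp add: hnorm_sq ip_simps)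
    ultimately show ?thesis using m_le[OF h] by (simp add: J_def algebra_simps)
  qed
  have "\<exists>N. \<forall>i\<ge>N. \<forall>k\<ge>N. hnorm K (s i - s k) < e" if e: "e > 0" for e
  proof -
    obtain N where N: "1 / Suc N < e\<^sup>2 / 4"
      using nat_approx_posE[of "e\<^sup>2 / 4"] e by (metis zero_less_divide_iff zero_less_numeral zero_less_power)
    have "hnorm K (s i - s k) < e" if "i \<ge> N" "k \<ge> N" for i k
    proof -
      have arith: "p < q" if "a \<le> c" "b \<le> c" "p \<le> 2 * (u - m) + 2 * (v - m)" "u < m + a" "v < m + b"
        "4 * c < q" for a b c p q u v :: real
        using that by argo
      have "(hnorm K (s i - s k))\<^sup>2 < e\<^sup>2"
        by (rule arith[of _ "1 / Suc N", OF _ _ par s(2) s(2)]) (use that s(1) N in \<open>simp_all add: frac_le\<close>)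
      then show ?thesis using e by (meson less_imp_le power2_less_imp_less)
    qed
    then show ?thesis by blast
  qed
  from complete[of s, OF s(1) this] obtain z where z: "z \<in> ?V"
    and lim: "(\<lambda>k. hnorm K (s k - z)) \<longlonglongrightarrow> 0" by blast
  have Jadd: "J (z + w) = J z + 2 * Re (hip K w z - f w) + (hnorm K w)\<^sup>2" if w: "w \<in> ?V" for w
  proof -
    have "Re (hip K z w) = Re (hip K w z)" using ip_cnj[OF w z] by simp
    then show ?thesis using w z by (simp add: J_def hnorm_sq ip_simps add)
  qed
  have Jz: "J z \<le> m"
  proof (rule LIMSEQ_le)
    let ?d = "\<lambda>k. hnorm K (s k - z)"
    have "(\<lambda>k. m + 1 / Suc k + 2 * (?d k * hnorm K z + M * ?d k))
        \<longlonglongrightarrow> m + 0 + 2 * (0 * hnorm K z + M * 0)"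
      by (intro tendsto_add tendsto_mult tendsto_const lim
          LIMSEQ_inverse_real_of_nat[unfolded inverse_eq_divide])
    then show "(\<lambda>k. m + 1 / Suc k + 2 * (?d k * hnorm K z + M * ?d k)) \<longlonglongrightarrow> m" by simp
    show "(\<lambda>k. J z) \<longlonglongrightarrow> J z" by simp
    have "J z \<le> m + 1 / Suc k + 2 * (?d k * hnorm K z + M * ?d k)" for k
    proof -
      let ?w = "s k - z"
      have w: "?w \<in> ?V" using s(1) z by simp
      have "- (hnorm K ?w * hnorm K z) - M * hnorm K ?w \<le> Re (hip K ?w z - f ?w)"
        using Cauchy_Schwarz[OF w z] bd[OF w] abs_Re_le_cmod[of "hip K ?w z"] abs_Re_le_cmod[of "f ?w"]
        by simp
      moreover have "J (s k) = J z + 2 * Re (hip K ?w z - f ?w) + (hnorm K ?w)\<^sup>2"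
        using Jadd[OF w] by simp
      moreover have "0 \<le> (hnorm K ?w)\<^sup>2" by simp
      ultimately show ?thesis using s(2)[of k] by (smt (verit))
    qed
    then show "\<exists>N. \<forall>n\<ge>N. J z \<le> m + 1 / Suc n + 2 * (?d n * hnorm K z + M * ?d n)" by blast
  qed
  have "f x = hip K x z" if x: "x \<in> ?V" for x
  proof (rule ccontr)
    assume "f x \<noteq> hip K x z"
    define g where "g = hip K x z - f x"
    have g: "g \<noteq> 0" using \<open>f x \<noteq> hip K x z\<close> by (simp add: g_def)
    define t where "t = 1 / (1 + (hnorm K x)\<^sup>2)"
    have t: "t > 0" "t * (hnorm K x)\<^sup>2 < 1" by (simp_all add: t_def add_pos_nonneg field_simps)
    define w where "w = hscale K (- of_real t * cnj g) x"
    have w: "w \<in> ?V" using x by (simp add: w_def)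
    have "hip K w z - f w = - of_real t * cnj g * g"
      unfolding w_def ip_scale_left[OF x z] mem[OF x] g_def right_diff_distrib ..
    also have "\<dots> = of_real (- t * (cmod g)\<^sup>2)"
      using complex_norm_square[of g] by (simp add: mult_ac)
    finally have "Re (hip K w z - f w) = - t * (cmod g)\<^sup>2" by simp
    moreover have "hnorm K w = t * cmod g * hnorm K x"
      unfolding w_def hnorm_scale[OF x] using t by (simp add: norm_mult)
    ultimately have "0 \<le> - 2 * (t * (cmod g)\<^sup>2) + (t * (hnorm K x)\<^sup>2) * (t * (cmod g)\<^sup>2)"
      using Jadd[OF w] Jz m_le[of "z + w"] w z by (simp add: power2_eq_square mult_ac)
    moreover have p: "0 < t * (cmod g)\<^sup>2" using t g by simp
    moreover have "(t * (hnorm K x)\<^sup>2) * (t * (cmod g)\<^sup>2) < 1 * (t * (cmod g)\<^sup>2)"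
      using t(2) p by (rule mult_strict_right_mono)
    ultimately show False by linarith
  qed
  then show ?thesis using z by blast
qed

lemma ip_ext:
  assumes "y \<in> hcarrier K" "z \<in> hcarrier K" "\<And>x. x \<in> hcarrier K \<Longrightarrow> hip K x y = hip K x z"
  shows "y = z"
  using assms(3)[of "y - z"] assms(1,2) ip_pos[of "y - z"]
  by (metis carrier_simps(3) ip_diff_right order_less_irrefl right_minus_eq zero_complex.sel(1))

lemma adj_props:
  assumes T: "T \<in> bops K" and y: "y \<in> hcarrier K"
  shows "adj K T y \<in> hcarrier K" "\<And>x. x \<in> hcarrier K \<Longrightarrow> hip K (T x) y = hip K x (adj K T y)"
proof -
  let ?P = "\<lambda>z. z \<in> hcarrier K \<and> (\<forall>x\<in>hcarrier K. hip K (T x) y = hip K x z)"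
  from T obtain M where M: "\<forall>x\<in>hcarrier K. hnorm K (T x) \<le> M * hnorm K x"
    by (auto simp: bops_def)
  have "\<exists>z\<in>hcarrier K. \<forall>x\<in>hcarrier K. hip K (T x) y = hip K x z"
  proof (rule Riesz)
    fix x assume x: "x \<in> hcarrier K"
    then have Tx: "T x \<in> hcarrier K" using T by (simp add: bops_def)
    show "hip K (T (hscale K c x)) y = c * hip K (T x) y" for c
      using T x Tx y by (simp add: bops_def ip_scale_left)
    show "hip K (T (x + x')) y = hip K (T x) y + hip K (T x') y" if "x' \<in> hcarrier K" for x'
      using T x y that by (simp add: bops_def ip_add_left)
    have "cmod (hip K (T x) y) \<le> hnorm K (T x) * hnorm K y" by (rule Cauchy_Schwarz[OF Tx y])
    also have "\<dots> \<le> M * hnorm K x * hnorm K y" using M x y by (simp add: mult_right_mono)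
    finally show "cmod (hip K (T x) y) \<le> M * hnorm K y * hnorm K x" by (simp add: mult_ac)
  qed
  then have "\<exists>!z. ?P z" using ip_ext by (metis (no_types, lifting))
  from theI'[OF this] show "adj K T y \<in> hcarrier K"
    "\<And>x. x \<in> hcarrier K \<Longrightarrow> hip K (T x) y = hip K x (adj K T y)"
    using y by (auto simp: adj_def)
qed

lemma onb_exists: "\<exists>E. onb K E"
proof -
  let ?O = "\<lambda>E. E \<subseteq> hcarrier K \<and> (\<forall>e\<in>E. \<forall>f\<in>E. hip K e f = (if e = f then 1 else 0))"
  have "\<exists>M\<in>{E. ?O E}. \<forall>Y\<in>{E. ?O E}. M \<subseteq> Y \<longrightarrow> Y = M"
  proof (rule subset_Zorn_nonempty)
    show "{E. ?O E} \<noteq> {}" by blast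
    fix C assume C: "C \<noteq> {}" "subset.chain {E. ?O E} C"
    then have sub: "\<And>E. E \<in> C \<Longrightarrow> ?O E" and ch: "\<And>E F. E \<in> C \<Longrightarrow> F \<in> C \<Longrightarrow> E \<subseteq> F \<or> F \<subseteq> E"
      by (auto simp: subset_chain_def)
    show "\<Union>C \<in> {E. ?O E}"
    proof (intro CollectI conjI ballI)
      show "\<Union>C \<subseteq> hcarrier K" using sub by blast
      fix e f assume "e \<in> \<Union>C" "f \<in> \<Union>C"
      then obtain E where "E \<in> C" "e \<in> E" "f \<in> E" using ch by blast
      then show "hip K e f = (if e = f then 1 else 0)" using sub by blast
    qed
  qed
  then obtain E where E0: "E \<in> {E. ?O E}" and mx0: "\<forall>Y\<in>{E. ?O E}. E \<subseteq> Y \<longrightarrow> Y = E"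
    by (rule bexE)
  have E: "?O E" using E0 by (rule CollectD)
  have mx: "Y = E" if "?O Y" "E \<subseteq> Y" for Y
    using mx0[unfolded Ball_def, THEN spec[of _ Y]] that by simp
  have "x = 0" if x: "x \<in> hcarrier K" and orth: "\<forall>e\<in>E. hip K x e = 0" for x
  proof (rule ccontr)
    assume "x \<noteq> 0"
    then have n: "hnorm K x \<noteq> 0" using hnorm_eq_0[OF x] by simp
    define u where "u = hscale K (of_real (1 / hnorm K x)) x"
    have u: "u \<in> hcarrier K" using x by (simp add: u_def)
    have uu: "hip K u u = 1" using x n unfolding u_def
      by (simp add: ip_self hnorm_scale norm_divide del: of_real_divide)
    have ue: "hip K u e = 0" "hip K e u = 0" if "e \<in> E" for e
      using that orth x E ip_cnj[of u e] u by (auto simp: u_def ip_simps subset_iff)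
    have uE: "u \<notin> E" using ue uu by auto
    then have "?O (insert u E)" using E u uu ue by auto
    from mx[OF this] uE show False by blast
  qed
  then show ?thesis using E unfolding onb_def by blast
qed

lemma onb_some_onb: "onb K (some_onb K)"
  unfolding some_onb_def using onb_exists by (rule someI_ex)

lemma Bessel:
  assumes E: "onb K E" and x: "x \<in> hcarrier K" and F: "finite F" "F \<subseteq> E"
  shows "(\<Sum>e\<in>F. (cmod (hip K x e))\<^sup>2) \<le> (hnorm K x)\<^sup>2"
proof -
  have "\<exists>p\<in>hcarrier K. (\<forall>e\<in>E. hip K p e = (if e \<in> F then hip K x e else 0)) \<and>
      hip K p x = of_real (\<Sum>e\<in>F. (cmod (hip K x e))\<^sup>2) \<and>
      hip K p p = of_real (\<Sum>e\<in>F. (cmod (hip K x e))\<^sup>2)"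
    using F
  proof (induction F)
    case empty
    show ?case using x E by (intro bexI[of _ 0]) (auto simp: onb_def subset_iff)
  next
    case (insert a F)
    then obtain p where p: "p \<in> hcarrier K" "\<forall>e\<in>E. hip K p e = (if e \<in> F then hip K x e else 0)"
      "hip K p x = of_real (\<Sum>e\<in>F. (cmod (hip K x e))\<^sup>2)"
      "hip K p p = of_real (\<Sum>e\<in>F. (cmod (hip K x e))\<^sup>2)" by auto
    have a: "a \<in> hcarrier K" "a \<in> E" using insert.prems E by (auto simp: onb_def)
    have aa: "\<And>e. e \<in> E \<Longrightarrow> hip K a e = (if e = a then 1 else 0)" using E a by (auto simp: onb_def)
    have pa: "hip K p a = 0" "hip K a p = 0" using p a insert.hyps ip_cnj[of p a] by auto
    let ?c = "hip K x a"
    show ?case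
    proof (intro bexI[of _ "p + hscale K ?c a"] conjI ballI)
      show "p + hscale K ?c a \<in> hcarrier K" using p a by simp
      fix e assume e: "e \<in> E"
      then have "e \<in> hcarrier K" using E by (auto simp: onb_def)
      then show "hip K (p + hscale K ?c a) e = (if e \<in> insert a F then hip K x e else 0)"
        using p a aa e insert.hyps by (auto simp: ip_simps)
    next
      show "hip K (p + hscale K ?c a) x = of_real (\<Sum>e\<in>insert a F. (cmod (hip K x e))\<^sup>2)"
        using p a x ip_cnj[OF x a(1)] insert.hyps complex_norm_square[of ?c]
        by (simp add: ip_simps)
      show "hip K (p + hscale K ?c a) (p + hscale K ?c a) = of_real (\<Sum>e\<in>insert a F. (cmod (hip K x e))\<^sup>2)"
        using p a x aa pa insert.hyps complex_norm_square[of ?c]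
        by (simp add: ip_simps)
    qed
  qed
  then obtain p where p: "p \<in> hcarrier K" "hip K p x = of_real (\<Sum>e\<in>F. (cmod (hip K x e))\<^sup>2)"
    "hip K p p = of_real (\<Sum>e\<in>F. (cmod (hip K x e))\<^sup>2)" by blast
  have "0 \<le> (hnorm K (x - p))\<^sup>2" by simp
  also have "(hnorm K (x - p))\<^sup>2 = (hnorm K x)\<^sup>2 - (\<Sum>e\<in>F. (cmod (hip K x e))\<^sup>2)"
    using p x ip_cnj[OF p(1) x] by (simp add: hnorm_sq ip_simps del: of_real_sum)
  finally show ?thesis by simp
qed

lemma Bessel_summable:
  assumes "onb K E" "x \<in> hcarrier K"
  shows "(\<lambda>e. (cmod (hip K x e))\<^sup>2) summable_on E"
  by (rule nonneg_bdd_above_summable_on) (auto intro!: bdd_aboveI2 Bessel assms)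

lemma Parseval:
  assumes E: "onb K E" and x: "x \<in> hcarrier K" and y: "y \<in> hcarrier K"
  shows "((\<lambda>e. hip K x e * hip K e y) has_sum hip K x y) E"
proof -
  let ?V = "hcarrier K"
  have EV: "e \<in> ?V" if "e \<in> E" for e using that E by (auto simp: onb_def)
  have fin: "(\<Sum>e\<in>F. cmod (hip K x e * hip K e y)) \<le> hnorm K x * hnorm K y"
    if x: "x \<in> ?V" and F: "finite F" "F \<subseteq> E" for x F
  proof -
    have "(\<Sum>e\<in>F. cmod (hip K x e * hip K e y)) = (\<Sum>e\<in>F. cmod (hip K x e) * cmod (hip K y e))"
      using F EV y ip_cnj by (intro sum.cong refl) (metis complex_mod_cnj norm_mult subsetD)
    also have "\<dots> \<le> L2_set (\<lambda>e. cmod (hip K x e)) F * L2_set (\<lambda>e. cmod (hip K y e)) F"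
      using L2_set_mult_ineq[of "\<lambda>e. cmod (hip K x e)" "\<lambda>e. cmod (hip K y e)" F] by simp
    also have "\<dots> \<le> hnorm K x * hnorm K y"
      using Bessel[OF E x F] Bessel[OF E y F] x y
      by (intro mult_mono) (auto simp: L2_set_def intro!: real_le_lsqrt sum_nonneg)
    finally show ?thesis .
  qed
  have asum: "(\<lambda>e. cmod (hip K x e * hip K e y)) summable_on E" if "x \<in> ?V" for x
    by (rule nonneg_bdd_above_summable_on) (auto intro!: bdd_aboveI2 fin that)
  note sumb = abs_summable_summable[OF asum]
  define f where "f x = (\<Sum>\<^sub>\<infinity>e\<in>E. hip K x e * hip K e y)" for x
  have "\<exists>z\<in>?V. \<forall>x\<in>?V. f x = hip K x z"
  proof (rule Riesz)
    fix c x assume x: "x \<in> ?V"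
    show "f (hscale K c x) = c * f x"
      unfolding f_def infsum_cmult_right'[symmetric]
      using x EV by (intro infsum_cong) (simp add: ip_simps mult_ac)
  next
    fix x x' assume x: "x \<in> ?V" "x' \<in> ?V"
    have "f (x + x') = (\<Sum>\<^sub>\<infinity>e\<in>E. hip K x e * hip K e y + hip K x' e * hip K e y)"
      unfolding f_def using x EV by (intro infsum_cong) (simp add: ip_simps algebra_simps)
    also have "\<dots> = f x + f x'" unfolding f_def by (intro infsum_add sumb x)
    finally show "f (x + x') = f x + f x'" .
  next
    fix x assume x: "x \<in> ?V"
    have "cmod (f x) \<le> (\<Sum>\<^sub>\<infinity>e\<in>E. cmod (hip K x e * hip K e y))"
      unfolding f_def by (rule norm_infsum_bound[OF asum[OF x]])
    also have "\<dots> \<le> hnorm K x * hnorm K y"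
      by (rule infsum_le_finite_sums[OF asum[OF x]]) (use fin x in auto)
    finally show "cmod (f x) \<le> hnorm K y * hnorm K x" by (simp add: mult.commute)
  qed
  then obtain z where z: "z \<in> ?V" "\<And>x. x \<in> ?V \<Longrightarrow> f x = hip K x z" by blast
  have "hip K (z - y) e = 0" if e: "e \<in> E" for e
  proof -
    have "f e = hip K e e * hip K e y"
      unfolding f_def using e E
      by (subst infsum_cong_neutral[where T = "{e}" and g = "\<lambda>e. hip K e e * hip K e y"])
        (auto simp: onb_def)
    then have "hip K e z = hip K e y" using z(2)[OF EV[OF e]] e E by (simp add: onb_def)
    then have "hip K z e = hip K y e" using ip_cnj[OF EV[OF e] z(1)] ip_cnj[OF EV[OF e] y] by simp
    then show ?thesis using z(1) y EV[OF e] by (simp add: ip_simps)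
  qed
  then have "z - y = 0" using E z(1) y unfolding onb_def by (meson carrier_simps(3))
  then have "f x = hip K x y" using z(2)[OF x] by simp
  then show ?thesis using sumb[OF x] unfolding f_def by (metis has_sum_infsum)
qed

end

text \<open>
  \<open>X \<otimes> H\<close> is realised as the space of conjugate linear Hilbert-Schmidt operators from \<open>X\<close> to \<open>H\<close>
  with the Hilbert-Schmidt inner product, which does not depend on the orthonormal basis of \<open>X\<close>.
  The elementary tensor \<open>x \<otimes> h\<close> is the map \<open>y \<mapsto> \<langle>x, y\<rangle> h\<close>, and \<open>T \<otimes> C\<close> is \<open>\<Phi> \<mapsto> C \<circ> \<Phi> \<circ> T\<^sup>*\<close>; the
  lemmas \<open>hip_tensor_vec\<close> and \<open>tensor_op_tensor_vec\<close> below give the defining identities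
  \<open>\<langle>x \<otimes> h, x' \<otimes> h'\<rangle> = \<langle>x, x'\<rangle> \<langle>h, h'\<rangle>\<close> and \<open>(T \<otimes> C) (x \<otimes> h) = T x \<otimes> C h\<close>.
\<close>

definition tensor :: "'x::ab_group_add hspace \<Rightarrow> 'h::ab_group_add hspace \<Rightarrow> ('x \<Rightarrow> 'h) hspace" where
  "tensor X H = \<lparr>
     hcarrier = {\<Phi>.
       (\<forall>x\<in>hcarrier X. \<Phi> x \<in> hcarrier H) \<and> (\<forall>x. x \<notin> hcarrier X \<longrightarrow> \<Phi> x = 0) \<and>
       (\<forall>x\<in>hcarrier X. \<forall>y\<in>hcarrier X. \<Phi> (x + y) = \<Phi> x + \<Phi> y) \<and>
       (\<forall>c. \<forall>x\<in>hcarrier X. \<Phi> (hscale X c x) = hscale H (cnj c) (\<Phi> x)) \<and>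
       (\<exists>M. \<forall>x\<in>hcarrier X. hnorm H (\<Phi> x) \<le> M * hnorm X x) \<and>
       (\<lambda>e. (hnorm H (\<Phi> e))\<^sup>2) summable_on some_onb X},
     hscale = (\<lambda>c \<Phi> y. hscale H c (\<Phi> y)),
     hip = (\<lambda>\<Phi> \<Psi>. \<Sum>\<^sub>\<infinity>e\<in>some_onb X. hip H (\<Phi> e) (\<Psi> e))\<rparr>"

definition tensor_vec :: "'x hspace \<Rightarrow> 'h::ab_group_add hspace \<Rightarrow> 'x \<Rightarrow> 'h \<Rightarrow> 'x \<Rightarrow> 'h" where
  "tensor_vec X H x h = (\<lambda>y. if y \<in> hcarrier X then hscale H (hip X x y) h else 0)"

definition tensor_op :: "'x::ab_group_add hspace \<Rightarrow> 'h::ab_group_add hspace \<Rightarrow>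
    ('x \<Rightarrow> 'x) \<Rightarrow> ('h \<Rightarrow> 'h) \<Rightarrow> ('x \<Rightarrow> 'h) \<Rightarrow> ('x \<Rightarrow> 'h)" where
  "tensor_op X H T C \<Phi> =
     (if \<Phi> \<in> hcarrier (tensor X H) then (\<lambda>y. C (\<Phi> (adj X T y))) else 0)"

lemma tensor_vec_in_tensor:
  assumes "hilbert_space X" "hilbert_space H" and x: "x \<in> hcarrier X" and h: "h \<in> hcarrier H"
  shows "tensor_vec X H x h \<in> hcarrier (tensor X H)"
proof -
  interpret X: hilbert_space X by fact
  interpret H: hilbert_space H by fact
  have E: "onb X (some_onb X)" by (rule X.onb_some_onb)
  then have EX: "e \<in> hcarrier X" if "e \<in> some_onb X" for e using that by (auto simp: onb_def)
  have "(\<lambda>e. (hnorm H (tensor_vec X H x h e))\<^sup>2) summable_on some_onb X \<longleftrightarrow>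
      (\<lambda>e. (cmod (hip X x e))\<^sup>2 * (hnorm H h)\<^sup>2) summable_on some_onb X"
    using EX h by (intro summable_on_cong) (simp add: tensor_vec_def H.hnorm_scale power_mult_distrib)
  moreover have "\<dots>" using X.Bessel_summable[OF E x] by (rule summable_on_cmult_left)
  moreover have "\<exists>M. \<forall>y\<in>hcarrier X. hnorm H (tensor_vec X H x h y) \<le> M * hnorm X y"
  proof (intro exI ballI)
    fix y assume "y \<in> hcarrier X"
    then show "hnorm H (tensor_vec X H x h y) \<le> (hnorm X x * hnorm H h) * hnorm X y"
      using mult_right_mono[OF X.Cauchy_Schwarz[OF x, of y], of "hnorm H h"] h
      by (simp add: tensor_vec_def H.hnorm_scale mult_ac)
  qed
  ultimately show ?thesis
    using x h by (simp add: tensor_def)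
      (simp add: tensor_vec_def X.ip_simps H.scale_left_distrib)
qed

lemma hip_tensor_vec:
  assumes "hilbert_space X" "hilbert_space H"
    and x: "x \<in> hcarrier X" "x' \<in> hcarrier X" and h: "h \<in> hcarrier H" "h' \<in> hcarrier H"
  shows "hip (tensor X H) (tensor_vec X H x h) (tensor_vec X H x' h') = hip X x x' * hip H h h'"
proof -
  interpret X: hilbert_space X by fact
  interpret H: hilbert_space H by fact
  have E: "onb X (some_onb X)" by (rule X.onb_some_onb)
  then have EX: "e \<in> hcarrier X" if "e \<in> some_onb X" for e using that by (auto simp: onb_def)
  have "hip (tensor X H) (tensor_vec X H x h) (tensor_vec X H x' h') =
      (\<Sum>\<^sub>\<infinity>e\<in>some_onb X. hip X x e * hip X e x' * hip H h h')"
    unfolding tensor_def using EX h x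
    by (auto intro!: infsum_cong simp: tensor_vec_def H.ip_simps X.ip_cnj[of x' ] )
  also have "\<dots> = hip X x x' * hip H h h'"
    using X.Parseval[OF E x] by (intro infsumI has_sum_cmult_left)
  finally show ?thesis .
qed

lemma tensor_op_tensor_vec:
  assumes "hilbert_space X" "hilbert_space H" and T: "T \<in> bops X" and C: "C \<in> bops H"
    and x: "x \<in> hcarrier X" and h: "h \<in> hcarrier H"
  shows "tensor_op X H T C (tensor_vec X H x h) = tensor_vec X H (T x) (C h)"
proof
  interpret X: hilbert_space X by fact
  interpret H: hilbert_space H by fact
  fix y
  have C0: "C 0 = 0" using C H.carrier_simps(1) by (force simp: bops_def)
  show "tensor_op X H T C (tensor_vec X H x h) y = tensor_vec X H (T x) (C h) y"
  proof (cases "y \<in> hcarrier X")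
    case True
    then show ?thesis
      using tensor_vec_in_tensor[OF assms(1,2) x h] X.adj_props[OF T True] x h C
      by (simp add: tensor_op_def tensor_vec_def bops_def)
  next
    case False
    then show ?thesis
      using tensor_vec_in_tensor[OF assms(1,2) x h] x C0
      by (simp add: tensor_op_def tensor_vec_def adj_def)
  qed
qed


section \<open>Noncommutative holomorphic and harmonic functions\<close>

text \<open>
  An element \<open>g\<^bsub>i\<^sub>1\<^esub> \<cdots> g\<^bsub>i\<^sub>k\<^esub>\<close> of the free semigroup is the list of its indices; \<open>g\<^sub>0\<close> is the empty list.
\<close>

definition words :: "nat \<Rightarrow> nat \<Rightarrow> nat list set" where
  "words n k = {\<alpha>. set \<alpha> \<subseteq> {1..n} \<and> length \<alpha> = k}"

primrec word_op :: "'x::ab_group_add hspace \<Rightarrow> (nat \<Rightarrow> 'x \<Rightarrow> 'x) \<Rightarrow> nat list \<Rightarrow> 'x \<Rightarrow> 'x" where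
  "word_op X Xs [] = id_op X"
| "word_op X Xs (i # \<alpha>) = Xs i \<circ> word_op X Xs \<alpha>"

definition op_ball :: "'x::ab_group_add hspace \<Rightarrow> nat \<Rightarrow> (nat \<Rightarrow> 'x \<Rightarrow> 'x) set" where
  "op_ball X n = {Xs. (\<forall>i\<in>{1..n}. Xs i \<in> bops X) \<and>
     opnorm X (\<Sum>i\<in>{1..n}. Xs i \<circ> adj X (Xs i)) < 1}"

definition nc_term :: "'x::ab_group_add hspace \<Rightarrow> 'h::ab_group_add hspace \<Rightarrow> nat \<Rightarrow>
    (nat list \<Rightarrow> 'h \<Rightarrow> 'h) \<Rightarrow> (nat \<Rightarrow> 'x \<Rightarrow> 'x) \<Rightarrow> nat \<Rightarrow> ('x \<Rightarrow> 'h) \<Rightarrow> ('x \<Rightarrow> 'h)" where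
  "nc_term X H n C Xs k = (\<Sum>\<alpha>\<in>words n k. tensor_op X H (word_op X Xs \<alpha>) (C \<alpha>))"

text \<open>
  HOL cannot quantify over types inside a formula, so "for every Hilbert space" ranges over all
  Hilbert spaces inside a type \<open>'x\<close>, which is passed as the first argument.  For an infinite type
  \<open>'i\<close>, the type \<open>'i \<Rightarrow> complex\<close> contains an isometric copy, namely \<open>\<ell>\<^sup>2(I)\<close> with \<open>I \<subseteq> 'i\<close>, of every
  Hilbert space of dimension at most the cardinality of \<open>'i\<close>.
\<close>

definition nc_holomorphic :: "'x::ab_group_add itself \<Rightarrow> 'h::ab_group_add hspace \<Rightarrow> nat \<Rightarrow>
    (nat list \<Rightarrow> 'h \<Rightarrow> 'h) \<Rightarrow> bool" where
  "nc_holomorphic U H n C \<longleftrightarrow>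
     (\<forall>X :: 'x hspace. hilbert_space X \<longrightarrow>
        (\<forall>Xs\<in>op_ball X n. \<exists>T. op_sums (tensor X H) (nc_term X H n C Xs) T))"

definition nc_fun :: "'x::ab_group_add hspace \<Rightarrow> 'h::ab_group_add hspace \<Rightarrow> nat \<Rightarrow>
    (nat list \<Rightarrow> 'h \<Rightarrow> 'h) \<Rightarrow> (nat \<Rightarrow> 'x \<Rightarrow> 'x) \<Rightarrow> ('x \<Rightarrow> 'h) \<Rightarrow> ('x \<Rightarrow> 'h)" where
  "nc_fun X H n C Xs = (THE T. op_sums (tensor X H) (nc_term X H n C Xs) T)"

definition half_const :: "'h hspace \<Rightarrow> (nat list \<Rightarrow> 'h \<Rightarrow> 'h) \<Rightarrow> nat list \<Rightarrow> 'h \<Rightarrow> 'h" where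
  "half_const H A \<alpha> = (if \<alpha> = [] then scale_op H (1/2) (A []) else A \<alpha>)"

definition nc_harmonic :: "'x::ab_group_add itself \<Rightarrow> 'h::ab_group_add hspace \<Rightarrow> nat \<Rightarrow>
    (nat list \<Rightarrow> 'h \<Rightarrow> 'h) \<Rightarrow> bool" where
  "nc_harmonic U H n A \<longleftrightarrow>
     adj H (A []) = A [] \<and> nc_holomorphic U H n (half_const H A)"

definition harmonic_fun :: "'x::ab_group_add hspace \<Rightarrow> 'h::ab_group_add hspace \<Rightarrow> nat \<Rightarrow>
    (nat list \<Rightarrow> 'h \<Rightarrow> 'h) \<Rightarrow> (nat \<Rightarrow> 'x \<Rightarrow> 'x) \<Rightarrow> ('x \<Rightarrow> 'h) \<Rightarrow> ('x \<Rightarrow> 'h)" where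
  "harmonic_fun X H n A Xs =
     (let F = nc_fun X H n (half_const H A) Xs
      in scale_op (tensor X H) (1/2) (F + adj (tensor X H) F))"

end

theory Submission
  imports Defs
begin

text \<open>
  Put \<open>C = B - A\<close> and evaluate \<open>H\<^sub>B - H\<^sub>A \<ge> 0\<close> at \<open>X\<^sub>i = r S\<^sub>i\<close>, where \<open>S\<^sub>i\<close> are the left creation operators on
  the full Fock space with basis \<open>e\<^sub>\<alpha>\<close>, on the vector \<open>e\<^sub>0 \<otimes> h - t \<Sum>\<^bsub>|\<alpha>|=k\<^esub> e\<^sub>\<alpha> \<otimes> C\<^sub>\<alpha> h\<close>.  With
  \<open>S = \<Sum>\<^bsub>|\<alpha>|=k\<^esub> \<parallel>C\<^sub>\<alpha> h\<parallel>\<^sup>2\<close>, \<open>q = \<langle>C\<^sub>0 h, h\<rangle>\<close> and \<open>M = \<parallel>C\<^sub>0\<parallel>\<close> this gives \<open>2 t r\<^sup>k S \<le> q + t\<^sup>2 M S\<close>; let \<open>r\<close> tend to 1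
  and take \<open>t = 1 / M\<close> to obtain \<open>S \<le> M q\<close>.  Hence the column operator \<open>(C\<^sub>\<alpha>)\<^bsub>|\<alpha>|=k\<^esub>\<close> has norm at most \<open>M\<close>, and
  the Bohr inequality follows from the triangle inequality for column norms and
  \<open>\<Sum>\<^bsub>k\<ge>1\<^esub> r\<^sup>k \<le> 1/2\<close> for \<open>r \<le> 1/3\<close>.  The series converge because convergence of \<open>F(S/2)\<close> bounds
  the \<open>k\<close>-th column norm by a multiple of \<open>2\<^sup>k\<close>.
\<close>

section \<open>Bounded operators on a Hilbert space\<close>

text \<open>The Fock space is what separates the coefficients: applied to e_0, different words give
  orthogonal vectors, so one positivity statement controls a whole sum over words of length k, while
  scalar arguments cannot tell permuted words apart. The creation operators lie on the boundary of
  the ball, since the sum of the S_i S_i^* is a nonzero projection; hence r < 1 and a limit. The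
  minus sign in the test vector makes the mixed terms negative, so that positivity bounds S from
  above. The value t = 1 / M minimises t^2 M S - 2 t S, which leaves M = 0 as a separate case.

  Before any evaluation, the Hilbert-Schmidt model of the tensor product must be a Hilbert space on
  which \<open>tensor_op\<close> is bounded. Its norm sees only one chosen orthonormal basis, so
  estimates away from that basis pass through the conjugate linear adjoint. The Fock space must also
  live in the type over which the hypotheses quantify: as \<open>'i\<close> is infinite, the words
  embed into it, and the Fock space sits in the square-summable functions on
  \<open>'i\<close>.\<close>

lemma sum_fun_apply: "(\<Sum>i\<in>I. f i) x = (\<Sum>i\<in>I. f i x)"
  by (induction I rule: infinite_finite_induct) auto

text \<open>A finite form of Fatou's lemma. Both completeness proofs need it: a Cauchy bound over
  finitely many coordinates passes to the coordinatewise limit.\<close>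

lemma sum_tendsto_le:
  fixes l :: "'a \<Rightarrow> real"
  assumes "\<And>x. x \<in> F \<Longrightarrow> (\<lambda>k. d k x) \<longlonglongrightarrow> l x" "\<And>k. k \<ge> N \<Longrightarrow> (\<Sum>x\<in>F. d k x) \<le> c"
  shows "(\<Sum>x\<in>F. l x) \<le> c"
  using assms by (intro LIMSEQ_le_const2[of "\<lambda>k. \<Sum>x\<in>F. d k x"] tendsto_sum exI[of _ N]) auto

lemma has_sum_finite_sum:
  fixes f :: "'i \<Rightarrow> 'a \<Rightarrow> real"
  assumes "\<And>i. i \<in> I \<Longrightarrow> (f i has_sum s i) A"
  shows "((\<lambda>x. \<Sum>i\<in>I. f i x) has_sum (\<Sum>i\<in>I. s i)) A"
  using assms by (induction I rule: infinite_finite_induct) (auto intro: has_sum_add)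

lemma bopsD:
  assumes "T \<in> bops K"
  shows "x \<in> hcarrier K \<Longrightarrow> T x \<in> hcarrier K"
    and "x \<notin> hcarrier K \<Longrightarrow> T x = 0"
    and "x \<in> hcarrier K \<Longrightarrow> y \<in> hcarrier K \<Longrightarrow> T (x + y) = T x + T y"
    and "x \<in> hcarrier K \<Longrightarrow> T (hscale K c x) = hscale K c (T x)"
  using assms by (auto simp: bops_def)

context hilbert_space
begin

section \<open>Finite sums, norm inequalities and uniqueness of limits\<close>

lemma carrier_sum: "(\<And>i. i \<in> I \<Longrightarrow> f i \<in> hcarrier K) \<Longrightarrow> (\<Sum>i\<in>I. f i) \<in> hcarrier K"
  by (induction I rule: infinite_finite_induct) auto

lemma ip_sum_left:
  "\<lbrakk>\<And>i. i \<in> I \<Longrightarrow> f i \<in> hcarrier K; y \<in> hcarrier K\<rbrakk>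
    \<Longrightarrow> hip K (\<Sum>i\<in>I. f i) y = (\<Sum>i\<in>I. hip K (f i) y)"
  by (induction I rule: infinite_finite_induct) (auto simp: ip_add_left carrier_sum)

lemma ip_sum_right:
  "\<lbrakk>\<And>i. i \<in> I \<Longrightarrow> f i \<in> hcarrier K; y \<in> hcarrier K\<rbrakk>
    \<Longrightarrow> hip K y (\<Sum>i\<in>I. f i) = (\<Sum>i\<in>I. hip K y (f i))"
  by (induction I rule: infinite_finite_induct) (auto simp: ip_add_right carrier_sum)

lemma hnorm_zero [simp]: "hnorm K 0 = 0"
  using hnorm_eq_0[of 0] by simp

lemma hnorm_minus [simp]: "x \<in> hcarrier K \<Longrightarrow> hnorm K (- x) = hnorm K x"
  using hnorm_scale[of x "-1"] by simp

lemma hnorm_triangle: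
  assumes x: "x \<in> hcarrier K" and y: "y \<in> hcarrier K"
  shows "hnorm K (x + y) \<le> hnorm K x + hnorm K y"
proof (rule power2_le_imp_le)
  have "Re (hip K x y) \<le> hnorm K x * hnorm K y" "Re (hip K y x) \<le> hnorm K x * hnorm K y"
    using Cauchy_Schwarz[OF x y] Cauchy_Schwarz[OF y x]
      complex_Re_le_cmod[of "hip K x y"] complex_Re_le_cmod[of "hip K y x"]
    by (simp_all add: mult.commute)
  then show "(hnorm K (x + y))\<^sup>2 \<le> (hnorm K x + hnorm K y)\<^sup>2"
    using x y by (simp add: hnorm_sq ip_simps power2_sum)
qed (use x y in auto)

lemma hnorm_diff_triangle:
  assumes "x \<in> hcarrier K" "y \<in> hcarrier K"
  shows "hnorm K (x - y) \<le> hnorm K x + hnorm K y"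
  using hnorm_triangle[of x "- y"] assms by simp

lemma hnorm_minus_commute:
  assumes "x \<in> hcarrier K" "y \<in> hcarrier K"
  shows "hnorm K (x - y) = hnorm K (y - x)"
  using hnorm_minus[of "x - y"] assms by simp

lemma hnorm_triangle_mid:
  assumes "x \<in> hcarrier K" "y \<in> hcarrier K" "z \<in> hcarrier K"
  shows "hnorm K (x - z) \<le> hnorm K (x - y) + hnorm K (y - z)"
  using hnorm_triangle[of "x - y" "y - z"] assms by simp

lemma hnorm_reverse_triangle:
  assumes "x \<in> hcarrier K" "y \<in> hcarrier K"
  shows "\<bar>hnorm K x - hnorm K y\<bar> \<le> hnorm K (x - y)"
  using hnorm_triangle[of "x - y" y] hnorm_triangle[of "y - x" x] hnorm_minus_commute[of x y] assms
  by simp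

lemma hnorm_add_sq_le:
  assumes x: "x \<in> hcarrier K" and y: "y \<in> hcarrier K"
  shows "(hnorm K (x + y))\<^sup>2 \<le> 2 * (hnorm K x)\<^sup>2 + 2 * (hnorm K y)\<^sup>2"
proof -
  have "0 \<le> (hnorm K (x - y))\<^sup>2" by simp
  then show ?thesis using x y by (simp add: hnorm_sq ip_simps)
qed

text \<open>Testing \<open>x\<close> against itself leaves one factor \<open>hnorm K x\<close> to
  cancel. Bounds for adjoints, for values of Hilbert-Schmidt operators and for column squares are
  all obtained this way.\<close>

lemma hnorm_leI:
  assumes x: "x \<in> hcarrier K" and "0 \<le> c" and "cmod (hip K x x) \<le> c * hnorm K x"
  shows "hnorm K x \<le> c"
proof (cases "hnorm K x = 0")
  case False
  then have "hnorm K x > 0" using hnorm_nonneg[OF x] by linarith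
  moreover have "hnorm K x * hnorm K x \<le> c * hnorm K x"
    using assms(3) by (simp add: ip_self[OF x] power2_eq_square norm_mult x)
  ultimately show ?thesis by (simp add: mult_le_cancel_right)
qed (use assms in simp)

text \<open>The underlying type carries no topology, so convergence is expressed by real sequences
  of norms, and uniqueness of limits comes from the triangle inequality.\<close>

lemma tendsto_unique:
  assumes "\<And>m. s m \<in> hcarrier K" "x \<in> hcarrier K" "y \<in> hcarrier K"
    and "(\<lambda>m. hnorm K (s m - x)) \<longlonglongrightarrow> 0" "(\<lambda>m. hnorm K (s m - y)) \<longlonglongrightarrow> 0"
  shows "x = y"
proof -
  have "(\<lambda>m. hnorm K (s m - x) + hnorm K (s m - y)) \<longlonglongrightarrow> 0"
    using tendsto_add[OF assms(4,5)] by simp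
  then have "hnorm K (x - y) \<le> 0"
    by (rule LIMSEQ_le_const)
      (use assms in \<open>auto intro!: exI[of _ 0] simp: hnorm_triangle_mid hnorm_minus_commute[of _ x]\<close>)
  then have "hnorm K (x - y) = 0" using assms(2,3) by (intro antisym) auto
  then show ?thesis using hnorm_eq_0[of "x - y"] assms(2,3) by simp
qed

section \<open>Operator norm and algebra of bounded operators\<close>

lemma bops_bound_nonneg:
  assumes "T \<in> bops K"
  obtains M where "0 \<le> M" "\<And>x. x \<in> hcarrier K \<Longrightarrow> hnorm K (T x) \<le> M * hnorm K x"
proof -
  obtain M where M: "\<forall>x\<in>hcarrier K. hnorm K (T x) \<le> M * hnorm K x"
    using assms by (auto simp: bops_def)
  have "hnorm K (T x) \<le> \<bar>M\<bar> * hnorm K x" if "x \<in> hcarrier K" for x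
    using M that mult_right_mono[OF abs_ge_self[of M], of "hnorm K x"] by fastforce
  then show ?thesis using that[of "\<bar>M\<bar>"] by simp
qed

lemma bdd_above_unit_ball_image:
  assumes T: "T \<in> bops K"
  shows "bdd_above {hnorm K (T x) | x. x \<in> hcarrier K \<and> hnorm K x \<le> 1}"
proof -
  obtain M where M: "0 \<le> M" "\<And>x. x \<in> hcarrier K \<Longrightarrow> hnorm K (T x) \<le> M * hnorm K x"
    using bops_bound_nonneg[OF T] by blast
  show ?thesis
  proof (rule bdd_aboveI[of _ M])
    fix a assume "a \<in> {hnorm K (T x) | x. x \<in> hcarrier K \<and> hnorm K x \<le> 1}"
    then obtain x where x: "a = hnorm K (T x)" "x \<in> hcarrier K" "hnorm K x \<le> 1" by blast
    then show "a \<le> M" using M(2)[of x] mult_left_mono[of "hnorm K x" 1 M] M(1) by simp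
  qed
qed

lemma hnorm_apply_le_opnorm:
  assumes T: "T \<in> bops K" and x: "x \<in> hcarrier K"
  shows "hnorm K (T x) \<le> opnorm K T * hnorm K x"
proof (cases "x = 0")
  case True
  then show ?thesis using bopsD(3)[OF T, of 0 0] by simp
next
  case False
  then have n: "hnorm K x > 0" using hnorm_eq_0[OF x] hnorm_nonneg[OF x] by linarith
  let ?S = "{hnorm K (T x) | x. x \<in> hcarrier K \<and> hnorm K x \<le> 1}"
  let ?c = "complex_of_real (1 / hnorm K x)"
  have c: "cmod ?c = 1 / hnorm K x" using n by (simp add: norm_divide)
  have "hnorm K (T (hscale K ?c x)) \<in> ?S"
    using x n by (auto simp: hnorm_scale c simp del: of_real_divide)
  then have "hnorm K (T (hscale K ?c x)) \<le> opnorm K T"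
    unfolding opnorm_def using bdd_above_unit_ball_image[OF T] by (rule cSup_upper)
  then have "1 / hnorm K x * hnorm K (T x) \<le> opnorm K T"
    using bopsD(4)[OF T x] bopsD(1)[OF T x] n by (simp add: hnorm_scale c del: of_real_divide)
  then show ?thesis using n by (simp add: field_simps)
qed

lemma opnorm_nonneg:
  assumes T: "T \<in> bops K" shows "opnorm K T \<ge> 0"
proof -
  let ?S = "{hnorm K (T x) | x. x \<in> hcarrier K \<and> hnorm K x \<le> 1}"
  have "T 0 = 0" using bopsD(3)[OF T, of 0 0] by simp
  then have "0 \<in> ?S" by (auto intro!: exI[of _ 0])
  then show ?thesis unfolding opnorm_def using bdd_above_unit_ball_image[OF T] by (rule cSup_upper)
qed

lemma opnorm_le:
  assumes "0 \<le> c" "\<And>x. x \<in> hcarrier K \<Longrightarrow> hnorm K (T x) \<le> c * hnorm K x"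
  shows "opnorm K T \<le> c"
  unfolding opnorm_def
proof (rule cSup_least)
  show "{hnorm K (T x) | x. x \<in> hcarrier K \<and> hnorm K x \<le> 1} \<noteq> {}" by (auto intro!: exI[of _ 0])
  fix a assume "a \<in> {hnorm K (T x) | x. x \<in> hcarrier K \<and> hnorm K x \<le> 1}"
  then obtain x where x: "a = hnorm K (T x)" "x \<in> hcarrier K" "hnorm K x \<le> 1" by blast
  then show "a \<le> c" using assms(2)[of x] mult_left_mono[of "hnorm K x" 1 c] assms(1) by simp
qed

lemma bops_add:
  assumes S: "S \<in> bops K" and T: "T \<in> bops K" shows "S + T \<in> bops K"
proof -
  obtain M N where "\<forall>x\<in>hcarrier K. hnorm K (S x) \<le> M * hnorm K x"
    "\<forall>x\<in>hcarrier K. hnorm K (T x) \<le> N * hnorm K x" using assms by (auto simp: bops_def)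
  then have "\<forall>x\<in>hcarrier K. hnorm K (S x + T x) \<le> (M + N) * hnorm K x"
    using hnorm_triangle bopsD(1)[OF S] bopsD(1)[OF T] by (fastforce simp: algebra_simps)
  then show ?thesis using bopsD[OF S] bopsD[OF T]
    unfolding bops_def by (auto simp: scale_right_distrib)
qed

lemma bops_zero: "0 \<in> bops K"
  unfolding bops_def by (auto intro!: exI[of _ 0])

lemma bops_scale:
  assumes T: "T \<in> bops K" shows "scale_op K c T \<in> bops K"
proof -
  obtain M where "\<forall>x\<in>hcarrier K. hnorm K (T x) \<le> M * hnorm K x" using T by (auto simp: bops_def)
  then have "\<forall>x\<in>hcarrier K. hnorm K (hscale K c (T x)) \<le> (cmod c * M) * hnorm K x"
    using bopsD(1)[OF T] by (simp add: hnorm_scale mult.assoc mult_left_mono)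
  then show ?thesis using bopsD[OF T]
    unfolding bops_def scale_op_def by (auto simp: scale_right_distrib scale_scale mult.commute[of _ c])
qed

lemma bops_diff:
  assumes S: "S \<in> bops K" and T: "T \<in> bops K" shows "S - T \<in> bops K"
proof -
  have "S - T = S + scale_op K (-1) T" by (simp add: fun_eq_iff scale_op_def)
  then show ?thesis using bops_add[OF S bops_scale[OF T]] by metis
qed

lemma bops_sum: "(\<And>i. i \<in> I \<Longrightarrow> f i \<in> bops K) \<Longrightarrow> (\<Sum>i\<in>I. f i) \<in> bops K"
  by (induction I rule: infinite_finite_induct) (auto simp: bops_add bops_zero)

lemma bops_comp:
  assumes S: "S \<in> bops K" and T: "T \<in> bops K" shows "S \<circ> T \<in> bops K"
proof -
  obtain M where M: "0 \<le> M" "\<And>x. x \<in> hcarrier K \<Longrightarrow> hnorm K (S x) \<le> M * hnorm K x"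
    using bops_bound_nonneg[OF S] by blast
  obtain N where N: "\<And>x. x \<in> hcarrier K \<Longrightarrow> hnorm K (T x) \<le> N * hnorm K x"
    using bops_bound_nonneg[OF T] by blast
  have "hnorm K (S (T x)) \<le> (M * N) * hnorm K x" if "x \<in> hcarrier K" for x
    using M(2)[OF bopsD(1)[OF T that]] mult_left_mono[OF N[OF that] M(1)] by (simp add: mult.assoc)
  \<comment> \<open>Off the carrier \<open>T\<close> returns 0, so \<open>S \<circ> T\<close>
    vanishes there because \<open>S\<close> maps 0 to 0.\<close>
  moreover have "S 0 = 0" using bopsD(3)[OF S, of 0 0] by simp
  ultimately show ?thesis using bopsD[OF S] bopsD[OF T] unfolding bops_def by auto
qed

lemma bops_id: "id_op K \<in> bops K"
  unfolding bops_def id_op_def by (auto intro!: exI[of _ 1])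

section \<open>Adjoints\<close>

lemma adj_bound:
  assumes T: "T \<in> bops K" and y: "y \<in> hcarrier K"
    and M: "0 \<le> M" "\<And>x. x \<in> hcarrier K \<Longrightarrow> hnorm K (T x) \<le> M * hnorm K x"
  shows "hnorm K (adj K T y) \<le> M * hnorm K y"
proof (rule hnorm_leI)
  let ?a = "adj K T y"
  note a = adj_props[OF T y]
  show "?a \<in> hcarrier K" by (rule a)
  show "0 \<le> M * hnorm K y" using M y by simp
  have "cmod (hip K ?a ?a) = cmod (hip K (T ?a) y)" using a by simp
  also have "\<dots> \<le> hnorm K (T ?a) * hnorm K y" by (rule Cauchy_Schwarz) (use bopsD[OF T] a y in auto)
  also have "\<dots> \<le> (M * hnorm K ?a) * hnorm K y" using M a y by (intro mult_right_mono) auto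
  finally show "cmod (hip K ?a ?a) \<le> M * hnorm K y * hnorm K ?a" by (simp add: mult_ac)
qed

lemma adj_eqI:
  assumes T: "T \<in> bops K" and "y \<in> hcarrier K" "z \<in> hcarrier K"
    and "\<And>x. x \<in> hcarrier K \<Longrightarrow> hip K (T x) y = hip K x z"
  shows "adj K T y = z"
  using assms adj_props[OF T, of y] by (intro ip_ext) auto

lemma adj_bops:
  assumes T: "T \<in> bops K" shows "adj K T \<in> bops K"
proof -
  obtain M where M: "0 \<le> M" "\<And>x. x \<in> hcarrier K \<Longrightarrow> hnorm K (T x) \<le> M * hnorm K x"
    using bops_bound_nonneg[OF T] by blast
  note a = adj_props[OF T] and t = bopsD[OF T]
  have "adj K T (x + y) = adj K T x + adj K T y" if "x \<in> hcarrier K" "y \<in> hcarrier K" for x y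
    by (rule adj_eqI[OF T]) (use that a t in \<open>auto simp: ip_simps\<close>)
  moreover have "adj K T (hscale K c x) = hscale K c (adj K T x)" if "x \<in> hcarrier K" for x c
    by (rule adj_eqI[OF T]) (use that a t in \<open>auto simp: ip_simps\<close>)
  moreover have "adj K T x = 0" if "x \<notin> hcarrier K" for x using that by (simp add: adj_def)
  ultimately show ?thesis using adj_bound[OF T _ M] a unfolding bops_def by blast
qed

lemma bops_apply_sum:
  assumes T: "T \<in> bops K" and "\<And>i. i \<in> I \<Longrightarrow> f i \<in> hcarrier K"
  shows "T (\<Sum>i\<in>I. f i) = (\<Sum>i\<in>I. T (f i))"
  using assms(2) bopsD(3)[OF T, of 0 0]
  by (induction I rule: infinite_finite_induct) (auto simp: bopsD(3)[OF T] carrier_sum)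

section \<open>Series of operators converging in norm\<close>

lemma op_sums_tendsto:
  assumes f: "\<And>k. f k \<in> bops K" and T: "op_sums K f T" and x: "x \<in> hcarrier K"
  shows "(\<lambda>N. hnorm K ((\<Sum>k<N. f k) x - T x)) \<longlonglongrightarrow> 0"
proof -
  have Tb: "T \<in> bops K" and lim: "(\<lambda>N. opnorm K (T - (\<Sum>k<N. f k))) \<longlonglongrightarrow> 0"
    using T by (auto simp: op_sums_def)
  show ?thesis
  proof (rule Lim_null_comparison[OF always_eventually])
    show "(\<lambda>N. opnorm K (T - (\<Sum>k<N. f k)) * hnorm K x) \<longlonglongrightarrow> 0"
      using tendsto_mult_right[OF lim, of "hnorm K x"] by simp
    show "\<forall>N. norm (hnorm K ((\<Sum>k<N. f k) x - T x)) \<le> opnorm K (T - (\<Sum>k<N. f k)) * hnorm K x"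
    proof
      fix N
      have S: "(\<Sum>k<N. f k) \<in> bops K" using f by (intro bops_sum)
      show "norm (hnorm K ((\<Sum>k<N. f k) x - T x)) \<le> opnorm K (T - (\<Sum>k<N. f k)) * hnorm K x"
        using hnorm_apply_le_opnorm[OF bops_diff[OF Tb S] x] bopsD(1)[OF S x] bopsD(1)[OF Tb x]
        by (simp add: hnorm_minus_commute[of _ "T x"])
    qed
  qed
qed

text \<open>Needed to read the definite description in \<open>nc_fun\<close> as the actual limit.
  Two limits agree on the carrier by strong convergence and off it because both vanish
  there.\<close>

lemma op_sums_unique:
  assumes f: "\<And>k. f k \<in> bops K" and T: "op_sums K f T" and T': "op_sums K f T'"
  shows "T = T'"
proof
  have b: "T \<in> bops K" "T' \<in> bops K" using T T' by (auto simp: op_sums_def)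
  fix x show "T x = T' x"
  proof (cases "x \<in> hcarrier K")
    case True
    show ?thesis
      by (rule tendsto_unique[OF _ _ _ op_sums_tendsto[OF f T True] op_sums_tendsto[OF f T' True]])
        (use bops_sum[of _ f] f b True bopsD(1) in blast)+
  qed (use b bopsD(2) in metis)
qed

text \<open>Lets the quadratic form of the sum of a series be computed term by term.\<close>

lemma op_sums_ip:
  assumes f: "\<And>k. f k \<in> bops K" and T: "op_sums K f T" and x: "x \<in> hcarrier K" and y: "y \<in> hcarrier K"
  shows "(\<lambda>N. \<Sum>k<N. hip K (f k x) y) \<longlonglongrightarrow> hip K (T x) y"
proof (rule LIM_zero_cancel, rule Lim_null_comparison[OF always_eventually])
  have Tb: "T \<in> bops K" using T by (auto simp: op_sums_def)
  show "(\<lambda>N. hnorm K ((\<Sum>k<N. f k) x - T x) * hnorm K y) \<longlonglongrightarrow> 0"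
    using tendsto_mult_right[OF op_sums_tendsto[OF f T x], of "hnorm K y"] by simp
  show "\<forall>N. norm ((\<Sum>k<N. hip K (f k x) y) - hip K (T x) y) \<le> hnorm K ((\<Sum>k<N. f k) x - T x) * hnorm K y"
  proof
    fix N
    have S: "(\<Sum>k<N. f k) \<in> bops K" using f by (intro bops_sum)
    have "(\<Sum>k<N. hip K (f k x) y) = hip K ((\<Sum>k<N. f k) x) y"
      unfolding sum_fun_apply using bopsD(1)[OF f x] y by (simp add: ip_sum_left)
    then show "norm ((\<Sum>k<N. hip K (f k x) y) - hip K (T x) y) \<le> hnorm K ((\<Sum>k<N. f k) x - T x) * hnorm K y"
      using Cauchy_Schwarz[of "(\<Sum>k<N. f k) x - T x" y] bopsD(1)[OF S x] bopsD(1)[OF Tb x] y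
      by (simp add: ip_diff_left)
  qed
qed

text \<open>One constant serves all terms: a term is the difference of two consecutive remainders,
  and the norms of the remainders converge, hence are bounded. At a point of radius r this plays the
  role of Cauchy's coefficient estimate.\<close>

lemma op_sums_terms_bounded:
  assumes f: "\<And>k. f k \<in> bops K" and T: "op_sums K f T"
  obtains M where "0 \<le> M" "\<And>k x. x \<in> hcarrier K \<Longrightarrow> hnorm K (f k x) \<le> M * hnorm K x"
proof -
  let ?R = "\<lambda>N. T - (\<Sum>k<N. f k)"
  have Tb: "T \<in> bops K" and lim: "(\<lambda>N. opnorm K (?R N)) \<longlonglongrightarrow> 0"
    using T by (auto simp: op_sums_def)
  obtain D where D: "\<And>N. \<bar>opnorm K (?R N)\<bar> \<le> D"
    using convergent_imp_Bseq[OF convergentI[OF lim]] by (auto simp: Bseq_def)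
  have R: "?R N \<in> bops K" for N using f Tb by (intro bops_diff bops_sum)
  have "hnorm K (f k x) \<le> (D + D) * hnorm K x" if x: "x \<in> hcarrier K" for k x
  proof -
    have le: "hnorm K (?R N x) \<le> D * hnorm K x" for N
      using hnorm_apply_le_opnorm[OF R x, of N] mult_right_mono[of "opnorm K (?R N)" D "hnorm K x"] D[of N] x
      by fastforce
    have "f k x = ?R k x - ?R (Suc k) x" by simp
    also have "hnorm K \<dots> \<le> hnorm K (?R k x) + hnorm K (?R (Suc k) x)"
      by (intro hnorm_diff_triangle bopsD(1)[OF R] x)
    finally show ?thesis using le[of k] le[of "Suc k"] by (simp add: algebra_simps)
  qed
  moreover have "0 \<le> D + D" using D[of 0] by simp
  ultimately show ?thesis using that by blast
qed

lemma ip_adj_left: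
  assumes "T \<in> bops K" "x \<in> hcarrier K" "y \<in> hcarrier K"
  shows "hip K (adj K T y) x = hip K y (T x)"
  using assms adj_props[OF assms(1,3)] ip_cnj[of x "adj K T y"] ip_cnj[of "T x" y] bopsD(1)[OF assms(1,2)]
  by simp

section \<open>Column operators\<close>

lemma col_square_bops:
  assumes "C \<in> W \<rightarrow> bops K"
  shows "(\<Sum>\<alpha>\<in>W. adj K (C \<alpha>) \<circ> C \<alpha>) \<in> bops K"
  using assms by (intro bops_sum bops_comp adj_bops) auto

lemma ip_col_square:
  assumes C: "C \<in> W \<rightarrow> bops K" and x: "x \<in> hcarrier K" and y: "y \<in> hcarrier K"
  shows "hip K ((\<Sum>\<alpha>\<in>W. adj K (C \<alpha>) \<circ> C \<alpha>) x) y = (\<Sum>\<alpha>\<in>W. hip K (C \<alpha> x) (C \<alpha> y))"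
proof -
  have m: "adj K (C \<alpha>) (C \<alpha> x) \<in> hcarrier K" if "\<alpha> \<in> W" for \<alpha>
    using bopsD(1)[OF adj_bops] bopsD(1) funcset_mem[OF C that] x by blast
  have "hip K (\<Sum>\<alpha>\<in>W. adj K (C \<alpha>) (C \<alpha> x)) y = (\<Sum>\<alpha>\<in>W. hip K (adj K (C \<alpha>) (C \<alpha> x)) y)"
    using m y by (rule ip_sum_left)
  also have "\<dots> = (\<Sum>\<alpha>\<in>W. hip K (C \<alpha> x) (C \<alpha> y))"
    using x y bopsD(1) funcset_mem[OF C] by (intro sum.cong refl ip_adj_left) blast+
  finally show ?thesis by (simp add: sum_fun_apply)
qed

lemma ip_col_square_self:
  assumes C: "C \<in> W \<rightarrow> bops K" and x: "x \<in> hcarrier K"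
  shows "hip K ((\<Sum>\<alpha>\<in>W. adj K (C \<alpha>) \<circ> C \<alpha>) x) x = of_real (\<Sum>\<alpha>\<in>W. (hnorm K (C \<alpha> x))\<^sup>2)"
  unfolding ip_col_square[OF C x x] of_real_sum
  using bopsD(1)[OF funcset_mem[OF C] x] by (intro sum.cong ip_self refl)

text \<open>The square root on the left is the norm of the column operator sending x to the family
  of all \<open>C \<alpha> x\<close>. \<open>L2_set\<close> replaces the direct sum of copies of the
  space, so the column itself is never formed. Together with \<open>L2_set_col_le\<close> this gives
  both halves of that identification.\<close>

lemma sqrt_opnorm_col_le:
  assumes C: "C \<in> W \<rightarrow> bops K" and c: "0 \<le> c"
    and le: "\<And>x. x \<in> hcarrier K \<Longrightarrow> L2_set (\<lambda>\<alpha>. hnorm K (C \<alpha> x)) W \<le> c * hnorm K x"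
  shows "sqrt (opnorm K (\<Sum>\<alpha>\<in>W. adj K (C \<alpha>) \<circ> C \<alpha>)) \<le> c"
proof (rule real_le_lsqrt)
  let ?P = "\<Sum>\<alpha>\<in>W. adj K (C \<alpha>) \<circ> C \<alpha>"
  have P: "?P \<in> bops K" using C by (rule col_square_bops)
  show "opnorm K ?P \<le> c\<^sup>2"
  proof (rule opnorm_le)
    fix x assume x: "x \<in> hcarrier K"
    note px = bopsD(1)[OF P x]
    show "hnorm K (?P x) \<le> c\<^sup>2 * hnorm K x"
    proof (rule hnorm_leI[OF px])
      \<comment> \<open>The test vector is \<open>?P x\<close> itself: its pairing with
        \<open>?P x\<close> is the pairing of the columns at \<open>x\<close> and at
        \<open>?P x\<close>, and the bound for the column is used once for each.\<close>
      have "cmod (hip K (?P x) (?P x)) \<le> (\<Sum>\<alpha>\<in>W. \<bar>hnorm K (C \<alpha> x)\<bar> * \<bar>hnorm K (C \<alpha> (?P x))\<bar>)"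
        unfolding ip_col_square[OF C x px] using bopsD(1)[OF funcset_mem[OF C] x] bopsD(1)[OF funcset_mem[OF C] px]
        by (intro sum_norm_le) (simp add: Cauchy_Schwarz)
      also have "\<dots> \<le> L2_set (\<lambda>\<alpha>. hnorm K (C \<alpha> x)) W * L2_set (\<lambda>\<alpha>. hnorm K (C \<alpha> (?P x))) W"
        by (rule L2_set_mult_ineq)
      also have "\<dots> \<le> (c * hnorm K x) * (c * hnorm K (?P x))"
        using c x px by (intro mult_mono le) auto
      finally show "cmod (hip K (?P x) (?P x)) \<le> c\<^sup>2 * hnorm K x * hnorm K (?P x)"
        by (simp add: power2_eq_square mult_ac)
    qed (use x in simp)
  qed simp
qed (use c in simp)

lemma L2_set_col_le:
  assumes C: "C \<in> W \<rightarrow> bops K" and x: "x \<in> hcarrier K"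
  shows "L2_set (\<lambda>\<alpha>. hnorm K (C \<alpha> x)) W \<le> sqrt (opnorm K (\<Sum>\<alpha>\<in>W. adj K (C \<alpha>) \<circ> C \<alpha>)) * hnorm K x"
proof -
  let ?P = "\<Sum>\<alpha>\<in>W. adj K (C \<alpha>) \<circ> C \<alpha>"
  have P: "?P \<in> bops K" using C by (rule col_square_bops)
  have "(\<Sum>\<alpha>\<in>W. (hnorm K (C \<alpha> x))\<^sup>2) = Re (hip K (?P x) x)"
    unfolding ip_col_square_self[OF C x] by simp
  also have "\<dots> \<le> hnorm K (?P x) * hnorm K x"
    using Cauchy_Schwarz[OF bopsD(1)[OF P x] x] complex_Re_le_cmod order_trans by blast
  also have "\<dots> \<le> opnorm K ?P * hnorm K x * hnorm K x"
    using hnorm_apply_le_opnorm[OF P x] x by (intro mult_right_mono) auto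
  finally have "L2_set (\<lambda>\<alpha>. hnorm K (C \<alpha> x)) W \<le> sqrt (opnorm K ?P * (hnorm K x)\<^sup>2)"
    unfolding L2_set_def by (simp add: power2_eq_square mult.assoc)
  then show ?thesis using x by (simp add: real_sqrt_mult)
qed

end

section \<open>The tensor product as a Hilbert space\<close>

locale hilbert_pair = X: hilbert_space X + H: hilbert_space H
  for X :: "'x::ab_group_add hspace" and H :: "'h::ab_group_add hspace"
begin

abbreviation "E \<equiv> some_onb X"
abbreviation "XH \<equiv> tensor X H"

lemma onb_in_carrier: "e \<in> E \<Longrightarrow> e \<in> hcarrier X"
  using X.onb_some_onb by (auto simp: onb_def)

lemma tensorD:
  assumes "\<Phi> \<in> hcarrier XH"
  shows "x \<in> hcarrier X \<Longrightarrow> \<Phi> x \<in> hcarrier H"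
    and "x \<notin> hcarrier X \<Longrightarrow> \<Phi> x = 0"
    and "x \<in> hcarrier X \<Longrightarrow> y \<in> hcarrier X \<Longrightarrow> \<Phi> (x + y) = \<Phi> x + \<Phi> y"
    and "x \<in> hcarrier X \<Longrightarrow> \<Phi> (hscale X c x) = hscale H (cnj c) (\<Phi> x)"
    and "\<exists>M. \<forall>x\<in>hcarrier X. hnorm H (\<Phi> x) \<le> M * hnorm X x"
    and "(\<lambda>e. (hnorm H (\<Phi> e))\<^sup>2) summable_on E"
  using assms by (auto simp: tensor_def)

text \<open>Trades summability over the basis for a uniform bound on finite partial sums, the form
  in which limits and estimates arrive.\<close>

lemma tensorI:
  assumes "\<And>x. x \<in> hcarrier X \<Longrightarrow> \<Phi> x \<in> hcarrier H"
    and "\<And>x. x \<notin> hcarrier X \<Longrightarrow> \<Phi> x = 0"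
    and "\<And>x y. x \<in> hcarrier X \<Longrightarrow> y \<in> hcarrier X \<Longrightarrow> \<Phi> (x + y) = \<Phi> x + \<Phi> y"
    and "\<And>x c. x \<in> hcarrier X \<Longrightarrow> \<Phi> (hscale X c x) = hscale H (cnj c) (\<Phi> x)"
    and "\<And>x. x \<in> hcarrier X \<Longrightarrow> hnorm H (\<Phi> x) \<le> M * hnorm X x"
    and "\<And>F. finite F \<Longrightarrow> F \<subseteq> E \<Longrightarrow> (\<Sum>e\<in>F. (hnorm H (\<Phi> e))\<^sup>2) \<le> N"
  shows "\<Phi> \<in> hcarrier XH"
proof -
  have "(\<lambda>e. (hnorm H (\<Phi> e))\<^sup>2) summable_on E"
    by (rule nonneg_bdd_above_summable_on) (auto intro!: bdd_aboveI2 assms(6))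
  then show ?thesis using assms(1-5) unfolding tensor_def by (auto intro!: exI[of _ M])
qed

lemma hscale_tensor: "hscale XH c \<Phi> = (\<lambda>y. hscale H c (\<Phi> y))"
  by (simp add: tensor_def)

lemma hip_tensor: "hip XH \<Phi> \<Psi> = (\<Sum>\<^sub>\<infinity>e\<in>E. hip H (\<Phi> e) (\<Psi> e))"
  by (simp add: tensor_def)

lemma tensor_ip_summable:
  assumes \<Phi>: "\<Phi> \<in> hcarrier XH" and \<Psi>: "\<Psi> \<in> hcarrier XH"
  shows "(\<lambda>e. hip H (\<Phi> e) (\<Psi> e)) summable_on E"
proof -
  have "(\<lambda>e. (hnorm H (\<Phi> e))\<^sup>2 + (hnorm H (\<Psi> e))\<^sup>2) summable_on E"
    using tensorD(6)[OF \<Phi>] tensorD(6)[OF \<Psi>] by (rule summable_on_add)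
  then have "(\<lambda>e. cmod (hip H (\<Phi> e) (\<Psi> e))) summable_on E"
  proof (rule summable_on_comparison_test)
    fix e assume "e \<in> E"
    then have "cmod (hip H (\<Phi> e) (\<Psi> e)) \<le> hnorm H (\<Phi> e) * hnorm H (\<Psi> e)"
      using tensorD(1)[OF \<Phi>] tensorD(1)[OF \<Psi>] onb_in_carrier by (intro H.Cauchy_Schwarz) auto
    also have "\<dots> \<le> (hnorm H (\<Phi> e))\<^sup>2 + (hnorm H (\<Psi> e))\<^sup>2"
      using sum_squares_bound[of "hnorm H (\<Phi> e)" "hnorm H (\<Psi> e)"]
        zero_le_power2[of "hnorm H (\<Phi> e)"] zero_le_power2[of "hnorm H (\<Psi> e)"] by argo
    finally show "cmod (hip H (\<Phi> e) (\<Psi> e)) \<le> (hnorm H (\<Phi> e))\<^sup>2 + (hnorm H (\<Psi> e))\<^sup>2" .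
  qed simp
  then show ?thesis by (rule abs_summable_summable)
qed

lemma hip_tensor_self:
  assumes \<Phi>: "\<Phi> \<in> hcarrier XH"
  shows "hip XH \<Phi> \<Phi> = of_real (\<Sum>\<^sub>\<infinity>e\<in>E. (hnorm H (\<Phi> e))\<^sup>2)"
proof -
  have "hip XH \<Phi> \<Phi> = (\<Sum>\<^sub>\<infinity>e\<in>E. of_real ((hnorm H (\<Phi> e))\<^sup>2))"
    unfolding hip_tensor using tensorD(1)[OF \<Phi>] onb_in_carrier
    by (intro infsum_cong) (simp add: H.ip_self)
  also have "\<dots> = of_real (\<Sum>\<^sub>\<infinity>e\<in>E. (hnorm H (\<Phi> e))\<^sup>2)"
    by (intro infsumI has_sum_of_real has_sum_infsum tensorD(6)[OF \<Phi>])
  finally show ?thesis .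
qed

lemma hnorm_tensor_sq:
  assumes "\<Phi> \<in> hcarrier XH"
  shows "(hnorm XH \<Phi>)\<^sup>2 = (\<Sum>\<^sub>\<infinity>e\<in>E. (hnorm H (\<Phi> e))\<^sup>2)"
  unfolding hnorm_def[of XH] using hip_tensor_self[OF assms]
  by (simp add: infsum_nonneg)

lemma hnorm_tensor_nonneg: "\<Phi> \<in> hcarrier XH \<Longrightarrow> 0 \<le> hnorm XH \<Phi>"
  unfolding hnorm_def[of XH] by (simp add: hip_tensor_self infsum_nonneg)

lemma sum_le_hnorm_tensor:
  assumes "\<Phi> \<in> hcarrier XH" "finite F" "F \<subseteq> E"
  shows "(\<Sum>e\<in>F. (hnorm H (\<Phi> e))\<^sup>2) \<le> (hnorm XH \<Phi>)\<^sup>2"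
  unfolding hnorm_tensor_sq[OF assms(1)]
  using assms tensorD(6) by (intro finite_sum_le_infsum) auto

lemma hnorm_tensor_le:
  assumes "\<Phi> \<in> hcarrier XH" "0 \<le> c" "\<And>F. finite F \<Longrightarrow> F \<subseteq> E \<Longrightarrow> (\<Sum>e\<in>F. (hnorm H (\<Phi> e))\<^sup>2) \<le> c\<^sup>2"
  shows "hnorm XH \<Phi> \<le> c"
proof (rule power2_le_imp_le[OF _ assms(2)])
  show "(hnorm XH \<Phi>)\<^sup>2 \<le> c\<^sup>2"
    unfolding hnorm_tensor_sq[OF assms(1)] using assms tensorD(6) by (intro infsum_le_finite_sums) auto
qed

section \<open>The conjugate linear adjoint of a Hilbert-Schmidt operator\<close>

definition cadj :: "('x \<Rightarrow> 'h) \<Rightarrow> 'h \<Rightarrow> 'x" where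
  "cadj \<Phi> h = (SOME z. z \<in> hcarrier X \<and> (\<forall>x\<in>hcarrier X. hip H h (\<Phi> x) = hip X x z))"

text \<open>The second slot of the inner product and \<open>\<Phi>\<close> are both conjugate
  linear, so x is sent to \<open>hip H h (\<Phi> x)\<close> linearly and boundedly, and the Riesz
  representation supplies the vector.\<close>

lemma cadj:
  assumes \<Phi>: "\<Phi> \<in> hcarrier XH" and h: "h \<in> hcarrier H"
  shows "cadj \<Phi> h \<in> hcarrier X" "x \<in> hcarrier X \<Longrightarrow> hip H h (\<Phi> x) = hip X x (cadj \<Phi> h)"
proof -
  note t = tensorD[OF \<Phi>]
  obtain M where M: "\<forall>x\<in>hcarrier X. hnorm H (\<Phi> x) \<le> M * hnorm X x" using t(5) by blast
  have "\<exists>z\<in>hcarrier X. \<forall>x\<in>hcarrier X. hip H h (\<Phi> x) = hip X x z"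
  proof (rule X.Riesz)
    fix x assume x: "x \<in> hcarrier X"
    show "hip H h (\<Phi> (hscale X c x)) = c * hip H h (\<Phi> x)" for c
      using x h t by (simp add: H.ip_simps)
    show "hip H h (\<Phi> (x + y)) = hip H h (\<Phi> x) + hip H h (\<Phi> y)" if "y \<in> hcarrier X" for y
      using x h t that by (simp add: H.ip_simps)
    have "cmod (hip H h (\<Phi> x)) \<le> hnorm H h * hnorm H (\<Phi> x)"
      using x h t by (intro H.Cauchy_Schwarz) auto
    also have "\<dots> \<le> hnorm H h * (M * hnorm X x)" using M x h by (intro mult_left_mono) auto
    finally show "cmod (hip H h (\<Phi> x)) \<le> hnorm H h * M * hnorm X x" by (simp add: mult.assoc)
  qed
  then have "\<exists>z. z \<in> hcarrier X \<and> (\<forall>x\<in>hcarrier X. hip H h (\<Phi> x) = hip X x z)" by blast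
  from someI_ex[OF this] show "cadj \<Phi> h \<in> hcarrier X"
    "x \<in> hcarrier X \<Longrightarrow> hip H h (\<Phi> x) = hip X x (cadj \<Phi> h)"
    unfolding cadj_def by auto
qed

lemma hnorm_sq_onb:
  assumes "x \<in> hcarrier X"
  shows "((\<lambda>e. (cmod (hip X e x))\<^sup>2) has_sum (hnorm X x)\<^sup>2) E"
proof -
  have "((\<lambda>e. hip X x e * hip X e x) has_sum hip X x x) E"
    using X.Parseval[OF X.onb_some_onb assms assms] .
  then have "((\<lambda>e. complex_of_real ((cmod (hip X e x))\<^sup>2)) has_sum of_real ((hnorm X x)\<^sup>2)) E"
    unfolding X.ip_self[OF assms]
    by (rule has_sum_cong[THEN iffD1, rotated])
      (simp only: X.ip_cnj[OF onb_in_carrier assms] complex_norm_square mult.commute)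
  then show ?thesis by (simp only: has_sum_of_real_iff)
qed

text \<open>The coordinates of \<open>cadj \<Phi> h\<close> in the chosen basis are the numbers
  \<open>hip H h (\<Phi> e)\<close>. Cauchy-Schwarz in each coordinate compares their squares with
  the Hilbert-Schmidt sum.\<close>

lemma hnorm_cadj_le:
  assumes \<Phi>: "\<Phi> \<in> hcarrier XH" and h: "h \<in> hcarrier H"
  shows "hnorm X (cadj \<Phi> h) \<le> hnorm XH \<Phi> * hnorm H h"
proof (rule power2_le_imp_le)
  note a = cadj[OF \<Phi> h]
  show "(hnorm X (cadj \<Phi> h))\<^sup>2 \<le> (hnorm XH \<Phi> * hnorm H h)\<^sup>2"
  proof (rule has_sum_le_finite_sums[OF hnorm_sq_onb[OF a(1)]])
    fix F assume F: "finite F" "F \<subseteq> E"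
    have "(\<Sum>e\<in>F. (cmod (hip X e (cadj \<Phi> h)))\<^sup>2) \<le> (\<Sum>e\<in>F. (hnorm H h)\<^sup>2 * (hnorm H (\<Phi> e))\<^sup>2)"
    proof (rule sum_mono)
      fix e assume "e \<in> F"
      then have e: "e \<in> hcarrier X" using F onb_in_carrier by blast
      have "cmod (hip X e (cadj \<Phi> h)) \<le> hnorm H h * hnorm H (\<Phi> e)"
        unfolding a(2)[OF e, symmetric] using h tensorD(1)[OF \<Phi> e] by (rule H.Cauchy_Schwarz)
      then show "(cmod (hip X e (cadj \<Phi> h)))\<^sup>2 \<le> (hnorm H h)\<^sup>2 * (hnorm H (\<Phi> e))\<^sup>2"
        unfolding power_mult_distrib[symmetric] by (rule power_mono) simp
    qed
    also have "\<dots> \<le> (hnorm H h)\<^sup>2 * (hnorm XH \<Phi>)\<^sup>2"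
      unfolding sum_distrib_left[symmetric] using sum_le_hnorm_tensor[OF \<Phi> F] by (rule mult_left_mono) simp
    finally show "(\<Sum>e\<in>F. (cmod (hip X e (cadj \<Phi> h)))\<^sup>2) \<le> (hnorm XH \<Phi> * hnorm H h)\<^sup>2"
      by (simp add: power_mult_distrib mult.commute)
  qed
qed (use hnorm_tensor_nonneg[OF \<Phi>] h in simp)

text \<open>The operator norm is at most the Hilbert-Schmidt norm. The latter is computed on basis
  vectors alone; the bound on the adjoint carries it to an arbitrary \<open>x\<close>.\<close>

lemma hnorm_tensor_apply_le:
  assumes \<Phi>: "\<Phi> \<in> hcarrier XH" and x: "x \<in> hcarrier X"
  shows "hnorm H (\<Phi> x) \<le> hnorm XH \<Phi> * hnorm X x"
proof (rule H.hnorm_leI)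
  note px = tensorD(1)[OF \<Phi> x]
  note a = cadj[OF \<Phi> px]
  show "\<Phi> x \<in> hcarrier H" by (rule px)
  show "0 \<le> hnorm XH \<Phi> * hnorm X x" using hnorm_tensor_nonneg[OF \<Phi>] x by simp
  have "cmod (hip H (\<Phi> x) (\<Phi> x)) \<le> hnorm X x * hnorm X (cadj \<Phi> (\<Phi> x))"
    unfolding a(2)[OF x] using x a(1) by (rule X.Cauchy_Schwarz)
  also have "\<dots> \<le> hnorm X x * (hnorm XH \<Phi> * hnorm H (\<Phi> x))"
    using hnorm_cadj_le[OF \<Phi> px] x by (intro mult_left_mono) auto
  finally show "cmod (hip H (\<Phi> x) (\<Phi> x)) \<le> hnorm XH \<Phi> * hnorm X x * hnorm H (\<Phi> x)"
    by (simp add: mult_ac)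
qed

section \<open>Linear structure and completeness of the Hilbert-Schmidt operators\<close>

lemma tensor_add:
  assumes \<Phi>: "\<Phi> \<in> hcarrier XH" and \<Psi>: "\<Psi> \<in> hcarrier XH"
  shows "\<Phi> + \<Psi> \<in> hcarrier XH"
proof (rule tensorI)
  note t = tensorD[OF \<Phi>] tensorD[OF \<Psi>]
  fix x y assume x: "x \<in> hcarrier X"
  show "(\<Phi> + \<Psi>) x \<in> hcarrier H" using t x by simp
  show "(\<Phi> + \<Psi>) (hscale X c x) = hscale H (cnj c) ((\<Phi> + \<Psi>) x)" for c
    using t x by (simp add: H.scale_right_distrib)
  show "hnorm H ((\<Phi> + \<Psi>) x) \<le> (hnorm XH \<Phi> + hnorm XH \<Psi>) * hnorm X x"
    using H.hnorm_triangle[of "\<Phi> x" "\<Psi> x"] hnorm_tensor_apply_le[OF \<Phi> x]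
      hnorm_tensor_apply_le[OF \<Psi> x] t x by (simp add: algebra_simps)
  show "(\<Phi> + \<Psi>) (x + y) = (\<Phi> + \<Psi>) x + (\<Phi> + \<Psi>) y" if "y \<in> hcarrier X"
    using t x that by simp
next
  show "(\<Phi> + \<Psi>) x = 0" if "x \<notin> hcarrier X" for x
    using that tensorD(2)[OF \<Phi>] tensorD(2)[OF \<Psi>] by simp
  fix F assume F: "finite F" "F \<subseteq> E"
  have "(\<Sum>e\<in>F. (hnorm H ((\<Phi> + \<Psi>) e))\<^sup>2) \<le> (\<Sum>e\<in>F. 2 * (hnorm H (\<Phi> e))\<^sup>2 + 2 * (hnorm H (\<Psi> e))\<^sup>2)"
    using F onb_in_carrier tensorD(1)[OF \<Phi>] tensorD(1)[OF \<Psi>]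
    by (intro sum_mono) (auto intro!: H.hnorm_add_sq_le)
  also have "\<dots> \<le> 2 * (hnorm XH \<Phi>)\<^sup>2 + 2 * (hnorm XH \<Psi>)\<^sup>2"
    unfolding sum.distrib sum_distrib_left[symmetric]
    using sum_le_hnorm_tensor[OF \<Phi> F] sum_le_hnorm_tensor[OF \<Psi> F] by simp
  finally show "(\<Sum>e\<in>F. (hnorm H ((\<Phi> + \<Psi>) e))\<^sup>2) \<le> 2 * (hnorm XH \<Phi>)\<^sup>2 + 2 * (hnorm XH \<Psi>)\<^sup>2" .
qed

lemma tensor_scale:
  assumes \<Phi>: "\<Phi> \<in> hcarrier XH"
  shows "hscale XH c \<Phi> \<in> hcarrier XH"
  unfolding hscale_tensor
proof (rule tensorI)
  note t = tensorD[OF \<Phi>]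
  fix x y assume x: "x \<in> hcarrier X"
  show "hscale H c (\<Phi> x) \<in> hcarrier H" using t x by simp
  show "hscale H c (\<Phi> (hscale X d x)) = hscale H (cnj d) (hscale H c (\<Phi> x))" for d
    using t x by (simp add: mult.commute)
  show "hnorm H (hscale H c (\<Phi> x)) \<le> (cmod c * hnorm XH \<Phi>) * hnorm X x"
    using hnorm_tensor_apply_le[OF \<Phi> x] t x by (simp add: H.hnorm_scale mult.assoc mult_left_mono)
  show "hscale H c (\<Phi> (x + y)) = hscale H c (\<Phi> x) + hscale H c (\<Phi> y)" if "y \<in> hcarrier X"
    using t x that by (simp add: H.scale_right_distrib)
next
  show "hscale H c (\<Phi> x) = 0" if "x \<notin> hcarrier X" for x
    using that tensorD(2)[OF \<Phi>] by simp
  fix F assume F: "finite F" "F \<subseteq> E"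
  have "(\<Sum>e\<in>F. (hnorm H (hscale H c (\<Phi> e)))\<^sup>2) = (\<Sum>e\<in>F. (cmod c)\<^sup>2 * (hnorm H (\<Phi> e))\<^sup>2)"
    using F onb_in_carrier tensorD(1)[OF \<Phi>]
    by (intro sum.cong) (auto simp: H.hnorm_scale power_mult_distrib)
  also have "\<dots> \<le> (cmod c)\<^sup>2 * (hnorm XH \<Phi>)\<^sup>2"
    unfolding sum_distrib_left[symmetric]
    using sum_le_hnorm_tensor[OF \<Phi> F] by (simp add: mult_left_mono)
  finally show "(\<Sum>e\<in>F. (hnorm H (hscale H c (\<Phi> e)))\<^sup>2) \<le> (cmod c)\<^sup>2 * (hnorm XH \<Phi>)\<^sup>2" .
qed

lemma tensor_zero: "0 \<in> hcarrier XH"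
  by (rule tensorI[where M = 0 and N = 0]) auto

lemma tensor_diff:
  assumes "\<Phi> \<in> hcarrier XH" "\<Psi> \<in> hcarrier XH"
  shows "\<Phi> - \<Psi> \<in> hcarrier XH"
proof -
  have "\<Phi> - \<Psi> = \<Phi> + hscale XH (-1) \<Psi>" by (simp add: fun_eq_iff hscale_tensor)
  then show ?thesis using tensor_add[OF assms(1) tensor_scale[OF assms(2)]] by metis
qed

text \<open>A Cauchy sequence in Hilbert-Schmidt norm is Cauchy at every point, so it has a
  pointwise limit in \<open>H\<close>. The limit inherits additivity and conjugate homogeneity, and
  the finite sections of the Cauchy estimate survive the passage to the limit.\<close>

lemma tensor_complete:
  assumes s: "\<And>m. s m \<in> hcarrier XH"
    and C: "\<And>e. e > 0 \<Longrightarrow> \<exists>N. \<forall>m\<ge>N. \<forall>k\<ge>N. hnorm XH (s m - s k) < e"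
  shows "\<exists>\<Phi>\<in>hcarrier XH. (\<lambda>m. hnorm XH (s m - \<Phi>)) \<longlonglongrightarrow> 0"
proof -
  note t = tensorD[OF s]
  have "\<exists>z\<in>hcarrier H. (\<lambda>m. hnorm H (s m x - z)) \<longlonglongrightarrow> 0" if x: "x \<in> hcarrier X" for x
  proof (rule H.complete)
    show "s m x \<in> hcarrier H" for m using t x by simp
    fix e :: real assume e: "e > 0"
    \<comment> \<open>Adding 1 keeps the divisor positive when \<open>x\<close> is 0.\<close>
    have p: "0 < 1 + hnorm X x" using x by (simp add: add_pos_nonneg)
    obtain N where N: "\<forall>m\<ge>N. \<forall>k\<ge>N. hnorm XH (s m - s k) < e / (1 + hnorm X x)"
      using C[of "e / (1 + hnorm X x)"] e p by auto
    have "hnorm H (s m x - s k x) < e" if "m \<ge> N" "k \<ge> N" for m k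
    proof -
      have "hnorm H (s m x - s k x) \<le> hnorm XH (s m - s k) * hnorm X x"
        using hnorm_tensor_apply_le[OF tensor_diff[OF s s] x, of m k] by simp
      also have "\<dots> \<le> hnorm XH (s m - s k) * (1 + hnorm X x)"
        using hnorm_tensor_nonneg[OF tensor_diff[OF s s]] by (intro mult_left_mono) auto
      also have "\<dots> < e" using N that p by (simp add: pos_less_divide_eq)
      finally show ?thesis .
    qed
    then show "\<exists>N. \<forall>m\<ge>N. \<forall>k\<ge>N. hnorm H (s m x - s k x) < e" by blast
  qed
  then obtain L0 where L0: "\<And>x. x \<in> hcarrier X \<Longrightarrow> L0 x \<in> hcarrier H"
    "\<And>x. x \<in> hcarrier X \<Longrightarrow> (\<lambda>m. hnorm H (s m x - L0 x)) \<longlonglongrightarrow> 0" by metis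
  define L where "L x = (if x \<in> hcarrier X then L0 x else 0)" for x
  have L: "L x \<in> hcarrier H" "(\<lambda>m. hnorm H (s m x - L x)) \<longlonglongrightarrow> 0" if "x \<in> hcarrier X" for x
    using L0 that by (auto simp: L_def)
  \<comment> \<open>With \<open>m\<close> fixed and \<open>k\<close> growing, estimates for
    \<open>s m - s k\<close> become estimates for \<open>s m - L\<close>.\<close>
  have diff_lim: "(\<lambda>k. hnorm H (s m x - s k x)) \<longlonglongrightarrow> hnorm H (s m x - L x)"
    if x: "x \<in> hcarrier X" for m x
  proof (rule LIM_zero_cancel, rule Lim_null_comparison[OF _ L(2)[OF x]], intro always_eventually allI)
    fix k
    have "\<bar>hnorm H (s m x - s k x) - hnorm H (s m x - L x)\<bar> \<le> hnorm H ((s m x - s k x) - (s m x - L x))"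
      using t x L by (intro H.hnorm_reverse_triangle) auto
    also have "\<dots> = hnorm H (s k x - L x)"
      using H.hnorm_minus_commute[of "L x" "s k x"] t x L by simp
    finally show "norm (hnorm H (s m x - s k x) - hnorm H (s m x - L x)) \<le> hnorm H (s k x - L x)" by simp
  qed
  have Ladd: "L (x + y) = L x + L y" if x: "x \<in> hcarrier X" and y: "y \<in> hcarrier X" for x y
  proof (rule H.tendsto_unique[of "\<lambda>m. s m (x + y)"])
    show "(\<lambda>m. hnorm H (s m (x + y) - (L x + L y))) \<longlonglongrightarrow> 0"
    proof (rule Lim_null_comparison[OF always_eventually])
      show "(\<lambda>m. hnorm H (s m x - L x) + hnorm H (s m y - L y)) \<longlonglongrightarrow> 0"
        using tendsto_add[OF L(2)[OF x] L(2)[OF y]] by simp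
      show "\<forall>m. norm (hnorm H (s m (x + y) - (L x + L y))) \<le> hnorm H (s m x - L x) + hnorm H (s m y - L y)"
      proof
        fix m
        have "s m (x + y) - (L x + L y) = (s m x - L x) + (s m y - L y)"
          using t x y by (simp add: algebra_simps)
        moreover have "hnorm H ((s m x - L x) + (s m y - L y)) \<le> hnorm H (s m x - L x) + hnorm H (s m y - L y)"
          using t x y L by (intro H.hnorm_triangle) auto
        moreover have "0 \<le> hnorm H (s m (x + y) - (L x + L y))" using t(1)[of "x + y" m] x y L by simp
        ultimately show "norm (hnorm H (s m (x + y) - (L x + L y))) \<le> hnorm H (s m x - L x) + hnorm H (s m y - L y)"
          by (simp only: real_norm_def abs_of_nonneg)
      qed
    qed
    show "(\<lambda>m. hnorm H (s m (x + y) - L (x + y))) \<longlonglongrightarrow> 0" using x y by (intro L) simp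
  qed (use t(1) L(1) x y in auto)
  have Lscale: "L (hscale X c x) = hscale H (cnj c) (L x)" if x: "x \<in> hcarrier X" for x c
  proof (rule H.tendsto_unique[of "\<lambda>m. s m (hscale X c x)"])
    have "hnorm H (s m (hscale X c x) - hscale H (cnj c) (L x)) = cmod c * hnorm H (s m x - L x)" for m
    proof -
      have "s m (hscale X c x) - hscale H (cnj c) (L x) = hscale H (cnj c) (s m x - L x)"
        using t x by (simp add: H.scale_right_diff_distrib)
      then show ?thesis using t x L by (simp add: H.hnorm_scale)
    qed
    then show "(\<lambda>m. hnorm H (s m (hscale X c x) - hscale H (cnj c) (L x))) \<longlonglongrightarrow> 0"
      using tendsto_mult_left[OF L(2)[OF x], of "cmod c"] by simp
    show "(\<lambda>m. hnorm H (s m (hscale X c x) - L (hscale X c x))) \<longlonglongrightarrow> 0" using x by (intro L) simp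
  qed (use t(1) L(1) x in auto)
  have close: "s m - L \<in> hcarrier XH \<and> hnorm XH (s m - L) \<le> d"
    if d: "d > 0" and N: "\<forall>m\<ge>N. \<forall>k\<ge>N. hnorm XH (s m - s k) < d" and m: "m \<ge> N" for d N m
  proof -
    have Fsum: "(\<Sum>e\<in>F. (hnorm H ((s m - L) e))\<^sup>2) \<le> d\<^sup>2" if F: "finite F" "F \<subseteq> E" for F
    proof (rule sum_tendsto_le)
      fix e assume "e \<in> F"
      then have "e \<in> hcarrier X" using F onb_in_carrier by blast
      then show "(\<lambda>k. (hnorm H (s m e - s k e))\<^sup>2) \<longlonglongrightarrow> (hnorm H ((s m - L) e))\<^sup>2"
        using tendsto_power[OF diff_lim] by simp
    next
      fix k assume "k \<ge> N"
      then have "(hnorm XH (s m - s k))\<^sup>2 \<le> d\<^sup>2"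
        using N m hnorm_tensor_nonneg[OF tensor_diff[OF s s]] by (intro power_mono) (auto intro: less_imp_le)
      then show "(\<Sum>e\<in>F. (hnorm H (s m e - s k e))\<^sup>2) \<le> d\<^sup>2"
        using sum_le_hnorm_tensor[OF tensor_diff[OF s s] F, of m k] by simp
    qed
    have bd: "hnorm H (s m x - L x) \<le> d * hnorm X x" if x: "x \<in> hcarrier X" for x
    proof (rule LIMSEQ_le_const2[OF diff_lim[OF x]], intro exI[of _ N] allI impI)
      fix k assume "k \<ge> N"
      then have "hnorm XH (s m - s k) * hnorm X x \<le> d * hnorm X x"
        using N m x by (intro mult_right_mono) (auto intro: less_imp_le)
      then show "hnorm H (s m x - s k x) \<le> d * hnorm X x"
        using hnorm_tensor_apply_le[OF tensor_diff[OF s s] x, of m k] by simp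
    qed
    have "s m - L \<in> hcarrier XH"
      by (rule tensorI[where M = d and N = "d\<^sup>2"])
        (use t L Ladd Lscale bd Fsum in \<open>simp_all add: H.scale_right_diff_distrib\<close>, simp add: L_def)
    then show ?thesis using d Fsum by (auto intro: hnorm_tensor_le)
  qed
  show ?thesis
  proof
    obtain N where "\<forall>m\<ge>N. \<forall>k\<ge>N. hnorm XH (s m - s k) < 1" using C[of 1] by auto
    then have "s N - L \<in> hcarrier XH" using close[of 1 N N] by simp
    \<comment> \<open>The estimates speak about differences only, so \<open>L\<close> is reached as
      \<open>s N - (s N - L)\<close>.\<close>
    from tensor_diff[OF s[of N] this] show "L \<in> hcarrier XH"
      by (simp add: fun_diff_def)
    show "(\<lambda>m. hnorm XH (s m - L)) \<longlonglongrightarrow> 0"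
    proof (rule LIMSEQ_I)
      fix r :: real assume r: "r > 0"
      obtain N where N: "\<forall>m\<ge>N. \<forall>k\<ge>N. hnorm XH (s m - s k) < r / 2" using C[of "r / 2"] r by auto
      have "norm (hnorm XH (s m - L) - 0) < r" if "m \<ge> N" for m
        using close[of "r / 2" N m] N that r hnorm_tensor_nonneg[of "s m - L"] by force
      then show "\<exists>N. \<forall>m\<ge>N. norm (hnorm XH (s m - L) - 0) < r" by blast
    qed
  qed
qed

lemma tensor_eq_0I:
  assumes \<Phi>: "\<Phi> \<in> hcarrier XH" and "hnorm XH \<Phi> = 0" shows "\<Phi> = 0"
proof
  fix x
  show "\<Phi> x = 0 x"
  proof (cases "x \<in> hcarrier X")
    case True
    then have "hnorm H (\<Phi> x) = 0"
      using hnorm_tensor_apply_le[OF \<Phi> True] assms(2) tensorD(1)[OF \<Phi>] by (intro antisym) auto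
    then show ?thesis using H.hnorm_eq_0 tensorD(1)[OF \<Phi> True] by simp
  qed (use tensorD(2)[OF \<Phi>] in simp)
qed

sublocale T: hilbert_space XH
proof unfold_locales
  show vs: "hscale XH a (x + y) = hscale XH a x + hscale XH a y"
    "hscale XH (a + b) x = hscale XH a x + hscale XH b x"
    "hscale XH a (hscale XH b x) = hscale XH (a * b) x"
    "hscale XH 1 x = x" for a b x y
    by (simp_all add: hscale_tensor fun_eq_iff H.scale_right_distrib H.scale_left_distrib)
  interpret vector_space "hscale XH" by unfold_locales (rule vs)+
  show "subspace (hcarrier XH)"
    by (rule subspaceI) (auto intro: tensor_zero tensor_add tensor_scale)
next
  fix x y z c assume x: "x \<in> hcarrier XH" and y: "y \<in> hcarrier XH"
  show "hip XH (x + y) z = hip XH x z + hip XH y z" if z: "z \<in> hcarrier XH"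
    unfolding hip_tensor infsum_add[OF tensor_ip_summable[OF x z] tensor_ip_summable[OF y z], symmetric]
    using x y z onb_in_carrier by (intro infsum_cong) (simp add: H.ip_simps tensorD)
  show "hip XH (hscale XH c x) y = c * hip XH x y"
    unfolding hip_tensor infsum_cmult_right'[symmetric] hscale_tensor
    using x y onb_in_carrier by (intro infsum_cong) (simp add: H.ip_simps tensorD)
  show "hip XH y x = cnj (hip XH x y)"
    unfolding hip_tensor infsum_cnj[symmetric]
    using x y onb_in_carrier by (intro infsum_cong H.ip_cnj) (simp_all add: tensorD)
next
  fix x assume x: "x \<in> hcarrier XH" "x \<noteq> 0"
  then have "hnorm XH x \<noteq> 0" using tensor_eq_0I by blast
  then have "0 < (hnorm XH x)\<^sup>2" by simp
  then show "0 < Re (hip XH x x)"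
    using hip_tensor_self[OF x(1)] by (simp add: hnorm_tensor_sq[OF x(1)])
qed (rule tensor_complete)

text \<open>
  The Hilbert-Schmidt norm of \<open>C \<Phi> T\<^sup>*\<close> is estimated on the side of the conjugate linear adjoint,
  where \<open>T\<^sup>*\<close> turns into \<open>T\<close> acting on the values.
\<close>

lemma tensor_op_estimate:
  assumes \<Phi>: "\<Phi> \<in> hcarrier XH" and T: "T \<in> bops X"
    and t: "0 \<le> t" "\<And>x. x \<in> hcarrier X \<Longrightarrow> hnorm X (T x) \<le> t * hnorm X x"
    and F: "finite F" "F \<subseteq> E"
  shows "(\<Sum>e\<in>F. (hnorm H (\<Phi> (adj X T e)))\<^sup>2) \<le> (t * hnorm XH \<Phi>)\<^sup>2"
proof -
  interpret HH: hilbert_pair H H ..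
  let ?G = "some_onb H"
  let ?\<Psi> = "cadj \<Phi>"
  have FX: "e \<in> hcarrier X" if "e \<in> F" for e using F that onb_in_carrier by blast
  \<comment> \<open>Parseval in \<open>H\<close> for each of the finitely many vectors puts the sum
    over \<open>F\<close> inside a sum over a basis of \<open>H\<close>; it is then enough to bound
    finite sections \<open>G\<close> of that basis.\<close>
  have "((\<lambda>g. \<Sum>e\<in>F. (cmod (hip H g (\<Phi> (adj X T e))))\<^sup>2)
      has_sum (\<Sum>e\<in>F. (hnorm H (\<Phi> (adj X T e)))\<^sup>2)) ?G"
    by (rule has_sum_finite_sum) (rule HH.hnorm_sq_onb tensorD(1)[OF \<Phi>] X.adj_props(1)[OF T] FX, assumption?)+
  then show ?thesis
  proof (rule has_sum_le_finite_sums)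
    fix G assume G: "finite G" "G \<subseteq> ?G"
    then have GH: "g \<in> hcarrier H" if "g \<in> G" for g using that HH.onb_in_carrier by blast
    \<comment> \<open>Pairing with \<open>g\<close> turns \<open>\<Phi>\<close> into
      \<open>?\<Psi>\<close>, and \<open>adj X T\<close> in one slot becomes \<open>T\<close> in the
      other. Now \<open>e\<close> stands alone and Bessel in \<open>X\<close> applies; the vectors
      \<open>adj X T e\<close> themselves need not be orthogonal.\<close>
    have cm: "cmod (hip H g (\<Phi> (adj X T e))) = cmod (hip X (T (?\<Psi> g)) e)" if "g \<in> G" "e \<in> F" for g e
      using cadj(2)[OF \<Phi> GH[OF that(1)], of "adj X T e"] X.adj_props[OF T FX[OF that(2)]]
        X.ip_cnj[of "?\<Psi> g" "adj X T e"] cadj(1)[OF \<Phi> GH[OF that(1)]] by simp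
    have "(\<Sum>g\<in>G. \<Sum>e\<in>F. (cmod (hip H g (\<Phi> (adj X T e))))\<^sup>2) \<le> (\<Sum>g\<in>G. t\<^sup>2 * (hnorm X (?\<Psi> g))\<^sup>2)"
    proof (rule sum_mono)
      fix g assume g: "g \<in> G"
      note a = cadj(1)[OF \<Phi> GH[OF g]]
      have "(\<Sum>e\<in>F. (cmod (hip H g (\<Phi> (adj X T e))))\<^sup>2) = (\<Sum>e\<in>F. (cmod (hip X (T (?\<Psi> g)) e))\<^sup>2)"
        using cm[OF g] by simp
      also have "\<dots> \<le> (hnorm X (T (?\<Psi> g)))\<^sup>2"
        using F by (intro X.Bessel[OF X.onb_some_onb] bopsD[OF T] a)
      also have "\<dots> \<le> (t * hnorm X (?\<Psi> g))\<^sup>2"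
        using t(2)[OF a] bopsD(1)[OF T a] by (intro power_mono) auto
      finally show "(\<Sum>e\<in>F. (cmod (hip H g (\<Phi> (adj X T e))))\<^sup>2) \<le> t\<^sup>2 * (hnorm X (?\<Psi> g))\<^sup>2"
        by (simp add: power_mult_distrib)
    qed
    also have "\<dots> \<le> t\<^sup>2 * (hnorm XH \<Phi>)\<^sup>2"
      unfolding sum_distrib_left[symmetric]
    proof (rule mult_left_mono)
      \<comment> \<open>The way back: expanding in the basis of \<open>X\<close> and applying Bessel
        in \<open>H\<close> to each \<open>\<Phi> e\<close> bounds the Hilbert-Schmidt sum of the
        adjoint by that of \<open>\<Phi>\<close>.\<close>
      have "((\<lambda>e. \<Sum>g\<in>G. (cmod (hip X e (?\<Psi> g)))\<^sup>2) has_sum (\<Sum>g\<in>G. (hnorm X (?\<Psi> g))\<^sup>2)) E"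
        by (rule has_sum_finite_sum) (intro hnorm_sq_onb cadj(1)[OF \<Phi>] GH)
      then show "(\<Sum>g\<in>G. (hnorm X (?\<Psi> g))\<^sup>2) \<le> (hnorm XH \<Phi>)\<^sup>2"
      proof (rule has_sum_le_finite_sums)
        fix F' assume F': "finite F'" "F' \<subseteq> E"
        have "(\<Sum>e\<in>F'. \<Sum>g\<in>G. (cmod (hip X e (?\<Psi> g)))\<^sup>2) \<le> (\<Sum>e\<in>F'. (hnorm H (\<Phi> e))\<^sup>2)"
        proof (rule sum_mono)
          fix e assume "e \<in> F'"
          then have e: "e \<in> hcarrier X" using F' onb_in_carrier by blast
          note pe = tensorD(1)[OF \<Phi> e]
          have "cmod (hip X e (?\<Psi> g)) = cmod (hip H (\<Phi> e) g)" if "g \<in> G" for g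
            using cadj(2)[OF \<Phi> GH[OF that] e] H.ip_cnj[OF pe GH[OF that]] by (metis complex_mod_cnj)
          then show "(\<Sum>g\<in>G. (cmod (hip X e (?\<Psi> g)))\<^sup>2) \<le> (hnorm H (\<Phi> e))\<^sup>2"
            using H.Bessel[OF H.onb_some_onb pe G] by simp
        qed
        also have "\<dots> \<le> (hnorm XH \<Phi>)\<^sup>2" by (rule sum_le_hnorm_tensor[OF \<Phi> F'])
        finally show "(\<Sum>e\<in>F'. \<Sum>g\<in>G. (cmod (hip X e (?\<Psi> g)))\<^sup>2) \<le> (hnorm XH \<Phi>)\<^sup>2" .
      qed
    qed simp
    finally show "(\<Sum>g\<in>G. \<Sum>e\<in>F. (cmod (hip H g (\<Phi> (adj X T e))))\<^sup>2) \<le> (t * hnorm XH \<Phi>)\<^sup>2"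
      by (simp add: power_mult_distrib)
  qed
qed

text \<open>\<open>C\<close> acts on the values and costs its bound c; \<open>adj X T\<close> acts
  on the arguments and costs t by \<open>tensor_op_estimate\<close>. So c t bounds the tensor
  product.\<close>

lemma tensor_op_bops:
  assumes T: "T \<in> bops X" and C: "C \<in> bops H"
  shows "tensor_op X H T C \<in> bops XH"
proof -
  obtain t where t: "0 \<le> t" "\<And>x. x \<in> hcarrier X \<Longrightarrow> hnorm X (T x) \<le> t * hnorm X x"
    using X.bops_bound_nonneg[OF T] by blast
  obtain c where c: "0 \<le> c" "\<And>x. x \<in> hcarrier H \<Longrightarrow> hnorm H (C x) \<le> c * hnorm H x"
    using H.bops_bound_nonneg[OF C] by blast
  note a = bopsD[OF X.adj_bops[OF T]] and b = bopsD[OF C]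
  have C0: "C 0 = 0" using b(3)[of 0 0] by simp
  define W where "W \<Phi> = (\<lambda>y. C (\<Phi> (adj X T y)))" for \<Phi>
  have est: "(\<Sum>e\<in>F. (hnorm H (W \<Phi> e))\<^sup>2) \<le> (c * t * hnorm XH \<Phi>)\<^sup>2"
    if \<Phi>: "\<Phi> \<in> hcarrier XH" and F: "finite F" "F \<subseteq> E" for \<Phi> F
  proof -
    have "(\<Sum>e\<in>F. (hnorm H (W \<Phi> e))\<^sup>2) \<le> (\<Sum>e\<in>F. c\<^sup>2 * (hnorm H (\<Phi> (adj X T e)))\<^sup>2)"
    proof (rule sum_mono)
      fix e assume "e \<in> F"
      then have "\<Phi> (adj X T e) \<in> hcarrier H" using F onb_in_carrier a(1) tensorD(1)[OF \<Phi>] by blast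
      then show "(hnorm H (W \<Phi> e))\<^sup>2 \<le> c\<^sup>2 * (hnorm H (\<Phi> (adj X T e)))\<^sup>2"
        unfolding W_def power_mult_distrib[symmetric] using c b by (intro power_mono) auto
    qed
    also have "\<dots> \<le> c\<^sup>2 * (t * hnorm XH \<Phi>)\<^sup>2"
      unfolding sum_distrib_left[symmetric]
      using tensor_op_estimate[OF \<Phi> T t F] by (intro mult_left_mono) auto
    finally show ?thesis by (simp add: power_mult_distrib mult.assoc)
  qed
  have W: "W \<Phi> \<in> hcarrier XH" if \<Phi>: "\<Phi> \<in> hcarrier XH" for \<Phi>
  proof (rule tensorI[OF _ _ _ _ _ est[OF \<Phi>]])
    fix x y assume x: "x \<in> hcarrier X"
    note p = tensorD[OF \<Phi>]
    show "W \<Phi> x \<in> hcarrier H" using x a b p by (simp add: W_def)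
    show "W \<Phi> (hscale X d x) = hscale H (cnj d) (W \<Phi> x)" for d using x a b p by (simp add: W_def)
    show "W \<Phi> (x + y) = W \<Phi> x + W \<Phi> y" if "y \<in> hcarrier X" using x that a b p by (simp add: W_def)
    have "hnorm H (W \<Phi> x) \<le> c * hnorm H (\<Phi> (adj X T x))" using x a p c by (simp add: W_def)
    also have "\<dots> \<le> c * (hnorm XH \<Phi> * hnorm X (adj X T x))"
      using hnorm_tensor_apply_le[OF \<Phi> a(1)[OF x]] c by (intro mult_left_mono) auto
    also have "\<dots> \<le> c * (hnorm XH \<Phi> * (t * hnorm X x))"
      using X.adj_bound[OF T x t] c hnorm_tensor_nonneg[OF \<Phi>] by (intro mult_left_mono) auto
    finally show "hnorm H (W \<Phi> x) \<le> (c * hnorm XH \<Phi> * t) * hnorm X x" by (simp add: mult_ac)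
  next
    show "W \<Phi> x = 0" if "x \<notin> hcarrier X" for x
      using that a(2) tensorD(3)[OF \<Phi>, of 0 0] C0 by (simp add: W_def)
  qed
  have nW: "hnorm XH (W \<Phi>) \<le> (c * t) * hnorm XH \<Phi>" if \<Phi>: "\<Phi> \<in> hcarrier XH" for \<Phi>
    using hnorm_tensor_le[OF W[OF \<Phi>] _ est[OF \<Phi>]] c t hnorm_tensor_nonneg[OF \<Phi>] by simp
  \<comment> \<open>Off the carrier the adjoint is 0, which again lies in the carrier; the next two
    identities therefore hold as equalities of functions on the whole type.\<close>
  have aX: "adj X T y \<in> hcarrier X" for y using a(1,2) by (cases "y \<in> hcarrier X") auto
  have add: "W (\<Phi> + \<Psi>) = W \<Phi> + W \<Psi>" if "\<Phi> \<in> hcarrier XH" "\<Psi> \<in> hcarrier XH" for \<Phi> \<Psi>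
    using that by (simp add: W_def fun_eq_iff b aX tensorD)
  have scale: "W (hscale XH d \<Phi>) = hscale XH d (W \<Phi>)" if "\<Phi> \<in> hcarrier XH" for \<Phi> d
    using that by (simp add: W_def fun_eq_iff b aX tensorD hscale_tensor)
  have "tensor_op X H T C \<Phi> = (if \<Phi> \<in> hcarrier XH then W \<Phi> else 0)" for \<Phi>
    by (simp add: tensor_op_def W_def)
  then show ?thesis unfolding bops_def using W nW add scale by auto
qed

end

text \<open>Moves the power of r produced by a word of scaled creation operators from the Fock
  factor to the coefficient.\<close>

lemma tensor_vec_scale_left:
  assumes "hilbert_space X" "hilbert_space H" "x \<in> hcarrier X"
  shows "tensor_vec X H (hscale X c x) h = tensor_vec X H x (hscale H c h)"
proof -
  interpret X: hilbert_space X by fact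
  interpret H: hilbert_space H by fact
  show ?thesis using assms(3) by (auto simp: tensor_vec_def fun_eq_iff X.ip_simps mult.commute)
qed

section \<open>Creation operators on the Fock space\<close>

definition l2_space :: "('i \<Rightarrow> complex) hspace" where
  "l2_space = \<lparr>
     hcarrier = {f. (\<lambda>x. (cmod (f x))\<^sup>2) summable_on UNIV},
     hscale = (\<lambda>c f x. c * f x),
     hip = (\<lambda>f g. \<Sum>\<^sub>\<infinity>x. f x * cnj (g x))\<rparr>"

lemma l2_carrier: "f \<in> hcarrier l2_space \<longleftrightarrow> (\<lambda>x. (cmod (f x))\<^sup>2) summable_on UNIV"
  by (simp add: l2_space_def)

lemma l2_scale: "hscale l2_space c f = (\<lambda>x. c * f x)"
  by (simp add: l2_space_def)

lemma l2_ip: "hip l2_space f g = (\<Sum>\<^sub>\<infinity>x. f x * cnj (g x))"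
  by (simp add: l2_space_def)

lemma l2_carrierI:
  assumes "\<And>F. finite F \<Longrightarrow> (\<Sum>x\<in>F. (cmod (f x))\<^sup>2) \<le> N"
  shows "f \<in> hcarrier l2_space"
  unfolding l2_carrier by (rule nonneg_bdd_above_summable_on) (auto intro!: bdd_aboveI2 assms)

lemma l2_ip_summable:
  assumes "f \<in> hcarrier l2_space" "g \<in> hcarrier l2_space"
  shows "(\<lambda>x. f x * cnj (g x)) summable_on UNIV"
proof -
  have "(\<lambda>x. (cmod (f x))\<^sup>2 + (cmod (g x))\<^sup>2) summable_on UNIV"
    using assms unfolding l2_carrier by (rule summable_on_add)
  then have "(\<lambda>x. cmod (f x * cnj (g x))) summable_on UNIV"
  proof (rule summable_on_comparison_test)
    fix x
    show "cmod (f x * cnj (g x)) \<le> (cmod (f x))\<^sup>2 + (cmod (g x))\<^sup>2"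
      using sum_squares_bound[of "cmod (f x)" "cmod (g x)"]
        zero_le_power2[of "cmod (f x)"] zero_le_power2[of "cmod (g x)"]
      unfolding norm_mult complex_mod_cnj by argo
  qed simp
  then show ?thesis by (rule abs_summable_summable)
qed

lemma l2_ip_self:
  assumes "f \<in> hcarrier l2_space"
  shows "hip l2_space f f = of_real (\<Sum>\<^sub>\<infinity>x. (cmod (f x))\<^sup>2)"
proof -
  have "((\<lambda>x. complex_of_real ((cmod (f x))\<^sup>2)) has_sum of_real (\<Sum>\<^sub>\<infinity>x. (cmod (f x))\<^sup>2)) UNIV"
    using assms unfolding l2_carrier by (intro has_sum_of_real has_sum_infsum)
  then show ?thesis unfolding l2_ip complex_norm_square by (rule infsumI)
qed

lemma l2_norm_sq:
  assumes "f \<in> hcarrier l2_space"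
  shows "(hnorm l2_space f)\<^sup>2 = (\<Sum>\<^sub>\<infinity>x. (cmod (f x))\<^sup>2)"
  unfolding hnorm_def l2_ip_self[OF assms] by (simp add: infsum_nonneg)

lemma sum_le_l2_norm:
  assumes "f \<in> hcarrier l2_space" "finite F"
  shows "(\<Sum>x\<in>F. (cmod (f x))\<^sup>2) \<le> (hnorm l2_space f)\<^sup>2"
  unfolding l2_norm_sq[OF assms(1)]
  using assms by (intro finite_sum_le_infsum) (auto simp: l2_carrier)

lemma l2_norm_le:
  assumes "f \<in> hcarrier l2_space" "0 \<le> c" "\<And>F. finite F \<Longrightarrow> (\<Sum>x\<in>F. (cmod (f x))\<^sup>2) \<le> c\<^sup>2"
  shows "hnorm l2_space f \<le> c"
proof (rule power2_le_imp_le[OF _ assms(2)])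
  show "(hnorm l2_space f)\<^sup>2 \<le> c\<^sup>2"
    unfolding l2_norm_sq[OF assms(1)] using assms
    by (intro infsum_le_finite_sums) (auto simp: l2_carrier)
qed

lemma l2_norm_nonneg: "f \<in> hcarrier l2_space \<Longrightarrow> 0 \<le> hnorm l2_space f"
  unfolding hnorm_def by (simp add: l2_ip_self infsum_nonneg)

lemma l2_coord_le:
  assumes "f \<in> hcarrier l2_space"
  shows "cmod (f x) \<le> hnorm l2_space f"
  using sum_le_l2_norm[OF assms, of "{x}"] l2_norm_nonneg[OF assms]
  by (auto intro: power2_le_imp_le)

lemma l2_add:
  assumes f: "f \<in> hcarrier l2_space" and g: "g \<in> hcarrier l2_space"
  shows "f + g \<in> hcarrier l2_space"
proof (rule l2_carrierI)
  fix F :: "'a set" assume F: "finite F"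
  have le: "(cmod (a + b))\<^sup>2 \<le> 2 * (cmod a)\<^sup>2 + 2 * (cmod b)\<^sup>2" for a b
    using power_mono[OF norm_triangle_ineq[of a b], of 2] sum_squares_bound[of "cmod a" "cmod b"]
    by (simp add: power2_sum)
  have "(\<Sum>x\<in>F. (cmod ((f + g) x))\<^sup>2) \<le> (\<Sum>x\<in>F. 2 * (cmod (f x))\<^sup>2 + 2 * (cmod (g x))\<^sup>2)"
    unfolding plus_fun_apply by (intro sum_mono le)
  also have "\<dots> \<le> 2 * (hnorm l2_space f)\<^sup>2 + 2 * (hnorm l2_space g)\<^sup>2"
    unfolding sum.distrib sum_distrib_left[symmetric]
    using sum_le_l2_norm[OF f F] sum_le_l2_norm[OF g F] by simp
  finally show "(\<Sum>x\<in>F. (cmod ((f + g) x))\<^sup>2) \<le> 2 * (hnorm l2_space f)\<^sup>2 + 2 * (hnorm l2_space g)\<^sup>2" .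
qed

lemma l2_scale_closed:
  assumes f: "f \<in> hcarrier l2_space" shows "hscale l2_space c f \<in> hcarrier l2_space"
  using f unfolding l2_carrier l2_scale norm_mult power_mult_distrib
  by (rule summable_on_cmult_right)

lemma l2_diff:
  assumes "f \<in> hcarrier l2_space" "g \<in> hcarrier l2_space"
  shows "f - g \<in> hcarrier l2_space"
proof -
  have "f - g = f + hscale l2_space (-1) g" by (simp add: fun_eq_iff l2_scale)
  then show ?thesis using l2_add[OF assms(1) l2_scale_closed[OF assms(2)]] by metis
qed

text \<open>Each coordinate is dominated by the norm, so the coordinates converge; the limit is
  treated by finite sections as in \<open>tensor_complete\<close>.\<close>

lemma l2_complete:
  assumes s: "\<And>m. s m \<in> hcarrier l2_space"
    and C: "\<And>e. e > 0 \<Longrightarrow> \<exists>N. \<forall>m\<ge>N. \<forall>k\<ge>N. hnorm l2_space (s m - s k) < e"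
  shows "\<exists>f\<in>hcarrier l2_space. (\<lambda>m. hnorm l2_space (s m - f)) \<longlonglongrightarrow> 0"
proof -
  have "convergent (\<lambda>m. s m x)" for x
    unfolding Cauchy_convergent_iff[symmetric]
  proof (rule CauchyI)
    fix e :: real assume "0 < e"
    then obtain N where N: "\<forall>m\<ge>N. \<forall>k\<ge>N. hnorm l2_space (s m - s k) < e" using C by blast
    have "norm (s m x - s k x) < e" if "m \<ge> N" "k \<ge> N" for m k
      using N that l2_coord_le[OF l2_diff[OF s s], of m k x] by fastforce
    then show "\<exists>N. \<forall>m\<ge>N. \<forall>k\<ge>N. norm (s m x - s k x) < e" by blast
  qed
  then obtain f where f: "\<And>x. (\<lambda>m. s m x) \<longlonglongrightarrow> f x" unfolding convergent_def by metis
  have close: "s m - f \<in> hcarrier l2_space \<and> hnorm l2_space (s m - f) \<le> d"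
    if d: "d > 0" and N: "\<forall>m\<ge>N. \<forall>k\<ge>N. hnorm l2_space (s m - s k) < d" and m: "m \<ge> N" for d N m
  proof -
    have Fsum: "(\<Sum>x\<in>F. (cmod ((s m - f) x))\<^sup>2) \<le> d\<^sup>2" if F: "finite F" for F
    proof (rule sum_tendsto_le)
      show "(\<lambda>k. (cmod (s m x - s k x))\<^sup>2) \<longlonglongrightarrow> (cmod ((s m - f) x))\<^sup>2" for x
        using f[of x] by (auto intro!: tendsto_intros)
    next
      fix k assume "k \<ge> N"
      then have "(hnorm l2_space (s m - s k))\<^sup>2 \<le> d\<^sup>2"
        using N m l2_norm_nonneg[OF l2_diff[OF s s]] by (intro power_mono) (auto intro: less_imp_le)
      then show "(\<Sum>x\<in>F. (cmod (s m x - s k x))\<^sup>2) \<le> d\<^sup>2"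
        using sum_le_l2_norm[OF l2_diff[OF s s] F, of m k] by simp
    qed
    have "s m - f \<in> hcarrier l2_space" using Fsum by (rule l2_carrierI)
    then show ?thesis using d Fsum by (auto intro: l2_norm_le)
  qed
  show ?thesis
  proof
    obtain N where "\<forall>m\<ge>N. \<forall>k\<ge>N. hnorm l2_space (s m - s k) < 1" using C[of 1] by auto
    then have "s N - f \<in> hcarrier l2_space" using close[of 1 N N] by simp
    from l2_diff[OF s[of N] this] show "f \<in> hcarrier l2_space"
      by (simp add: fun_diff_def)
    show "(\<lambda>m. hnorm l2_space (s m - f)) \<longlonglongrightarrow> 0"
    proof (rule LIMSEQ_I)
      fix r :: real assume r: "r > 0"
      obtain N where N: "\<forall>m\<ge>N. \<forall>k\<ge>N. hnorm l2_space (s m - s k) < r / 2" using C[of "r / 2"] r by auto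
      have "norm (hnorm l2_space (s m - f) - 0) < r" if "m \<ge> N" for m
        using close[of "r / 2" N m] N that r l2_norm_nonneg[of "s m - f"] by force
      then show "\<exists>N. \<forall>m\<ge>N. norm (hnorm l2_space (s m - f) - 0) < r" by blast
    qed
  qed
qed

interpretation l2: hilbert_space "l2_space :: ('i \<Rightarrow> complex) hspace"
proof unfold_locales
  show vs: "hscale l2_space a (x + y) = hscale l2_space a x + hscale l2_space a y"
    "hscale l2_space (a + b) x = hscale l2_space a x + hscale l2_space b x"
    "hscale l2_space a (hscale l2_space b x) = hscale l2_space (a * b) x"
    "hscale l2_space 1 x = x" for a b and x y :: "'i \<Rightarrow> complex"
    by (simp_all add: l2_scale fun_eq_iff algebra_simps)
  interpret vector_space "hscale (l2_space :: ('i \<Rightarrow> complex) hspace)" by unfold_locales (rule vs)+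
  show "subspace (hcarrier (l2_space :: ('i \<Rightarrow> complex) hspace))"
    by (rule subspaceI) (simp_all add: l2_add l2_scale_closed, simp add: l2_carrier)
next
  fix x y z :: "'i \<Rightarrow> complex" and c
  assume x: "x \<in> hcarrier l2_space" and y: "y \<in> hcarrier l2_space"
  show "hip l2_space (x + y) z = hip l2_space x z + hip l2_space y z" if z: "z \<in> hcarrier l2_space"
    unfolding l2_ip infsum_add[OF l2_ip_summable[OF x z] l2_ip_summable[OF y z], symmetric]
    by (simp add: algebra_simps)
  show "hip l2_space (hscale l2_space c x) y = c * hip l2_space x y"
    unfolding l2_ip infsum_cmult_right'[symmetric] l2_scale by (simp add: mult.assoc)
  show "hip l2_space y x = cnj (hip l2_space x y)"
    unfolding l2_ip infsum_cnj[symmetric] by (simp add: mult.commute)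
next
  fix x :: "'i \<Rightarrow> complex" assume x: "x \<in> hcarrier l2_space" "x \<noteq> 0"
  then obtain i where "x i \<noteq> 0" by (auto simp: fun_eq_iff)
  then have "0 < (hnorm l2_space x)\<^sup>2" using l2_coord_le[OF x(1), of i] by auto
  then show "0 < Re (hip l2_space x x)"
    using l2_ip_self[OF x(1)] by (simp add: l2_norm_sq[OF x(1)])
qed (rule l2_complete)

text \<open>
  The words embedded into the index type by \<open>w\<close> span a copy of the full Fock space in \<open>\<ell>\<^sup>2\<close>;
  the left creation operator is extended by 0 to the orthogonal complement.
\<close>

definition creation :: "(nat list \<Rightarrow> 'i) \<Rightarrow> nat \<Rightarrow> ('i \<Rightarrow> complex) \<Rightarrow> 'i \<Rightarrow> complex" where
  "creation w i f = (if f \<in> hcarrier l2_space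
     then (\<lambda>x. if x \<in> range (\<lambda>\<beta>. w (i # \<beta>)) then f (w (tl (inv w x))) else 0) else 0)"

definition unit_vec :: "'i \<Rightarrow> 'i \<Rightarrow> complex" where
  "unit_vec j x = (if x = j then 1 else 0)"

lemma unit_vec_carrier: "unit_vec j \<in> hcarrier l2_space"
proof (rule l2_carrierI)
  fix F :: "'a set" assume "finite F"
  have "(\<Sum>x\<in>F. (cmod (unit_vec j x))\<^sup>2) = (\<Sum>x\<in>F. if x = j then 1 else 0)"
    by (intro sum.cong) (auto simp: unit_vec_def)
  also have "\<dots> \<le> 1" using \<open>finite F\<close> by simp
  finally show "(\<Sum>x\<in>F. (cmod (unit_vec j x))\<^sup>2) \<le> 1" .
qed

lemma ip_unit_vec: "hip l2_space (unit_vec i) (unit_vec j) = (if i = j then 1 else 0)"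
proof -
  have "hip l2_space (unit_vec i) (unit_vec j) = infsum (\<lambda>x. if i = j then 1 else 0) {i}"
    unfolding l2_ip by (rule infsum_cong_neutral) (auto simp: unit_vec_def)
  then show ?thesis by simp
qed

context
  fixes w :: "nat list \<Rightarrow> 'i"
  assumes w: "inj w"
begin

lemma creation_apply:
  assumes "f \<in> hcarrier l2_space"
  shows "creation w i f (w (i # \<beta>)) = f (w \<beta>)"
    and "x \<notin> range (\<lambda>\<beta>. w (i # \<beta>)) \<Longrightarrow> creation w i f x = 0"
  using assms w by (auto simp: creation_def)

text \<open>Only coordinates of the form \<open>w (i # \<beta>)\<close> survive, and each determines
  \<beta>. Reindexing along this injection turns a finite section of the image into a finite section
  of \<open>f\<close>, so creation is a contraction.\<close>

lemma creation_sum_le: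
  assumes f: "f \<in> hcarrier l2_space" and F: "finite F"
  shows "(\<Sum>x\<in>F. (cmod (creation w i f x))\<^sup>2) \<le> (hnorm l2_space f)\<^sup>2"
proof -
  let ?p = "\<lambda>\<beta>. w (i # \<beta>)"
  have p: "inj ?p" using w by (auto simp: inj_def)
  define B where "B = ?p -` F"
  have B: "finite B" unfolding B_def using p F by (metis finite_vimageI)
  have "(\<Sum>x\<in>F. (cmod (creation w i f x))\<^sup>2) = (\<Sum>x\<in>?p ` B. (cmod (creation w i f x))\<^sup>2)"
    by (rule sum.mono_neutral_right)
      (use F creation_apply(2)[OF f] in \<open>auto simp: B_def image_iff\<close>)
  also have "\<dots> = (\<Sum>\<beta>\<in>B. (cmod (f (w \<beta>)))\<^sup>2)"
    using p by (subst sum.reindex) (auto intro: inj_on_subset simp: creation_apply(1)[OF f])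
  also have "\<dots> = (\<Sum>x\<in>w ` B. (cmod (f x))\<^sup>2)"
    using w by (subst sum.reindex) (auto intro: inj_on_subset)
  also have "\<dots> \<le> (hnorm l2_space f)\<^sup>2" using f B by (intro sum_le_l2_norm) auto
  finally show ?thesis .
qed

lemma creation_bops: "creation w i \<in> bops l2_space"
proof -
  have c: "creation w i f \<in> hcarrier l2_space" if "f \<in> hcarrier l2_space" for f
    using creation_sum_le[OF that] by (rule l2_carrierI)
  have "hnorm l2_space (creation w i f) \<le> 1 * hnorm l2_space f" if f: "f \<in> hcarrier l2_space" for f
    using creation_sum_le[OF f] f c[OF f] by (intro l2_norm_le) auto
  moreover have "creation w i (f + g) = creation w i f + creation w i g"
    if "f \<in> hcarrier l2_space" "g \<in> hcarrier l2_space" for f g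
    using that by (auto simp: creation_def fun_eq_iff)
  moreover have "creation w i (hscale l2_space c f) = hscale l2_space c (creation w i f)"
    if "f \<in> hcarrier l2_space" for f c
    using that by (auto simp: creation_def fun_eq_iff l2_scale l2_scale_closed[unfolded l2_scale])
  moreover have "creation w i f = 0" if "f \<notin> hcarrier l2_space" for f
    using that by (simp add: creation_def)
  ultimately show ?thesis using c unfolding bops_def by blast
qed

lemma creation_unit_vec: "creation w i (unit_vec (w \<beta>)) = unit_vec (w (i # \<beta>))"
proof
  fix x show "creation w i (unit_vec (w \<beta>)) x = unit_vec (w (i # \<beta>)) x"
  proof (cases "x \<in> range (\<lambda>\<beta>. w (i # \<beta>))")
    case True
    then show ?thesis using w creation_apply(1)[OF unit_vec_carrier]
      by (auto simp: unit_vec_def inj_eq)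
  next
    case False
    then show ?thesis using creation_apply(2)[OF unit_vec_carrier False] by (auto simp: unit_vec_def)
  qed
qed

text \<open>Both sides of the adjoint identity are brought to the same sum over words; this is the
  side of \<open>creation\<close>.\<close>

lemma creation_sum_words:
  assumes f: "f \<in> hcarrier l2_space" and "g \<in> hcarrier l2_space"
  shows "hip l2_space (creation w i f) g = (\<Sum>\<^sub>\<infinity>\<beta>. f (w \<beta>) * cnj (g (w (i # \<beta>))))"
proof -
  let ?p = "\<lambda>\<beta>. w (i # \<beta>)"
  have p: "inj ?p" using w by (auto simp: inj_def)
  have "hip l2_space (creation w i f) g = (\<Sum>\<^sub>\<infinity>x\<in>range ?p. creation w i f x * cnj (g x))"
    unfolding l2_ip by (rule infsum_cong_neutral) (use creation_apply(2)[OF f] in auto)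
  also have "\<dots> = (\<Sum>\<^sub>\<infinity>\<beta>. f (w \<beta>) * cnj (g (w (i # \<beta>))))"
    by (simp add: infsum_reindex[OF p] o_def creation_apply(1)[OF f])
  finally show ?thesis .
qed

text \<open>This is the annihilation operator, which strips a leading letter \<open>i\<close>. The
  candidate is square-summable by the reindexing of \<open>creation_sum_le\<close> run in the other
  direction.\<close>

lemma adj_creation:
  assumes g: "g \<in> hcarrier l2_space"
  shows "adj l2_space (creation w i) g =
    (\<lambda>x. if x \<in> range w then g (w (i # inv w x)) else 0)" (is "_ = ?a")
proof (rule l2.adj_eqI[OF creation_bops g])
  have p: "inj (\<lambda>\<beta>. w (i # \<beta>))" using w by (auto simp: inj_def)
  show a: "?a \<in> hcarrier l2_space"
  proof (rule l2_carrierI)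
    fix F :: "'i set" assume F: "finite F"
    define B where "B = w -` F"
    have B: "finite B" unfolding B_def using w F by (metis finite_vimageI)
    have "(\<Sum>x\<in>F. (cmod (?a x))\<^sup>2) = (\<Sum>x\<in>w ` B. (cmod (?a x))\<^sup>2)"
      by (rule sum.mono_neutral_right) (use F in \<open>auto simp: B_def\<close>)
    also have "\<dots> = (\<Sum>\<beta>\<in>B. (cmod (g (w (i # \<beta>))))\<^sup>2)"
      using w by (subst sum.reindex) (auto intro: inj_on_subset)
    also have "\<dots> = (\<Sum>x\<in>(\<lambda>\<beta>. w (i # \<beta>)) ` B. (cmod (g x))\<^sup>2)"
      using inj_on_subset[OF p subset_UNIV] by (subst sum.reindex) auto
    also have "\<dots> \<le> (hnorm l2_space g)\<^sup>2" using g B by (intro sum_le_l2_norm) auto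
    finally show "(\<Sum>x\<in>F. (cmod (?a x))\<^sup>2) \<le> (hnorm l2_space g)\<^sup>2" .
  qed
  fix f :: "'i \<Rightarrow> complex" assume f: "f \<in> hcarrier l2_space"
  have "hip l2_space f ?a = (\<Sum>\<^sub>\<infinity>x\<in>range w. f x * cnj (?a x))"
    unfolding l2_ip by (rule infsum_cong_neutral) auto
  also have "\<dots> = (\<Sum>\<^sub>\<infinity>\<beta>. f (w \<beta>) * cnj (g (w (i # \<beta>))))"
    using w by (simp add: infsum_reindex[OF w] o_def)
  finally show "hip l2_space (creation w i f) g = hip l2_space f ?a"
    using creation_sum_words[OF f g] by simp
qed

section \<open>Scaled creation operators as points of the operator ball\<close>

abbreviation "screation r i \<equiv> scale_op l2_space (complex_of_real r) (creation w i)"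

lemma screation_bops: "screation r i \<in> bops l2_space"
  by (rule l2.bops_scale[OF creation_bops])

lemma adj_screation:
  assumes g: "g \<in> hcarrier l2_space"
  shows "adj l2_space (screation r i) g = hscale l2_space (of_real r) (adj l2_space (creation w i) g)"
proof (rule l2.adj_eqI[OF screation_bops g])
  note a = l2.adj_props[OF creation_bops g]
  show "hscale l2_space (complex_of_real r) (adj l2_space (creation w i) g) \<in> hcarrier l2_space"
    using a by simp
  fix x :: "'i \<Rightarrow> complex" assume x: "x \<in> hcarrier l2_space"
  show "hip l2_space (screation r i x) g =
      hip l2_space x (hscale l2_space (of_real r) (adj l2_space (creation w i) g))"
    using a x g bopsD(1)[OF creation_bops x] by (simp add: scale_op_def l2.ip_simps)
qed

text \<open>The operator \<open>?P\<close> multiplies coordinates: by r^2 at words whose first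
  letter lies in 1..n, by 0 elsewhere. It is r^2 times a projection, with norm at most r^2 <
  1.\<close>

lemma screation_in_op_ball:
  assumes r: "0 \<le> r" "r < 1"
  shows "screation r \<in> op_ball l2_space n"
proof -
  let ?P = "\<Sum>i\<in>{1..n}. screation r i \<circ> adj l2_space (screation r i)"
  have P: "?P \<in> bops l2_space"
    by (intro l2.bops_sum l2.bops_comp l2.adj_bops screation_bops)
  have "opnorm l2_space ?P \<le> r\<^sup>2"
  proof (rule l2.opnorm_le)
    fix g :: "'i \<Rightarrow> complex" assume g: "g \<in> hcarrier l2_space"
    have app: "?P g x = of_real (r\<^sup>2) * (\<Sum>i\<in>{1..n}. if x \<in> range (\<lambda>\<beta>. w (i # \<beta>)) then g x else 0)" for x
    proof -
      have "(screation r i \<circ> adj l2_space (screation r i)) g x =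
          of_real (r\<^sup>2) * (if x \<in> range (\<lambda>\<beta>. w (i # \<beta>)) then g x else 0)" for i
      proof -
        let ?a = "adj l2_space (creation w i) g"
        have a: "?a \<in> hcarrier l2_space" by (rule l2.adj_props(1)[OF creation_bops g])
        have "(screation r i \<circ> adj l2_space (screation r i)) g =
            hscale l2_space (of_real r) (hscale l2_space (of_real r) (creation w i ?a))"
          by (simp only: o_apply adj_screation[OF g])
            (simp only: scale_op_def bopsD(4)[OF creation_bops a])
        then have "(screation r i \<circ> adj l2_space (screation r i)) g x =
            of_real (r\<^sup>2) * creation w i ?a x"
          by (simp add: l2_scale power2_eq_square)
        moreover have "creation w i ?a x = (if x \<in> range (\<lambda>\<beta>. w (i # \<beta>)) then g x else 0)"
          using creation_apply[OF a] w by (auto simp: adj_creation[OF g])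
        ultimately show ?thesis by simp
      qed
      then show ?thesis unfolding sum_fun_apply sum_distrib_left by simp
    qed
    have "cmod (?P g x) \<le> r\<^sup>2 * cmod (g x)" for x
    proof -
      have "cmod (\<Sum>i\<in>{1..n}. if x \<in> range (\<lambda>\<beta>. w (i # \<beta>)) then g x else 0) \<le> cmod (g x)"
      proof (cases "\<exists>i\<in>{1..n}. x \<in> range (\<lambda>\<beta>. w (i # \<beta>))")
        case True
        then obtain j where j: "j \<in> {1..n}" "x \<in> range (\<lambda>\<beta>. w (j # \<beta>))" by blast
        \<comment> \<open>A word has only one first letter, so a single summand survives however
          large n is.\<close>
        have "x \<in> range (\<lambda>\<beta>. w (i # \<beta>)) \<longleftrightarrow> i = j" for i
          using j(2) w by (auto simp: inj_eq)
        then have "(\<Sum>i\<in>{1..n}. if x \<in> range (\<lambda>\<beta>. w (i # \<beta>)) then g x else 0) = g x"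
          using j(1) by simp
        then show ?thesis by simp
      next
        case False
        then have "(\<Sum>i\<in>{1..n}. if x \<in> range (\<lambda>\<beta>. w (i # \<beta>)) then g x else 0) = 0"
          by (intro sum.neutral) auto
        then show ?thesis by simp
      qed
      then show ?thesis unfolding app norm_mult norm_of_real by (simp add: mult_left_mono)
    qed
    then have "(\<Sum>x\<in>F. (cmod (?P g x))\<^sup>2) \<le> (\<Sum>x\<in>F. (r\<^sup>2)\<^sup>2 * (cmod (g x))\<^sup>2)" for F
      unfolding power_mult_distrib[symmetric] by (intro sum_mono power_mono) auto
    also have "(\<Sum>x\<in>F. (r\<^sup>2)\<^sup>2 * (cmod (g x))\<^sup>2) \<le> (r\<^sup>2 * hnorm l2_space g)\<^sup>2" if "finite F" for F
      unfolding sum_distrib_left[symmetric] power_mult_distrib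
      using sum_le_l2_norm[OF g that] by (intro mult_left_mono) auto
    finally show "hnorm l2_space (?P g) \<le> r\<^sup>2 * hnorm l2_space g"
      using bopsD(1)[OF P g] g by (intro l2_norm_le) auto
  qed simp
  also have "r\<^sup>2 < 1" using r by (simp add: power_less_one_iff abs_square_less_1)
  finally show ?thesis using screation_bops by (simp add: op_ball_def)
qed

lemma word_op_screation:
  "word_op l2_space (screation r) \<alpha> (unit_vec (w \<beta>)) =
     hscale l2_space (of_real (r ^ length \<alpha>)) (unit_vec (w (\<alpha> @ \<beta>)))"
proof (induction \<alpha>)
  case Nil
  then show ?case by (simp add: id_op_def unit_vec_carrier)
next
  case (Cons i \<alpha>)
  then show ?case
    by (simp add: scale_op_def bopsD(4)[OF creation_bops] unit_vec_carrier creation_unit_vec)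
qed

lemma word_op_bops: "word_op l2_space (screation r) \<alpha> \<in> bops l2_space"
  by (induction \<alpha>) (simp_all only: word_op.simps l2.bops_id l2.bops_comp screation_bops)

end

section \<open>The quadratic form of a harmonic function\<close>

lemma words_subset_lists: "words n k \<subseteq> lists {1..n}"
  by (auto simp: words_def)

lemma finite_words [simp]: "finite (words n k)"
  unfolding words_def using finite_lists_length_eq[of "{1..n}" k] by simp

lemma words_0: "words n 0 = {[]}"
  by (auto simp: words_def)

text \<open>The embedding \<open>w\<close> is left abstract: any index type with room for all words
  over the naturals provides a Fock space inside \<open>'i \<Rightarrow> complex\<close>.\<close>

locale fock_tensor = H: hilbert_space H for H :: "'h::ab_group_add hspace" +
  fixes w :: "nat list \<Rightarrow> 'i"
  assumes w: "inj w"
begin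

sublocale hilbert_pair "l2_space :: ('i \<Rightarrow> complex) hspace" H ..

abbreviation "\<X> \<equiv> l2_space :: ('i \<Rightarrow> complex) hspace"

section \<open>Fock basis tensors and the action of each degree on them\<close>

definition Xs :: "real \<Rightarrow> nat \<Rightarrow> ('i \<Rightarrow> complex) \<Rightarrow> 'i \<Rightarrow> complex" where
  "Xs r i = scale_op \<X> (of_real r) (creation w i)"

definition tv :: "nat list \<Rightarrow> 'h \<Rightarrow> ('i \<Rightarrow> complex) \<Rightarrow> 'h" where
  "tv \<beta> h = tensor_vec \<X> H (unit_vec (w \<beta>)) h"

lemma tv_carrier [simp]: "h \<in> hcarrier H \<Longrightarrow> tv \<beta> h \<in> hcarrier XH"
  unfolding tv_def by (intro tensor_vec_in_tensor unit_vec_carrier) unfold_locales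

lemma ip_tv:
  assumes "h \<in> hcarrier H" "g \<in> hcarrier H"
  shows "hip XH (tv \<beta> h) (tv \<gamma> g) = (if \<beta> = \<gamma> then hip H h g else 0)"
proof -
  have "hip XH (tv \<beta> h) (tv \<gamma> g) = hip \<X> (unit_vec (w \<beta>)) (unit_vec (w \<gamma>)) * hip H h g"
    unfolding tv_def using assms by (intro hip_tensor_vec unit_vec_carrier) unfold_locales
  then show ?thesis using w by (simp add: ip_unit_vec inj_eq)
qed

lemma ip_tv_sum:
  assumes "finite G" "h \<in> hcarrier H" "\<And>\<beta>. \<beta> \<in> G \<Longrightarrow> v \<beta> \<in> hcarrier H"
  shows "hip XH (tv \<gamma> h) (\<Sum>\<beta>\<in>G. tv \<beta> (v \<beta>)) = (if \<gamma> \<in> G then hip H h (v \<gamma>) else 0)"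
proof -
  have "hip XH (tv \<gamma> h) (\<Sum>\<beta>\<in>G. tv \<beta> (v \<beta>)) = (\<Sum>\<beta>\<in>G. if \<gamma> = \<beta> then hip H h (v \<beta>) else 0)"
    using assms by (simp add: T.ip_sum_right ip_tv)
  then show ?thesis using assms(1) by simp
qed

lemma Xs_in_op_ball: "0 \<le> r \<Longrightarrow> r < 1 \<Longrightarrow> Xs r \<in> op_ball \<X> n"
  using screation_in_op_ball[OF w] unfolding Xs_def by blast

lemma word_op_Xs_bops: "word_op \<X> (Xs r) \<alpha> \<in> bops \<X>"
  using word_op_bops[OF w] unfolding Xs_def .

lemma tensor_op_tv:
  assumes C: "C \<in> bops H" and h: "h \<in> hcarrier H"
  shows "tensor_op \<X> H (word_op \<X> (Xs r) \<alpha>) C (tv \<beta> h) =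
    tv (\<alpha> @ \<beta>) (hscale H (of_real (r ^ length \<alpha>)) (C h))"
proof -
  have l2: "hilbert_space \<X>" by unfold_locales
  have "tensor_op \<X> H (word_op \<X> (Xs r) \<alpha>) C (tv \<beta> h) =
      tensor_vec \<X> H (word_op \<X> (Xs r) \<alpha> (unit_vec (w \<beta>))) (C h)"
    unfolding tv_def
    by (rule tensor_op_tensor_vec[OF l2 H.hilbert_space_axioms word_op_Xs_bops C unit_vec_carrier h])
  also have "word_op \<X> (Xs r) \<alpha> (unit_vec (w \<beta>)) =
      hscale \<X> (of_real (r ^ length \<alpha>)) (unit_vec (w (\<alpha> @ \<beta>)))"
    unfolding Xs_def by (rule word_op_screation[OF w])
  finally show ?thesis
    unfolding tv_def tensor_vec_scale_left[OF l2 H.hilbert_space_axioms unit_vec_carrier] .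
qed

lemma nc_term_bops:
  assumes C: "C \<in> lists {1..n} \<rightarrow> bops H"
  shows "nc_term \<X> H n C (Xs r) k \<in> bops XH"
  unfolding nc_term_def
  using funcset_mem[OF C] words_subset_lists
  by (intro T.bops_sum tensor_op_bops word_op_Xs_bops) blast

lemma nc_term_tv:
  assumes C: "C \<in> lists {1..n} \<rightarrow> bops H" and h: "h \<in> hcarrier H"
  shows "nc_term \<X> H n C (Xs r) k (tv \<beta> h) =
    (\<Sum>\<alpha>\<in>words n k. tv (\<alpha> @ \<beta>) (hscale H (of_real (r ^ k)) (C \<alpha> h)))"
proof -
  have "nc_term \<X> H n C (Xs r) k (tv \<beta> h) =
      (\<Sum>\<alpha>\<in>words n k. tensor_op \<X> H (word_op \<X> (Xs r) \<alpha>) (C \<alpha>) (tv \<beta> h))"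
    by (simp add: nc_term_def sum_fun_apply)
  also have "\<dots> = (\<Sum>\<alpha>\<in>words n k. tv (\<alpha> @ \<beta>) (hscale H (of_real (r ^ k)) (C \<alpha> h)))"
  proof (rule sum.cong[OF refl])
    fix \<alpha> assume a: "\<alpha> \<in> words n k"
    then have "C \<alpha> \<in> bops H" "length \<alpha> = k"
      using funcset_mem[OF C] words_subset_lists by (blast, simp add: words_def)
    then show "tensor_op \<X> H (word_op \<X> (Xs r) \<alpha>) (C \<alpha>) (tv \<beta> h) =
        tv (\<alpha> @ \<beta>) (hscale H (of_real (r ^ k)) (C \<alpha> h))"
      using tensor_op_tv[OF _ h] by blast
  qed
  finally show ?thesis .
qed

text \<open>Degree j sends the component at \<beta> to the words \<open>\<alpha> @ \<beta>\<close>
  with \<alpha> of length j. Orthogonality discards every target outside the support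
  \<open>G\<close>.\<close>

lemma ip_nc_term:
  assumes C: "C \<in> lists {1..n} \<rightarrow> bops H"
    and G: "finite G" and v: "\<And>\<beta>. \<beta> \<in> G \<Longrightarrow> v \<beta> \<in> hcarrier H"
  shows "hip XH (nc_term \<X> H n C (Xs r) j (\<Sum>\<beta>\<in>G. tv \<beta> (v \<beta>))) (\<Sum>\<beta>\<in>G. tv \<beta> (v \<beta>)) =
    (\<Sum>\<beta>\<in>G. \<Sum>\<alpha>\<in>words n j. if \<alpha> @ \<beta> \<in> G then of_real (r ^ j) * hip H (C \<alpha> (v \<beta>)) (v (\<alpha> @ \<beta>)) else 0)"
proof -
  let ?u = "\<Sum>\<beta>\<in>G. tv \<beta> (v \<beta>)"
  have u: "?u \<in> hcarrier XH" using v by (intro T.carrier_sum) auto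
  have Cv: "C \<alpha> (v \<beta>) \<in> hcarrier H" if "\<alpha> \<in> words n j" "\<beta> \<in> G" for \<alpha> \<beta>
    using bopsD(1) funcset_mem[OF C] words_subset_lists v that by blast
  have nt: "nc_term \<X> H n C (Xs r) j ?u =
      (\<Sum>\<beta>\<in>G. \<Sum>\<alpha>\<in>words n j. tv (\<alpha> @ \<beta>) (hscale H (of_real (r ^ j)) (C \<alpha> (v \<beta>))))"
  proof (subst T.bops_apply_sum[OF nc_term_bops[OF C]])
    show "(\<Sum>\<beta>\<in>G. nc_term \<X> H n C (Xs r) j (tv \<beta> (v \<beta>))) =
        (\<Sum>\<beta>\<in>G. \<Sum>\<alpha>\<in>words n j. tv (\<alpha> @ \<beta>) (hscale H (of_real (r ^ j)) (C \<alpha> (v \<beta>))))"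
      using v by (intro sum.cong refl nc_term_tv[OF C])
  qed (use v in simp)
  have "hip XH (nc_term \<X> H n C (Xs r) j ?u) ?u = (\<Sum>\<beta>\<in>G. \<Sum>\<alpha>\<in>words n j.
      hip XH (tv (\<alpha> @ \<beta>) (hscale H (of_real (r ^ j)) (C \<alpha> (v \<beta>)))) ?u)"
    unfolding nt using Cv u by (subst T.ip_sum_left; (intro T.carrier_sum tv_carrier)?)
      (auto intro!: sum.cong T.ip_sum_left v)
  also have "\<dots> = (\<Sum>\<beta>\<in>G. \<Sum>\<alpha>\<in>words n j.
      if \<alpha> @ \<beta> \<in> G then of_real (r ^ j) * hip H (C \<alpha> (v \<beta>)) (v (\<alpha> @ \<beta>)) else 0)"
    using Cv v by (intro sum.cong refl) (simp add: ip_tv_sum[OF G] H.ip_scale_left del: of_real_power)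
  finally show ?thesis .
qed

section \<open>Convergence at the creation operators and growth of the column norms\<close>

lemma nc_fun_op_sums:
  assumes hol: "nc_holomorphic TYPE('i \<Rightarrow> complex) H n C"
    and C: "C \<in> lists {1..n} \<rightarrow> bops H" and r: "0 \<le> r" "r < 1"
  shows "op_sums XH (nc_term \<X> H n C (Xs r)) (nc_fun \<X> H n C (Xs r))"
proof -
  have "hilbert_space \<X>" by unfold_locales
  then obtain T where "op_sums XH (nc_term \<X> H n C (Xs r)) T"
    using hol Xs_in_op_ball[OF r] unfolding nc_holomorphic_def by blast
  note T = this
  show ?thesis unfolding nc_fun_def
    by (rule theI[of "op_sums XH (nc_term \<X> H n C (Xs r))", OF T])
      (rule T.op_sums_unique[OF nc_term_bops[OF C] _ T])
qed

text \<open>On the vacuum tensor \<open>tv [] h\<close> the degree-k term spreads the vectors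
  \<open>C \<alpha> h\<close> over orthogonal directions, so its norm is exactly r^k times the
  length of the column at \<open>h\<close>. The uniform bound on the terms of the series then gives
  the estimate.\<close>

lemma col_bound:
  assumes hol: "nc_holomorphic TYPE('i \<Rightarrow> complex) H n C"
    and C: "C \<in> lists {1..n} \<rightarrow> bops H" and r: "0 < r" "r < 1"
  obtains M where "0 \<le> M"
    "\<And>k. sqrt (opnorm H (\<Sum>\<alpha>\<in>words n k. adj H (C \<alpha>) \<circ> C \<alpha>)) \<le> M / r ^ k"
proof -
  have s: "op_sums XH (nc_term \<X> H n C (Xs r)) (nc_fun \<X> H n C (Xs r))"
    using nc_fun_op_sums[OF hol C] r by simp
  obtain M where M: "0 \<le> M"
    "\<And>k u. u \<in> hcarrier XH \<Longrightarrow> hnorm XH (nc_term \<X> H n C (Xs r) k u) \<le> M * hnorm XH u"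
    by (rule T.op_sums_terms_bounded[OF nc_term_bops[OF C] s]) blast
  have "sqrt (opnorm H (\<Sum>\<alpha>\<in>words n k. adj H (C \<alpha>) \<circ> C \<alpha>)) \<le> M / r ^ k" for k
  proof (rule H.sqrt_opnorm_col_le)
    show "C \<in> words n k \<rightarrow> bops H" using C words_subset_lists by blast
    then have Cw: "C \<alpha> \<in> bops H" if "\<alpha> \<in> words n k" for \<alpha> using that by auto
    show "0 \<le> M / r ^ k" using M r by simp
    fix h assume h: "h \<in> hcarrier H"
    let ?g = "\<lambda>\<alpha>. hscale H (of_real (r ^ k)) (C \<alpha> h)"
    have g: "?g \<alpha> \<in> hcarrier H" if "\<alpha> \<in> words n k" for \<alpha> using bopsD(1)[OF Cw[OF that] h] by simp
    have nt: "nc_term \<X> H n C (Xs r) k (tv [] h) = (\<Sum>\<alpha>\<in>words n k. tv \<alpha> (?g \<alpha>))"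
      using nc_term_tv[OF C h, where \<beta> = "[]"] by simp
    define u where "u = (\<Sum>\<alpha>\<in>words n k. tv \<alpha> (?g \<alpha>))"
    have u: "u \<in> hcarrier XH" unfolding u_def using g by (intro T.carrier_sum tv_carrier)
    have gg: "hip H (?g \<alpha>) (?g \<alpha>) = of_real ((r ^ k * hnorm H (C \<alpha> h))\<^sup>2)" if "\<alpha> \<in> words n k" for \<alpha>
    proof -
      have "hnorm H (?g \<alpha>) = r ^ k * hnorm H (C \<alpha> h)"
        unfolding H.hnorm_scale[OF bopsD(1)[OF Cw[OF that] h]] norm_of_real using r by simp
      then show ?thesis using H.ip_self[OF g[OF that]] by simp
    qed
    have "hip XH u u = (\<Sum>\<alpha>\<in>words n k. hip XH (tv \<alpha> (?g \<alpha>)) u)"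
      using T.ip_sum_left[of "words n k" "\<lambda>\<alpha>. tv \<alpha> (?g \<alpha>)" u, OF tv_carrier[OF g] u]
      unfolding u_def[symmetric] .
    also have "\<dots> = (\<Sum>\<alpha>\<in>words n k. of_real ((r ^ k * hnorm H (C \<alpha> h))\<^sup>2))"
    proof (rule sum.cong[OF refl])
      fix \<alpha> assume a: "\<alpha> \<in> words n k"
      show "hip XH (tv \<alpha> (?g \<alpha>)) u = of_real ((r ^ k * hnorm H (C \<alpha> h))\<^sup>2)"
        unfolding u_def gg[OF a, symmetric]
        by (subst ip_tv_sum) (use g a in \<open>simp_all del: of_real_power\<close>)
    qed
    finally have "hip XH u u = of_real (\<Sum>\<alpha>\<in>words n k. (r ^ k * hnorm H (C \<alpha> h))\<^sup>2)"
      unfolding of_real_sum .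
    then have "(hnorm XH u)\<^sup>2 = (\<Sum>\<alpha>\<in>words n k. (r ^ k * hnorm H (C \<alpha> h))\<^sup>2)"
      using T.hnorm_sq[OF u] by simp
    then have "hnorm XH u = L2_set (\<lambda>\<alpha>. r ^ k * hnorm H (C \<alpha> h)) (words n k)"
      unfolding L2_set_def using T.hnorm_nonneg[OF u] by (simp add: real_sqrt_unique)
    also have "\<dots> = r ^ k * L2_set (\<lambda>\<alpha>. hnorm H (C \<alpha> h)) (words n k)"
      using r by (simp add: L2_set_right_distrib)
    finally have "r ^ k * L2_set (\<lambda>\<alpha>. hnorm H (C \<alpha> h)) (words n k) \<le> M * hnorm XH (tv [] h)"
      using M(2)[OF tv_carrier[OF h], of k "[]"] unfolding nt u_def[symmetric] by simp
    also have "hnorm XH (tv [] h) = hnorm H h"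
      unfolding hnorm_def ip_tv[OF h h] by simp
    finally show "L2_set (\<lambda>\<alpha>. hnorm H (C \<alpha> h)) (words n k) \<le> M / r ^ k * hnorm H h"
      using r by (simp add: field_simps)
  qed
  with M(1) show ?thesis by (rule that)
qed

text \<open>
  Creation lengthens words, so at a vector supported on the empty word and the words of length \<open>k\<close>
  only the constant term and the terms of degree \<open>k\<close> contribute to the quadratic form.
\<close>

lemma harmonic_form:
  assumes harm: "nc_harmonic TYPE('i \<Rightarrow> complex) H n A"
    and A: "A \<in> lists {1..n} \<rightarrow> bops H" and r: "0 \<le> r" "r < 1" and k: "k \<ge> 1"
    and v: "\<And>\<beta>. v \<beta> \<in> hcarrier H"
  defines "G \<equiv> insert [] (words n k)"
  defines "u \<equiv> \<Sum>\<beta>\<in>G. tv \<beta> (v \<beta>)"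
  shows "harmonic_fun \<X> H n A (Xs r) u \<in> hcarrier XH"
    and "hip XH (harmonic_fun \<X> H n A (Xs r) u) u = of_real
      ((\<Sum>\<beta>\<in>G. Re (hip H (A [] (v \<beta>)) (v \<beta>))) / 2 +
       r ^ k * (\<Sum>\<alpha>\<in>words n k. Re (hip H (A \<alpha> (v [])) (v \<alpha>))))"
proof -
  let ?C = "half_const H A"
  let ?F = "nc_fun \<X> H n ?C (Xs r)"
  let ?q = "(\<Sum>\<beta>\<in>G. hip H (A [] (v \<beta>)) (v \<beta>)) / 2 +
    of_real (r ^ k) * (\<Sum>\<alpha>\<in>words n k. hip H (A \<alpha> (v [])) (v \<alpha>))"
  have C: "?C \<in> lists {1..n} \<rightarrow> bops H"
    using funcset_mem[OF A] H.bops_scale[OF funcset_mem[OF A, of "[]"]]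
    by (intro funcsetI) (simp add: half_const_def)
  have A0: "A [] \<in> bops H" using funcset_mem[OF A, of "[]"] by simp
  have hol: "nc_holomorphic TYPE('i \<Rightarrow> complex) H n ?C" using harm by (simp add: nc_harmonic_def)
  note s = nc_fun_op_sums[OF hol C r]
  have F: "?F \<in> bops XH" using s by (simp add: op_sums_def)
  have G: "finite G" by (simp add: G_def)
  have u: "u \<in> hcarrier XH" unfolding u_def using v by (intro T.carrier_sum) auto
  let ?t = "\<lambda>j. hip XH (nc_term \<X> H n ?C (Xs r) j u) u"
  have t0: "?t 0 = (\<Sum>\<beta>\<in>G. hip H (A [] (v \<beta>)) (v \<beta>)) / 2"
  proof -
    have "A [] (v \<beta>) \<in> hcarrier H" for \<beta> using bopsD(1)[OF A0 v] by simp
    then show ?thesis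
      unfolding u_def ip_nc_term[OF C G v] words_0
      by (simp add: half_const_def scale_op_def H.ip_scale_left v sum_divide_distrib)
  qed
  have tj: "?t j = (if j = k then of_real (r ^ k) * (\<Sum>\<alpha>\<in>words n k. hip H (A \<alpha> (v [])) (v \<alpha>)) else 0)"
    if j: "j \<ge> 1" for j
  proof -
    have len: "length \<beta> = 0 \<or> length \<beta> = k" if "\<beta> \<in> G" for \<beta> using that by (auto simp: G_def words_def)
    \<comment> \<open>Both \<beta> and \<open>\<alpha> @ \<beta>\<close> have length 0 or k, and
      \<alpha> has length j \<ge> 1. The product then has length k, and \<beta> of length k would
      make it longer.\<close>
    have G_iff: "\<alpha> @ \<beta> \<in> G \<longleftrightarrow> \<beta> = [] \<and> j = k" if a: "\<alpha> \<in> words n j" and b: "\<beta> \<in> G" for \<alpha> \<beta>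
    proof
      assume "\<alpha> @ \<beta> \<in> G"
      from len[OF this] len[OF b] show "\<beta> = [] \<and> j = k" using a j by (auto simp: words_def)
    qed (use a in \<open>auto simp: G_def\<close>)
    have "?t j = (\<Sum>\<beta>\<in>G. if \<beta> = [] then (\<Sum>\<alpha>\<in>words n j.
        if j = k then of_real (r ^ k) * hip H (?C \<alpha> (v [])) (v \<alpha>) else 0) else 0)"
      unfolding u_def ip_nc_term[OF C G v] by (rule sum.cong) (auto simp: G_iff intro!: sum.cong)
    also have "\<dots> = (\<Sum>\<alpha>\<in>words n j. if j = k then of_real (r ^ k) * hip H (?C \<alpha> (v [])) (v \<alpha>) else 0)"
      using G by (simp add: G_def)
    also have "\<dots> = (if j = k then of_real (r ^ k) * (\<Sum>\<alpha>\<in>words n k. hip H (?C \<alpha> (v [])) (v \<alpha>)) else 0)"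
      by (simp add: sum_distrib_left)
    also have "(\<Sum>\<alpha>\<in>words n k. hip H (?C \<alpha> (v [])) (v \<alpha>)) = (\<Sum>\<alpha>\<in>words n k. hip H (A \<alpha> (v [])) (v \<alpha>))"
      using k by (intro sum.cong) (auto simp: half_const_def words_def)
    finally show ?thesis .
  qed
  \<comment> \<open>Degrees 0 and k alone survive, so the partial sums are constant once
    \<open>{..<N}\<close> contains k.\<close>
  have "(\<Sum>j<N. ?t j) = ?q" if "N \<ge> Suc k" for N
  proof -
    have "(\<Sum>j<N. ?t j) = (\<Sum>j\<in>{0, k}. ?t j)"
      using that k by (intro sum.mono_neutral_right) (auto simp: tj)
    then show ?thesis using k t0 tj[OF k] by simp
  qed
  then have "(\<lambda>N. \<Sum>j<N. ?t j) \<longlonglongrightarrow> ?q"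
    by (intro tendsto_eventually) (auto simp: eventually_at_top_linorder)
  with T.op_sums_ip[OF nc_term_bops[OF C] s u u] have Fq: "hip XH (?F u) u = ?q"
    by (rule LIMSEQ_unique)
  have hf: "harmonic_fun \<X> H n A (Xs r) = scale_op XH (1/2) (?F + adj XH ?F)"
    by (simp add: harmonic_fun_def Let_def)
  have "harmonic_fun \<X> H n A (Xs r) \<in> bops XH"
    unfolding hf by (intro T.bops_scale T.bops_add T.adj_bops F)
  then show "harmonic_fun \<X> H n A (Xs r) u \<in> hcarrier XH" using u by (rule bopsD)
  have "hip XH (harmonic_fun \<X> H n A (Xs r) u) u = (hip XH (?F u) u + cnj (hip XH (?F u) u)) / 2"
    using bopsD(1)[OF F u] T.adj_props(1)[OF F u] u T.ip_adj_left[OF F u u] T.ip_cnj[OF bopsD(1)[OF F u] u]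
    by (simp add: hf scale_op_def T.ip_simps)
  also have "\<dots> = of_real (Re ?q)" unfolding Fq by (simp only: complex_add_cnj) simp
  finally show "hip XH (harmonic_fun \<X> H n A (Xs r) u) u = of_real
      ((\<Sum>\<beta>\<in>G. Re (hip H (A [] (v \<beta>)) (v \<beta>))) / 2 +
       r ^ k * (\<Sum>\<alpha>\<in>words n k. Re (hip H (A \<alpha> (v [])) (v \<alpha>))))"
    by (simp add: Re_sum del: of_real_power)
qed

text \<open>Domination is asked only at the scaled creation operators, on one family of test vectors
  with real parameter t; eliminating r and t leaves an inequality between the coefficients.\<close>

lemma col_square_le:
  assumes harm: "nc_harmonic TYPE('i \<Rightarrow> complex) H n A" "nc_harmonic TYPE('i \<Rightarrow> complex) H n B"
    and A: "A \<in> lists {1..n} \<rightarrow> bops H" and B: "B \<in> lists {1..n} \<rightarrow> bops H"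
    and le: "\<And>r. 0 \<le> r \<Longrightarrow> r < 1 \<Longrightarrow>
      op_le XH (harmonic_fun \<X> H n A (Xs r)) (harmonic_fun \<X> H n B (Xs r))"
    and k: "k \<ge> 1" and h: "h \<in> hcarrier H"
  defines "C \<equiv> \<lambda>\<alpha>. B \<alpha> - A \<alpha>"
  shows "(\<Sum>\<alpha>\<in>words n k. (hnorm H (C \<alpha> h))\<^sup>2) \<le> opnorm H (C []) * Re (hip H (C [] h) h)"
proof -
  let ?W = "words n k" and ?M = "opnorm H (C [])"
  let ?S = "\<Sum>\<alpha>\<in>?W. (hnorm H (C \<alpha> h))\<^sup>2" and ?q = "Re (hip H (C [] h) h)"
  have AB: "A \<alpha> \<in> bops H" "B \<alpha> \<in> bops H" if "\<alpha> \<in> lists {1..n}" for \<alpha>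
    using funcset_mem[OF A that] funcset_mem[OF B that] .
  then have Cb: "C \<alpha> \<in> bops H" if "\<alpha> \<in> lists {1..n}" for \<alpha>
    using that by (simp add: C_def H.bops_diff)
  have nil: "[] \<in> lists {1..n}" by simp
  have W: "\<alpha> \<in> lists {1..n}" if "\<alpha> \<in> ?W" for \<alpha> using that words_subset_lists by blast
  have M: "0 \<le> ?M" using H.opnorm_nonneg[OF Cb[OF nil]] .
  have C0_le: "Re (hip H (C [] y) y) \<le> ?M * (hnorm H y)\<^sup>2" if y: "y \<in> hcarrier H" for y
  proof -
    have "Re (hip H (C [] y) y) \<le> hnorm H (C [] y) * hnorm H y"
      using H.Cauchy_Schwarz[OF bopsD(1)[OF Cb[OF nil] y] y] complex_Re_le_cmod order_trans by blast
    also have "\<dots> \<le> ?M * hnorm H y * hnorm H y"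
      using H.hnorm_apply_le_opnorm[OF Cb[OF nil] y] y by (intro mult_right_mono) auto
    finally show ?thesis by (simp add: power2_eq_square mult.assoc)
  qed
  have ineq: "2 * t * r ^ k * ?S \<le> ?q + t\<^sup>2 * ?M * ?S" if r: "0 \<le> r" "r < 1" for r t
  proof -
    \<comment> \<open>The value 0 at other words is a default that keeps \<open>v\<close> in the
      carrier everywhere, as \<open>harmonic_form\<close> demands.\<close>
    define v where "v \<beta> = (if \<beta> = [] then h else if \<beta> \<in> ?W then hscale H (of_real (- t)) (C \<beta> h) else 0)" for \<beta>
    have v: "v \<beta> \<in> hcarrier H" for \<beta>
      using h bopsD(1)[OF Cb[OF W] h] by (simp add: v_def)
    define u where "u = (\<Sum>\<beta>\<in>insert [] ?W. tv \<beta> (v \<beta>))"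
    have u: "u \<in> hcarrier XH" unfolding u_def using v by (intro T.carrier_sum) auto
    note fA = harmonic_form[where v = v, OF harm(1) A r k v, folded u_def]
    note fB = harmonic_form[where v = v, OF harm(2) B r k v, folded u_def]
    have nil_W: "[] \<notin> ?W" using k by (auto simp: words_def)
    have diff: "hip H (B \<alpha> x) y - hip H (A \<alpha> x) y = hip H (C \<alpha> x) y"
      if "\<alpha> \<in> lists {1..n}" "x \<in> hcarrier H" "y \<in> hcarrier H" for \<alpha> x y
      using bopsD(1)[OF AB(1)[OF that(1)] that(2)] bopsD(1)[OF AB(2)[OF that(1)] that(2)] that(3)
      by (simp add: C_def H.ip_diff_left)
    have diff_Re: "Re (hip H (B \<alpha> x) y) - Re (hip H (A \<alpha> x) y) = Re (hip H (C \<alpha> x) y)"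
      if "\<alpha> \<in> lists {1..n}" "x \<in> hcarrier H" "y \<in> hcarrier H" for \<alpha> x y
      unfolding diff[OF that, symmetric] by simp
    let ?hA = "harmonic_fun \<X> H n A (Xs r) u" and ?hB = "harmonic_fun \<X> H n B (Xs r) u"
    have "hip XH (?hB - ?hA) u \<in> \<real>\<^sub>\<ge>\<^sub>0"
      using le[OF r] u unfolding op_le_def by blast
    then have "0 \<le> Re (hip XH ?hB u) - Re (hip XH ?hA u)"
      using fA(1) fB(1) u by (simp add: T.ip_diff_left complex_nonneg_Reals_iff)
    also have "\<dots> = (\<Sum>\<beta>\<in>insert [] ?W. Re (hip H (B [] (v \<beta>)) (v \<beta>)) - Re (hip H (A [] (v \<beta>)) (v \<beta>))) / 2 +
        r ^ k * (\<Sum>\<alpha>\<in>?W. Re (hip H (B \<alpha> (v [])) (v \<alpha>)) - Re (hip H (A \<alpha> (v [])) (v \<alpha>)))"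
      unfolding fA(2) fB(2) Re_complex_of_real sum_subtractf by (simp add: algebra_simps diff_divide_distrib)
    also have "\<dots> = (\<Sum>\<beta>\<in>insert [] ?W. Re (hip H (C [] (v \<beta>)) (v \<beta>))) / 2 +
        r ^ k * (\<Sum>\<alpha>\<in>?W. Re (hip H (C \<alpha> (v [])) (v \<alpha>)))"
      by (simp only: diff_Re[OF nil v v] diff_Re[OF W v v] cong: sum.cong)
    also have "(\<Sum>\<beta>\<in>insert [] ?W. Re (hip H (C [] (v \<beta>)) (v \<beta>))) =
        ?q + (\<Sum>\<alpha>\<in>?W. Re (hip H (C [] (v \<alpha>)) (v \<alpha>)))"
      using nil_W by (simp add: v_def)
    also have "(\<Sum>\<alpha>\<in>?W. Re (hip H (C \<alpha> (v [])) (v \<alpha>))) = (\<Sum>\<alpha>\<in>?W. - t * (hnorm H (C \<alpha> h))\<^sup>2)"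
    proof (rule sum.cong[OF refl])
      fix \<alpha> assume a: "\<alpha> \<in> ?W"
      note c = bopsD(1)[OF Cb[OF W[OF a]] h]
      have "\<alpha> \<noteq> []" using a nil_W by blast
      then have "hip H (C \<alpha> (v [])) (v \<alpha>) = of_real (- t * (hnorm H (C \<alpha> h))\<^sup>2)"
        using a c by (simp add: v_def H.ip_scale_right H.ip_self del: of_real_minus) simp
      then show "Re (hip H (C \<alpha> (v [])) (v \<alpha>)) = - t * (hnorm H (C \<alpha> h))\<^sup>2"
        by (simp only: Re_complex_of_real)
    qed
    also have "\<dots> = - t * ?S" by (simp only: sum_distrib_left)
    also have "(\<Sum>\<alpha>\<in>?W. Re (hip H (C [] (v \<alpha>)) (v \<alpha>))) \<le> (\<Sum>\<alpha>\<in>?W. ?M * (t\<^sup>2 * (hnorm H (C \<alpha> h))\<^sup>2))"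
    proof (rule sum_mono)
      fix \<alpha> assume a: "\<alpha> \<in> ?W"
      note c = bopsD(1)[OF Cb[OF W[OF a]] h]
      have "v \<alpha> = hscale H (of_real (- t)) (C \<alpha> h)" using a nil_W by (auto simp: v_def)
      then have "(hnorm H (v \<alpha>))\<^sup>2 = t\<^sup>2 * (hnorm H (C \<alpha> h))\<^sup>2"
        using c by (simp add: H.hnorm_scale power_mult_distrib del: of_real_minus)
      then show "Re (hip H (C [] (v \<alpha>)) (v \<alpha>)) \<le> ?M * (t\<^sup>2 * (hnorm H (C \<alpha> h))\<^sup>2)"
        using C0_le[OF v, of \<alpha>] by simp
    qed
    also have "\<dots> = t\<^sup>2 * ?M * ?S" by (simp add: sum_distrib_left mult_ac)
    finally show ?thesis by (simp add: algebra_simps)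
  qed
  have lim: "2 * t * ?S \<le> ?q + t\<^sup>2 * ?M * ?S" for t
  proof (rule LIMSEQ_le_const2)
    \<comment> \<open>The radii 1 - 1/(m + 1) start at 0 and stay below 1, so \<open>ineq\<close>
      applies to every m.\<close>
    have "(\<lambda>m. 2 * t * (1 - 1 / real (Suc m)) ^ k * ?S) \<longlonglongrightarrow> 2 * t * (1 - 0) ^ k * ?S"
      by (intro tendsto_intros LIMSEQ_inverse_real_of_nat[unfolded inverse_eq_divide])
    then show "(\<lambda>m. 2 * t * (1 - 1 / real (Suc m)) ^ k * ?S) \<longlonglongrightarrow> 2 * t * ?S" by simp
    show "\<exists>N. \<forall>m\<ge>N. 2 * t * (1 - 1 / real (Suc m)) ^ k * ?S \<le> ?q + t\<^sup>2 * ?M * ?S"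
      by (intro exI allI impI ineq) auto
  qed
  show ?thesis
  proof (cases "?M = 0")
    case True
    \<comment> \<open>With M = 0 the quadratic term disappears and q \<le> 0, so t = 1 already gives
      S \<le> 0.\<close>
    then show ?thesis using lim[of 1] C0_le[OF h] by simp
  next
    case False
    then have pos: "?M > 0" using M by simp
    have "2 * (1 / ?M) * ?S \<le> ?q + (1 / ?M)\<^sup>2 * ?M * ?S" by (rule lim)
    then have "?S / ?M \<le> ?q" using pos by (simp add: power2_eq_square)
    then show ?thesis using pos by (simp add: field_simps)
  qed
qed

end

section \<open>The Bohr inequality\<close>

text \<open>Summability belongs to the conclusion because \<open>suminf\<close> of a divergent
  series carries no information. The sums run over \<open>Suc k\<close> so that they start with
  words of length 1.\<close>

theorem theorem3p1:
  fixes H :: "'h::ab_group_add hspace"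
    and n :: nat
    and A B :: "nat list \<Rightarrow> 'h \<Rightarrow> 'h"
  assumes "hilbert_space H"
    and "n \<ge> 1"
    and "\<And>\<alpha>. set \<alpha> \<subseteq> {1..n} \<Longrightarrow> A \<alpha> \<in> bops H"
    and "\<And>\<alpha>. set \<alpha> \<subseteq> {1..n} \<Longrightarrow> B \<alpha> \<in> bops H"
    and "nc_harmonic TYPE('i::infinite \<Rightarrow> complex) H n A"
    and "nc_harmonic TYPE('i \<Rightarrow> complex) H n B"
    and "\<And>(X :: ('i \<Rightarrow> complex) hspace) Xs. hilbert_space X \<Longrightarrow> Xs \<in> op_ball X n \<Longrightarrow>
           op_le (tensor X H) (harmonic_fun X H n A Xs) (harmonic_fun X H n B Xs)"
  shows "(\<forall>k\<ge>1. op_le H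
             (\<Sum>\<alpha>\<in>words n k. adj H (B \<alpha> - A \<alpha>) \<circ> (B \<alpha> - A \<alpha>))
             (scale_op H (of_real (opnorm H (B [] - A []))) (B [] - A []))) \<and>
         (\<forall>r\<in>{0..1/3}.
            summable (\<lambda>k. r ^ Suc k * sqrt (opnorm H (\<Sum>\<alpha>\<in>words n (Suc k). adj H (A \<alpha>) \<circ> A \<alpha>))) \<and>
            summable (\<lambda>k. r ^ Suc k * sqrt (opnorm H (\<Sum>\<alpha>\<in>words n (Suc k). adj H (B \<alpha>) \<circ> B \<alpha>))) \<and>
            (\<Sum>k. r ^ Suc k * sqrt (opnorm H (\<Sum>\<alpha>\<in>words n (Suc k). adj H (A \<alpha>) \<circ> A \<alpha>)))
              \<le> 1/2 * opnorm H (B [] - A []) +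
                (\<Sum>k. r ^ Suc k * sqrt (opnorm H (\<Sum>\<alpha>\<in>words n (Suc k). adj H (B \<alpha>) \<circ> B \<alpha>))))"
proof -
  interpret H: hilbert_space H by fact
  \<comment> \<open>An infinite type receives an injection from the naturals, and lists of naturals
    are countable; the composition places all words in \<open>'i\<close>.\<close>
  obtain e :: "nat \<Rightarrow> 'i" where e: "inj e" using arb_countable_map[of "{}"] by auto
  define w :: "nat list \<Rightarrow> 'i" where "w = e \<circ> to_nat"
  have w: "inj w" unfolding w_def using e by (intro inj_compose) auto
  interpret fock_tensor H w by unfold_locales (rule w)
  let ?C = "\<lambda>\<alpha>. B \<alpha> - A \<alpha>"
  let ?M = "opnorm H (?C [])"
  let ?col = "\<lambda>D k. sqrt (opnorm H (\<Sum>\<alpha>\<in>words n k. adj H (D \<alpha>) \<circ> D \<alpha>))"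
  have A: "A \<in> lists {1..n} \<rightarrow> bops H" and B: "B \<in> lists {1..n} \<rightarrow> bops H"
    using assms(3,4) by (simp_all add: lists_eq_set)
  have C: "?C \<in> lists {1..n} \<rightarrow> bops H"
    using funcset_mem[OF A] funcset_mem[OF B] by (intro funcsetI H.bops_diff)
  have Cw: "D \<in> words n k \<rightarrow> bops H" if "D \<in> lists {1..n} \<rightarrow> bops H" for D k
    using that words_subset_lists by blast
  have nil: "[] \<in> lists {1..n}" by simp
  note A0 = funcset_mem[OF A nil] and B0 = funcset_mem[OF B nil] and C0 = funcset_mem[OF C nil]
  have M: "0 \<le> ?M" by (rule H.opnorm_nonneg[OF C0])
  have "hilbert_space \<X>" by unfold_locales
  then have "op_le XH (harmonic_fun \<X> H n A (Xs r)) (harmonic_fun \<X> H n B (Xs r))"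
    if "0 \<le> r" "r < 1" for r
    using that by (intro assms(7) Xs_in_op_ball)
  note key = col_square_le[OF assms(5,6) A B this]
  \<comment> \<open>\<open>op_le\<close> asks for a form in the nonnegative reals as a subset of the
    complex numbers, while the key inequality only knows real parts. Selfadjointness of the constant
    coefficients closes this gap.\<close>
  have C0_real: "hip H (?C [] x) x = of_real (Re (hip H (?C [] x) x))" if x: "x \<in> hcarrier H" for x
  proof -
    have "cnj (hip H (D x) x) = hip H (D x) x" if D: "D \<in> bops H" "adj H D = D" for D
      using H.adj_props(2)[OF D(1) x x] H.ip_cnj[OF bopsD(1)[OF D(1) x] x] D(2)
      by metis
    then have "cnj (hip H (A [] x) x) = hip H (A [] x) x" "cnj (hip H (B [] x) x) = hip H (B [] x) x"
      using A0 B0 assms(5,6) by (auto simp: nc_harmonic_def)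
    then have "cnj (hip H (?C [] x) x) = hip H (?C [] x) x"
      using bopsD(1)[OF A0 x] bopsD(1)[OF B0 x] x by (simp add: H.ip_diff_left)
    then show ?thesis by (metis Reals_cnj_iff of_real_Re)
  qed
  have first: "op_le H (\<Sum>\<alpha>\<in>words n k. adj H (?C \<alpha>) \<circ> ?C \<alpha>) (scale_op H (of_real ?M) (?C []))"
    if k: "k \<ge> 1" for k
    unfolding op_le_def
  proof
    fix x assume x: "x \<in> hcarrier H"
    let ?P = "\<Sum>\<alpha>\<in>words n k. adj H (?C \<alpha>) \<circ> ?C \<alpha>"
    have P: "?P \<in> bops H" by (rule H.col_square_bops[OF Cw[OF C]])
    have "hip H (scale_op H (of_real ?M) (?C []) x - ?P x) x =
        of_real ?M * hip H (?C [] x) x - hip H (?P x) x"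
      unfolding scale_op_def using bopsD(1)[OF P x] bopsD(1)[OF C0 x] x
      by (simp only: H.ip_diff_left H.ip_scale_left H.carrier_simps)
    also have "\<dots> = of_real (?M * Re (hip H (?C [] x) x) - (\<Sum>\<alpha>\<in>words n k. (hnorm H (?C \<alpha> x))\<^sup>2))"
      unfolding H.ip_col_square_self[OF Cw[OF C] x] of_real_diff of_real_mult C0_real[OF x, symmetric] ..
    finally show "hip H (scale_op H (of_real ?M) (?C []) x - ?P x) x \<in> \<real>\<^sub>\<ge>\<^sub>0"
      using key[OF _ _ k x] by (simp only: nonneg_Reals_of_real_iff) simp
  qed
  \<comment> \<open>Cauchy-Schwarz bounds q by M times the squared norm of \<open>x\<close>, so S
    \<le> M q becomes a bound M for the column of differences.\<close>
  have C_col: "L2_set (\<lambda>\<alpha>. hnorm H (?C \<alpha> x)) (words n k) \<le> ?M * hnorm H x"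
    if k: "k \<ge> 1" and x: "x \<in> hcarrier H" for k x
    unfolding L2_set_def
  proof (rule real_le_lsqrt)
    have "Re (hip H (?C [] x) x) \<le> hnorm H (?C [] x) * hnorm H x"
      using H.Cauchy_Schwarz[OF bopsD(1)[OF C0 x] x] complex_Re_le_cmod order_trans by blast
    also have "\<dots> \<le> ?M * hnorm H x * hnorm H x"
      using H.hnorm_apply_le_opnorm[OF C0 x] x by (intro mult_right_mono) auto
    finally have "?M * Re (hip H (?C [] x) x) \<le> ?M * (?M * hnorm H x * hnorm H x)"
      using M by (rule mult_left_mono)
    then show "(\<Sum>\<alpha>\<in>words n k. (hnorm H (?C \<alpha> x))\<^sup>2) \<le> (?M * hnorm H x)\<^sup>2"
      using key[OF _ _ k x] by (simp add: power2_eq_square mult_ac)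
  qed (use M x in simp)
  \<comment> \<open>Since A = B - (B - A), Minkowski's inequality for \<open>L2_set\<close> is the
    triangle inequality for the columns.\<close>
  have col_le: "?col A k \<le> ?col B k + ?M" if k: "k \<ge> 1" for k
  proof (rule H.sqrt_opnorm_col_le[OF Cw[OF A]])
    have "0 \<le> ?col B k" by (simp add: H.opnorm_nonneg[OF H.col_square_bops[OF Cw[OF B]]])
    then show "0 \<le> ?col B k + ?M" using M by simp
    fix x assume x: "x \<in> hcarrier H"
    have "L2_set (\<lambda>\<alpha>. hnorm H (A \<alpha> x)) (words n k) \<le>
        L2_set (\<lambda>\<alpha>. hnorm H (B \<alpha> x) + hnorm H (?C \<alpha> x)) (words n k)"
    proof (rule L2_set_mono)
      fix \<alpha> assume "\<alpha> \<in> words n k"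
      then have a: "A \<alpha> x \<in> hcarrier H" "B \<alpha> x \<in> hcarrier H"
        using funcset_mem[OF Cw[OF A]] funcset_mem[OF Cw[OF B]] bopsD(1) x by blast+
      then show "hnorm H (A \<alpha> x) \<le> hnorm H (B \<alpha> x) + hnorm H (?C \<alpha> x)"
        using H.hnorm_diff_triangle[of "B \<alpha> x" "?C \<alpha> x"] by simp
      show "0 \<le> hnorm H (A \<alpha> x)" using a by simp
    qed
    also have "\<dots> \<le> L2_set (\<lambda>\<alpha>. hnorm H (B \<alpha> x)) (words n k) + L2_set (\<lambda>\<alpha>. hnorm H (?C \<alpha> x)) (words n k)"
      by (rule L2_set_triangle_ineq)
    also have "\<dots> \<le> ?col B k * hnorm H x + ?M * hnorm H x"
      using H.L2_set_col_le[OF Cw[OF B] x] C_col[OF k x] by (rule add_mono)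
    finally show "L2_set (\<lambda>\<alpha>. hnorm H (A \<alpha> x)) (words n k) \<le> (?col B k + ?M) * hnorm H x"
      by (simp add: algebra_simps)
  qed
  have summ: "summable (\<lambda>k. r ^ Suc k * ?col D (Suc k))"
    if r: "0 \<le> r" "r \<le> 1/3" and D: "D \<in> lists {1..n} \<rightarrow> bops H"
      and harm: "nc_harmonic TYPE('i \<Rightarrow> complex) H n D" for r D
  proof -
    have hD: "half_const H D \<in> lists {1..n} \<rightarrow> bops H"
      using funcset_mem[OF D] H.bops_scale[OF funcset_mem[OF D nil]]
      by (intro funcsetI) (simp add: half_const_def)
    \<comment> \<open>Any radius strictly between 1/3 and 1 would serve. With 1/2 the column norms
      grow at most like 2^k, and r \<le> 1/3 leaves a geometric series of ratio 2/3.\<close>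
    obtain K where K: "0 \<le> K" "\<And>k. ?col (half_const H D) k \<le> K / (1/2) ^ k"
      by (rule col_bound[OF _ hD, of "1/2"]) (use harm in \<open>auto simp: nc_harmonic_def\<close>)
    have eq: "?col (half_const H D) (Suc k) = ?col D (Suc k)" for k
      by (intro arg_cong[of _ _ sqrt] arg_cong[of _ _ "opnorm H"] sum.cong refl)
        (auto simp: half_const_def words_def)
    show ?thesis
    proof (rule summable_comparison_test')
      show "summable (\<lambda>k. K * (2/3) ^ Suc k :: real)"
        by (intro summable_mult) (simp add: summable_Suc_iff summable_geometric)
      fix k :: nat
      have "0 \<le> ?col D (Suc k)" by (simp add: H.opnorm_nonneg[OF H.col_square_bops[OF Cw[OF D]]])
      moreover have "?col D (Suc k) \<le> K * 2 ^ Suc k"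
        using K(2)[of "Suc k"] unfolding eq by (simp add: power_one_over field_simps)
      moreover have "r ^ Suc k \<le> (1/3) ^ Suc k" using r by (intro power_mono) auto
      ultimately have "r ^ Suc k * ?col D (Suc k) \<le> (1/3) ^ Suc k * (K * 2 ^ Suc k)"
        using r by (intro mult_mono) auto
      also have "\<dots> = K * (2/3) ^ Suc k" by (simp add: power_divide)
      finally show "norm (r ^ Suc k * ?col D (Suc k)) \<le> K * (2/3) ^ Suc k"
        using r \<open>0 \<le> ?col D (Suc k)\<close> by simp
    qed
  qed
  have second: "(\<Sum>k. r ^ Suc k * ?col A (Suc k)) \<le> 1/2 * ?M + (\<Sum>k. r ^ Suc k * ?col B (Suc k))"
    if r: "0 \<le> r" "r \<le> 1/3" for r
  proof -
    note sA = summ[OF r A assms(5)] and sB = summ[OF r B assms(6)]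
    have geo: "(\<lambda>k. ?M * (r * r ^ k)) sums (?M * (r * (1 / (1 - r))))"
      using r by (intro sums_mult geometric_sums) simp
    have "(\<Sum>k. r ^ Suc k * ?col A (Suc k)) \<le> (\<Sum>k. ?M * (r * r ^ k) + r ^ Suc k * ?col B (Suc k))"
    proof (rule suminf_le[OF _ sA summable_add[OF sums_summable[OF geo] sB]])
      fix k
      have "r ^ Suc k * ?col A (Suc k) \<le> r ^ Suc k * (?col B (Suc k) + ?M)"
        using r by (intro mult_left_mono col_le) auto
      then show "r ^ Suc k * ?col A (Suc k) \<le> ?M * (r * r ^ k) + r ^ Suc k * ?col B (Suc k)"
        by (simp add: algebra_simps)
    qed
    also have "\<dots> = ?M * (r * (1 / (1 - r))) + (\<Sum>k. r ^ Suc k * ?col B (Suc k))"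
      unfolding suminf_add[OF sums_summable[OF geo] sB, symmetric] sums_unique[OF geo, symmetric] ..
    also have "\<dots> \<le> 1/2 * ?M + (\<Sum>k. r ^ Suc k * ?col B (Suc k))"
    proof (rule add_right_mono)
      \<comment> \<open>The quotient r / (1 - r) increases with r and equals 1/2 exactly at r = 1/3,
        which is where the Bohr radius comes from.\<close>
      have "r * (1 / (1 - r)) \<le> 1/2" using r by (simp add: field_simps)
      then have "?M * (r * (1 / (1 - r))) \<le> ?M * (1/2)" using M by (rule mult_left_mono)
      then show "?M * (r * (1 / (1 - r))) \<le> 1/2 * ?M" by simp
    qed
    finally show ?thesis .
  qed
  show ?thesis
    by (intro conjI allI impI ballI first summ[OF _ _ A assms(5)] summ[OF _ _ B assms(6)] second) auto
qed

end
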